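(* Let $n\ge2$ and let $(S_1,\dots,S_{n-1},P)$ be a c.n.u. $\Gamma_n$-contraction on a Hilbert space $\mathcal H$ such that $P^*$ commutes with each $S_i$, $1\le i\le n-1$. Let $\mathcal H=\mathcal H_1'\oplus\mathcal H_2'$ be the orthogonal decomposition in which $\mathcal H_1'$ is the maximal subspace of $\mathcal H$, invariant under $P$, such that $P|_{\mathcal H_1'}$ is a c.n.u. isometry. Then: (1) $\mathcal H_1'$ is a maximal joint invariant subspace for $S_1,\dots,S_{n-1}$ and $P$ such that $(S_1|_{\mathcal H_1'},\dots,S_{n-1}|_{\mathcal H_1'},P|_{\mathcal H_1'})$ is a c.n.u. $\Gamma_n$-isometry; (2) $\mathcal H_2'$ is a maximal joint invariant subspace for $S_1^*,\dots,S_{n-1}^*$ and $P^*$ such that $(S_1^*|_{\mathcal H_2'},\dots,S_{n-1}^*|_{\mathcal H_2'},P^*|_{\mathcal H_2'})$ is a c.n.u. $\Gamma_n$-contraction. The orthogonal decomposition $\mathcal H=\mathcal H_1'\oplus\mathcal H_2'$ is unique.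
   Context: All operators are bounded linear operators on complex Hilbert spaces; subspaces are closed. A compact set $K\subset\mathbb C^n$ is a spectral set for a commuting $n$-tuple $\underline T$ if the Taylor joint spectrum of $\underline T$ lies in $K$ and $\|f(\underline T)\|\le\sup_{K}|f|$ for every rational function $f$ with poles off $K$. The closed symmetrized polydisc is $\Gamma_n=\pi_n(\overline{\mathbb D}^n)$, where $\pi_n(z_1,\dots,z_n)=(\sum_i z_i,\sum_{i<j}z_iz_j,\dots,\prod_i z_i)$, and $b\Gamma_n=\pi_n(\mathbb T^n)$. A $\Gamma_n$-contraction is a commuting $n$-tuple $(S_1,\dots,S_{n-1},P)$ having $\Gamma_n$ as a spectral set (then $P$ is a contraction). A $\Gamma_n$-unitary is a commuting tuple of normal operators with Taylor joint spectrum contained in $b\Gamma_n$. A $\Gamma_n$-isometry is the restriction of a $\Gamma_n$-unitary to a joint invariant subspace. A contraction is c.n.u. (completely non-unitary) if no nonzero reducing subspace exists on which it is unitary; a $\Gamma_n$-contraction is c.n.u. if its last component is a c.n.u. contraction. Levan's theorem: for a c.n.u. contraction $P$ on $\mathcal H$ there is a unique orthogonal decomposition $\mathcal H=\mathcal H_1'\oplus\mathcal H_2'$ where $\mathcal H_1'$ is the maximal subspace such that $P|_{\mathcal H_1'}$ is a c.n.u. isometry, and $P^*|_{\mathcal H_2'}$ is a c.n.u. contraction; $\mathcal H_1'$ is invariant for $P$, $\mathcal H_2'$ is invariant for $P^*$, and $\lim_k\|P^kx\|<\|x\|$ for all nonzero $x\in\mathcal H_2'$. Explicitly, $\mathcal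 H_1'=\{h\in\mathcal H:\|P^kh\|=\|h\|\text{ for all }k\ge1\}$.
   Formalization: In (2), "maximal" is taken among joint invariant subspaces that also satisfy lim‖P^k x‖<‖x‖ for all nonzero x; otherwise H itself qualifies and (2) fails when H_1' is nonzero. Γ_n-isometries are extended inside ℓ²(H), which loses nothing. *)

theory Defs
  imports "HOL-Analysis.Analysis" "HOL-Library.Poly_Mapping"
begin

section \<open>Complex Hilbert spaces\<close>

text \<open>The scalar product is linear in its first argument. Positive definiteness is contained in
  \<open>cinner_self\<close>, and completeness in the superclass \<^class>\<open>banach\<close>.\<close>

class chilbert_space = banach +
  fixes scaleC :: "complex \<Rightarrow> 'a \<Rightarrow> 'a"  (infixr \<open>*\<^sub>C\<close> 75)
    and cinner :: "'a \<Rightarrow> 'a \<Rightarrow> complex"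
  assumes scaleC_add_right: "c *\<^sub>C (x + y) = c *\<^sub>C x + c *\<^sub>C y"
    and scaleC_add_left: "(c + d) *\<^sub>C x = c *\<^sub>C x + d *\<^sub>C x"
    and scaleC_scaleC: "c *\<^sub>C (d *\<^sub>C x) = (c * d) *\<^sub>C x"
    and scaleC_of_real: "complex_of_real r *\<^sub>C x = r *\<^sub>R x"
    and cinner_commute: "cinner x y = cnj (cinner y x)"
    and cinner_add_left: "cinner (x + y) z = cinner x z + cinner y z"
    and cinner_scaleC_left: "cinner (c *\<^sub>C x) y = c * cinner x y"
    and cinner_self: "cinner x x = complex_of_real ((norm x)\<^sup>2)"
begin

lemma cinner_add_right: "cinner x (y + z) = cinner x y + cinner x z"
  by (metis cinner_commute cinner_add_left complex_cnj_add)

lemma cinner_scaleC_right: "cinner x (c *\<^sub>C y) = cnj c * cinner x y"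
  by (metis cinner_commute cinner_scaleC_left complex_cnj_mult)

lemma norm_scaleC: "norm (c *\<^sub>C x) = cmod c * norm x"
proof -
  have "complex_of_real ((norm (c *\<^sub>C x))\<^sup>2) = (c * cnj c) * cinner x x"
    unfolding cinner_self[symmetric] by (simp add: cinner_scaleC_left cinner_scaleC_right)
  also have "\<dots> = complex_of_real ((cmod c * norm x)\<^sup>2)"
    unfolding cinner_self complex_norm_square[symmetric]
    by (simp only: power_mult_distrib of_real_mult of_real_power)
  finally have "(norm (c *\<^sub>C x))\<^sup>2 = (cmod c * norm x)\<^sup>2"
    using of_real_eq_iff by blast
  then show ?thesis by (simp add: power2_eq_iff_nonneg)
qed

lemma cinner_polarization:
  "4 * cinner x y = complex_of_real ((norm (x + y))\<^sup>2) - complex_of_real ((norm (x + (-1) *\<^sub>C y))\<^sup>2)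
     + \<i> * complex_of_real ((norm (x + \<i> *\<^sub>C y))\<^sup>2) - \<i> * complex_of_real ((norm (x + (- \<i>) *\<^sub>C y))\<^sup>2)"
  unfolding cinner_self[symmetric]
  by (simp add: cinner_add_left cinner_add_right cinner_scaleC_left cinner_scaleC_right algebra_simps)

end

instantiation complex :: chilbert_space
begin
definition scaleC_complex :: "complex \<Rightarrow> complex \<Rightarrow> complex" where "scaleC_complex c x = c * x"
definition cinner_complex :: "complex \<Rightarrow> complex \<Rightarrow> complex" where "cinner_complex x y = x * cnj y"
instance
proof
  show "cinner x x = complex_of_real ((norm x)\<^sup>2)" for x :: complex
    unfolding cinner_complex_def by (rule complex_norm_square[symmetric])
qed (simp_all add: scaleC_complex_def cinner_complex_def algebra_simps scaleR_conv_of_real)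
end


section \<open>The Hilbert space of square-summable sequences in a Hilbert space\<close>

typedef (overloaded) 'a l2 = "{f :: nat \<Rightarrow> 'a::chilbert_space. summable (\<lambda>k. (norm (f k))\<^sup>2)}"
  morphisms l2_nth Abs_l2
  by (rule exI[of _ "\<lambda>_. 0"]) simp

setup_lifting type_definition_l2

lemma l2_summable_add:
  fixes f g :: "nat \<Rightarrow> 'a::real_normed_vector"
  assumes "summable (\<lambda>k. (norm (f k))\<^sup>2)" "summable (\<lambda>k. (norm (g k))\<^sup>2)"
  shows "summable (\<lambda>k. (norm (f k + g k))\<^sup>2)"
proof (rule summable_comparison_test)
  show "\<exists>N. \<forall>k\<ge>N. norm ((norm (f k + g k))\<^sup>2) \<le> 2 * (norm (f k))\<^sup>2 + 2 * (norm (g k))\<^sup>2"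
  proof (intro exI allI impI)
    fix k :: nat
    have "(norm (f k + g k))\<^sup>2 \<le> (norm (f k) + norm (g k))\<^sup>2"
      by (intro power_mono norm_triangle_ineq) simp
    also have "\<dots> \<le> 2 * (norm (f k))\<^sup>2 + 2 * (norm (g k))\<^sup>2"
      using sum_squares_bound[of "norm (f k)" "norm (g k)"] by (simp add: power2_sum)
    finally show "norm ((norm (f k + g k))\<^sup>2) \<le> 2 * (norm (f k))\<^sup>2 + 2 * (norm (g k))\<^sup>2" by simp
  qed
  show "summable (\<lambda>k. 2 * (norm (f k))\<^sup>2 + 2 * (norm (g k))\<^sup>2)"
    by (intro summable_add summable_mult assms)
qed

lemma l2_summable_scaleC:
  fixes f :: "nat \<Rightarrow> 'a::chilbert_space"
  assumes "summable (\<lambda>k. (norm (f k))\<^sup>2)"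
  shows "summable (\<lambda>k. (norm (c *\<^sub>C f k))\<^sup>2)"
  using summable_mult[OF assms, of "(cmod c)\<^sup>2"] by (simp add: norm_scaleC power_mult_distrib)

lemma l2_summable_cinner:
  fixes f g :: "nat \<Rightarrow> 'a::chilbert_space"
  assumes f: "summable (\<lambda>k. (norm (f k))\<^sup>2)" and g: "summable (\<lambda>k. (norm (g k))\<^sup>2)"
  shows "summable (\<lambda>k. cinner (f k) (g k))"
proof -
  have s: "summable (\<lambda>k. complex_of_real ((norm (f k + c *\<^sub>C g k))\<^sup>2))" for c
    by (intro summable_of_real l2_summable_add l2_summable_scaleC f g)
  have s1: "summable (\<lambda>k. complex_of_real ((norm (f k + g k))\<^sup>2))"
    by (intro summable_of_real l2_summable_add f g)
  have "summable (\<lambda>k. 4 * cinner (f k) (g k))"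
    unfolding cinner_polarization by (intro summable_add summable_diff summable_mult s s1)
  from summable_mult[OF this, of "1/4"] show ?thesis by simp
qed

lemma l2_partial_sum:
  fixes f :: "nat \<Rightarrow> 'a::real_normed_vector"
  assumes "summable (\<lambda>k. (norm (f k))\<^sup>2)"
  shows "L2_set (\<lambda>k. norm (f k)) {..<N} \<le> sqrt (suminf (\<lambda>k. (norm (f k))\<^sup>2))"
  unfolding L2_set_def using assms by (intro real_sqrt_le_mono sum_le_suminf) auto

lemma l2_bound:
  fixes f :: "nat \<Rightarrow> 'a::real_normed_vector"
  assumes "\<And>N. L2_set (\<lambda>k. norm (f k)) {..<N} \<le> e"
  shows "summable (\<lambda>k. (norm (f k))\<^sup>2)" "sqrt (suminf (\<lambda>k. (norm (f k))\<^sup>2)) \<le> e"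
proof -
  have e0: "0 \<le> e" using assms[of 0] by simp
  have b: "(\<Sum>k<N. (norm (f k))\<^sup>2) \<le> e\<^sup>2" for N
    using assms[of N] unfolding L2_set_def by (simp add: sqrt_le_D)
  show s: "summable (\<lambda>k. (norm (f k))\<^sup>2)"
    by (rule summableI_nonneg_bounded[OF _ b]) simp
  have "(suminf (\<lambda>k. (norm (f k))\<^sup>2)) \<le> e\<^sup>2" by (rule suminf_le_const[OF s b])
  then show "sqrt (suminf (\<lambda>k. (norm (f k))\<^sup>2)) \<le> e" using e0 by (simp add: real_le_lsqrt suminf_nonneg s)
qed

instantiation l2 :: (chilbert_space) real_normed_vector
begin

lift_definition zero_l2 :: "'a l2" is "\<lambda>_. 0" by simp
lift_definition plus_l2 :: "'a l2 \<Rightarrow> 'a l2 \<Rightarrow> 'a l2" is "\<lambda>f g k. f k + g k"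
  by (rule l2_summable_add)
lift_definition uminus_l2 :: "'a l2 \<Rightarrow> 'a l2" is "\<lambda>f k. - f k" by simp
lift_definition minus_l2 :: "'a l2 \<Rightarrow> 'a l2 \<Rightarrow> 'a l2" is "\<lambda>f g k. f k - g k"
  subgoal for f g using l2_summable_add[of f "\<lambda>k. - g k"] by simp
  done
lift_definition scaleR_l2 :: "real \<Rightarrow> 'a l2 \<Rightarrow> 'a l2" is "\<lambda>r f k. r *\<^sub>R f k"
  using l2_summable_scaleC by (simp add: scaleC_of_real[symmetric])
lift_definition norm_l2 :: "'a l2 \<Rightarrow> real" is "\<lambda>f. sqrt (suminf (\<lambda>k. (norm (f k))\<^sup>2))" .
definition sgn_l2 :: "'a l2 \<Rightarrow> 'a l2" where "sgn_l2 x = inverse (norm x) *\<^sub>R x"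
definition dist_l2 :: "'a l2 \<Rightarrow> 'a l2 \<Rightarrow> real" where "dist_l2 x y = norm (x - y)"
definition uniformity_l2 :: "('a l2 \<times> 'a l2) filter"
  where [code del]: "uniformity_l2 = (INF e\<in>{0<..}. principal {(x, y). dist x y < e})"
definition open_l2 :: "'a l2 set \<Rightarrow> bool"
  where [code del]: "open_l2 U = (\<forall>x\<in>U. \<forall>\<^sub>F (x', y) in uniformity. x' = x \<longrightarrow> y \<in> U)"

instance
proof
  fix x y z :: "'a l2" and a b :: real
  show "x + y + z = x + (y + z)" by transfer (simp add: add.assoc)
  show "x + y = y + x" by transfer (simp add: add.commute)
  show "0 + x = x" by transfer simp
  show "- x + x = 0" by transfer simp
  show "x - y = x + - y" by transfer simp
  show "a *\<^sub>R (x + y) = a *\<^sub>R x + a *\<^sub>R y" by transfer (simp add: scaleR_add_right)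
  show "(a + b) *\<^sub>R x = a *\<^sub>R x + b *\<^sub>R x" by transfer (simp add: scaleR_add_left)
  show "a *\<^sub>R b *\<^sub>R x = (a * b) *\<^sub>R x" by transfer simp
  show "1 *\<^sub>R x = x" by transfer simp
  show "sgn x = inverse (norm x) *\<^sub>R x" by (rule sgn_l2_def)
  show "dist x y = norm (x - y)" by (rule dist_l2_def)
  show "uniformity = (INF e\<in>{0<..}. principal {(x::'a l2, y). dist x y < e})"
    by (rule uniformity_l2_def)
  show "open U = (\<forall>x\<in>U. \<forall>\<^sub>F (x', y) in uniformity. x' = x \<longrightarrow> y \<in> U)" for U :: "'a l2 set"
    by (rule open_l2_def)
  show "norm x = 0 \<longleftrightarrow> x = 0"
  proof (transfer, intro iffI)
    fix f :: "nat \<Rightarrow> 'a"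
    assume s: "summable (\<lambda>k. (norm (f k))\<^sup>2)" and "sqrt (suminf (\<lambda>k. (norm (f k))\<^sup>2)) = 0"
    then show "f = (\<lambda>_. 0)" using suminf_eq_zero_iff[OF s] by auto
  qed simp
  show "norm (x + y) \<le> norm x + norm y"
  proof transfer
    fix f g :: "nat \<Rightarrow> 'a"
    assume f: "summable (\<lambda>k. (norm (f k))\<^sup>2)" and g: "summable (\<lambda>k. (norm (g k))\<^sup>2)"
    show "sqrt (suminf (\<lambda>k. (norm (f k + g k))\<^sup>2)) \<le> sqrt (suminf (\<lambda>k. (norm (f k))\<^sup>2)) + sqrt (suminf (\<lambda>k. (norm (g k))\<^sup>2))"
    proof (rule l2_bound)
      fix N
      have "L2_set (\<lambda>k. norm (f k + g k)) {..<N} \<le> L2_set (\<lambda>k. norm (f k) + norm (g k)) {..<N}"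
        by (intro L2_set_mono norm_triangle_ineq) auto
      also have "\<dots> \<le> L2_set (\<lambda>k. norm (f k)) {..<N} + L2_set (\<lambda>k. norm (g k)) {..<N}"
        by (rule L2_set_triangle_ineq)
      also have "\<dots> \<le> sqrt (suminf (\<lambda>k. (norm (f k))\<^sup>2)) + sqrt (suminf (\<lambda>k. (norm (g k))\<^sup>2))"
        by (intro add_mono l2_partial_sum f g)
      finally show "L2_set (\<lambda>k. norm (f k + g k)) {..<N} \<le> \<dots>" .
    qed
  qed
  show "norm (a *\<^sub>R x) = \<bar>a\<bar> * norm x"
  proof transfer
    fix a and f :: "nat \<Rightarrow> 'a"
    assume s: "summable (\<lambda>k. (norm (f k))\<^sup>2)"
    then show "sqrt (suminf (\<lambda>k. (norm (a *\<^sub>R f k))\<^sup>2)) = \<bar>a\<bar> * sqrt (suminf (\<lambda>k. (norm (f k))\<^sup>2))"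
      by (simp add: power_mult_distrib suminf_mult real_sqrt_mult)
  qed
qed

end

lemma l2_nth_norm_le: "norm (l2_nth x k) \<le> norm x"
proof -
  have s: "summable (\<lambda>k. (norm (l2_nth x k))\<^sup>2)" using l2_nth[of x] by simp
  have "(norm (l2_nth x k))\<^sup>2 \<le> (suminf (\<lambda>k. (norm (l2_nth x k))\<^sup>2))"
    using sum_le_suminf[OF s, of "{k}"] by simp
  then show ?thesis unfolding norm_l2.rep_eq by (simp add: real_le_rsqrt)
qed

instance l2 :: (chilbert_space) banach
proof
  fix X :: "nat \<Rightarrow> 'a l2"
  assume X: "Cauchy X"
  have "Cauchy (\<lambda>m. l2_nth (X m) k)" for k
  proof (rule metric_CauchyI)
    fix e :: real assume "0 < e"
    then obtain M where M: "\<forall>m\<ge>M. \<forall>m'\<ge>M. dist (X m) (X m') < e" using metric_CauchyD[OF X] by blast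
    show "\<exists>M. \<forall>m\<ge>M. \<forall>m'\<ge>M. dist (l2_nth (X m) k) (l2_nth (X m') k) < e"
    proof (intro exI allI impI)
      fix m m' assume "M \<le> m" "M \<le> m'"
      then have "dist (X m) (X m') < e" using M by blast
      then show "dist (l2_nth (X m) k) (l2_nth (X m') k) < e"
        using l2_nth_norm_le[of "X m - X m'" k] by (simp add: dist_norm minus_l2.rep_eq)
    qed
  qed
  then have "\<forall>k. \<exists>l. (\<lambda>m. l2_nth (X m) k) \<longlonglongrightarrow> l"
    using Cauchy_convergent convergent_def by blast
  then obtain g where g: "\<And>k. (\<lambda>m. l2_nth (X m) k) \<longlonglongrightarrow> g k" by metis
  have key: "\<exists>M. \<forall>m\<ge>M. \<forall>N. L2_set (\<lambda>k. norm (l2_nth (X m) k - g k)) {..<N} \<le> e" if e: "0 < e" for e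
  proof -
    obtain M where M: "\<forall>m\<ge>M. \<forall>m'\<ge>M. dist (X m) (X m') < e"
      using metric_CauchyD[OF X e] by blast
    show ?thesis
    proof (intro exI allI impI)
      fix m N assume m: "M \<le> m"
      have lim: "(\<lambda>m'. L2_set (\<lambda>k. norm (l2_nth (X m) k - l2_nth (X m') k)) {..<N})
          \<longlonglongrightarrow> L2_set (\<lambda>k. norm (l2_nth (X m) k - g k)) {..<N}"
        unfolding L2_set_def by (intro tendsto_intros g)
      show "L2_set (\<lambda>k. norm (l2_nth (X m) k - g k)) {..<N} \<le> e"
      proof (rule LIMSEQ_le_const2[OF lim], intro exI allI impI)
        fix m' assume "M \<le> m'"
        with M m have "dist (X m) (X m') < e" by blast
        then have "norm (X m - X m') \<le> e" by (simp add: dist_norm)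
        then show "L2_set (\<lambda>k. norm (l2_nth (X m) k - l2_nth (X m') k)) {..<N} \<le> e"
          using l2_partial_sum[of "\<lambda>k. l2_nth (X m - X m') k" N] l2_nth[of "X m - X m'"]
          by (simp add: norm_l2.rep_eq minus_l2.rep_eq)
      qed
    qed
  qed
  obtain M1 where M1: "\<forall>m\<ge>M1. \<forall>N. L2_set (\<lambda>k. norm (l2_nth (X m) k - g k)) {..<N} \<le> 1"
    using key[OF zero_less_one] by blast
  have "summable (\<lambda>k. (norm (l2_nth (X M1) k - g k))\<^sup>2)"
    by (rule l2_bound(1)[of _ 1]) (use M1 in auto)
  then have "summable (\<lambda>k. (norm (- (l2_nth (X M1) k - g k) + l2_nth (X M1) k))\<^sup>2)"
    using l2_nth[of "X M1"] by (intro l2_summable_add) (simp_all add: norm_minus_commute)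
  then have gs: "summable (\<lambda>k. (norm (g k))\<^sup>2)" by simp
  define L where "L = Abs_l2 g"
  have L: "l2_nth L = g" unfolding L_def using gs by (simp add: Abs_l2_inverse)
  have "X \<longlonglongrightarrow> L"
  proof (rule LIMSEQ_I)
    fix e :: real assume e: "0 < e"
    then obtain M where M: "\<forall>m\<ge>M. \<forall>N. L2_set (\<lambda>k. norm (l2_nth (X m) k - g k)) {..<N} \<le> e/2"
      using key[OF half_gt_zero[OF e]] by blast
    show "\<exists>no. \<forall>n\<ge>no. norm (X n - L) < e"
    proof (intro exI allI impI)
      fix m assume "M \<le> m"
      then have "sqrt (suminf (\<lambda>k. (norm (l2_nth (X m) k - g k))\<^sup>2)) \<le> e/2"
        by (intro l2_bound(2)) (use M in auto)
      then show "norm (X m - L) < e" using e by (simp add: norm_l2.rep_eq minus_l2.rep_eq L)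
    qed
  qed
  then show "convergent X" by (rule convergentI)
qed

instantiation l2 :: (chilbert_space) chilbert_space
begin

lift_definition scaleC_l2 :: "complex \<Rightarrow> 'a l2 \<Rightarrow> 'a l2" is "\<lambda>c f k. c *\<^sub>C f k"
  by (rule l2_summable_scaleC)
lift_definition cinner_l2 :: "'a l2 \<Rightarrow> 'a l2 \<Rightarrow> complex" is "\<lambda>f g. suminf (\<lambda>k. cinner (f k) (g k))" .

instance
proof
  fix x y z :: "'a l2" and c d :: complex and r :: real
  show "c *\<^sub>C (x + y) = c *\<^sub>C x + c *\<^sub>C y" by transfer (simp add: scaleC_add_right)
  show "(c + d) *\<^sub>C x = c *\<^sub>C x + d *\<^sub>C x" by transfer (simp add: scaleC_add_left)
  show "c *\<^sub>C d *\<^sub>C x = (c * d) *\<^sub>C x" by transfer (simp add: scaleC_scaleC)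
  show "complex_of_real r *\<^sub>C x = r *\<^sub>R x" by transfer (simp add: scaleC_of_real)
  show "cinner x y = cnj (cinner y x)"
  proof transfer
    fix f g :: "nat \<Rightarrow> 'a"
    assume "summable (\<lambda>k. (norm (f k))\<^sup>2)" "summable (\<lambda>k. (norm (g k))\<^sup>2)"
    moreover have eq: "cnj (cinner (g k) (f k)) = cinner (f k) (g k)" for k
      by (rule cinner_commute[symmetric])
    ultimately have "(\<lambda>k. cinner (g k) (f k)) sums (suminf (\<lambda>k. cinner (g k) (f k)))"
      by (intro summable_sums l2_summable_cinner)
    then have "(\<lambda>k. cnj (cinner (g k) (f k))) sums cnj (suminf (\<lambda>k. cinner (g k) (f k)))"
      by (simp only: sums_cnj)
    then show "(suminf (\<lambda>k. cinner (f k) (g k))) = cnj (suminf (\<lambda>k. cinner (g k) (f k)))"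
      by (simp add: eq sums_iff)
  qed
  show "cinner (x + y) z = cinner x z + cinner y z"
    by transfer (simp add: cinner_add_left suminf_add l2_summable_cinner)
  show "cinner (c *\<^sub>C x) y = c * cinner x y"
    by transfer (simp add: cinner_scaleC_left suminf_mult l2_summable_cinner)
  show "cinner x x = complex_of_real ((norm x)\<^sup>2)"
    by transfer (simp add: cinner_self suminf_of_real suminf_nonneg del: of_real_power)
qed

end


section \<open>Closed subspaces and operators on them\<close>

text \<open>An operator on a closed subspace \<open>M\<close> of the ambient Hilbert space is a function
  \<open>T\<close> of which only the values on \<open>M\<close> matter. The restriction of an operator to an invariant
  closed subspace is therefore the same function, considered on the smaller subspace.\<close>

definition closed_csubspace :: "'a::chilbert_space set \<Rightarrow> bool" where
  "closed_csubspace M \<longleftrightarrow>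
     0 \<in> M \<and> (\<forall>x\<in>M. \<forall>y\<in>M. x + y \<in> M) \<and> (\<forall>c. \<forall>x\<in>M. c *\<^sub>C x \<in> M) \<and> closed M"

definition clinear_on :: "'a::chilbert_space set \<Rightarrow> ('a \<Rightarrow> 'b::chilbert_space) \<Rightarrow> bool" where
  "clinear_on M T \<longleftrightarrow>
     (\<forall>x\<in>M. \<forall>y\<in>M. T (x + y) = T x + T y) \<and> (\<forall>c. \<forall>x\<in>M. T (c *\<^sub>C x) = c *\<^sub>C T x)"

definition bounded_op_on :: "'a::chilbert_space set \<Rightarrow> ('a \<Rightarrow> 'a) \<Rightarrow> bool" where
  "bounded_op_on M T \<longleftrightarrow>
     T ` M \<subseteq> M \<and> clinear_on M T \<and> (\<exists>B. \<forall>x\<in>M. norm (T x) \<le> B * norm x)"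

text \<open>The Hilbert space adjoint of \<open>T\<close> as an operator on \<open>M\<close>.\<close>

definition adjoint_on :: "'a::chilbert_space set \<Rightarrow> ('a \<Rightarrow> 'a) \<Rightarrow> 'a \<Rightarrow> 'a" where
  "adjoint_on M T y = (THE z. z \<in> M \<and> (\<forall>x\<in>M. cinner (T x) y = cinner x z))"

abbreviation cadjoint :: "('a::chilbert_space \<Rightarrow> 'a) \<Rightarrow> 'a \<Rightarrow> 'a" where
  "cadjoint T \<equiv> adjoint_on UNIV T"

definition normal_on :: "'a::chilbert_space set \<Rightarrow> ('a \<Rightarrow> 'a) \<Rightarrow> bool" where
  "normal_on M T \<longleftrightarrow>
     bounded_op_on M T \<and> (\<forall>x\<in>M. adjoint_on M T (T x) = T (adjoint_on M T x))"

definition unitary_on :: "'a::chilbert_space set \<Rightarrow> ('a \<Rightarrow> 'a) \<Rightarrow> bool" where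
  "unitary_on M T \<longleftrightarrow>
     bounded_op_on M T \<and> (\<forall>x\<in>M. adjoint_on M T (T x) = x \<and> T (adjoint_on M T x) = x)"

definition contraction_on :: "'a::chilbert_space set \<Rightarrow> ('a \<Rightarrow> 'a) \<Rightarrow> bool" where
  "contraction_on M T \<longleftrightarrow> bounded_op_on M T \<and> (\<forall>x\<in>M. norm (T x) \<le> norm x)"

definition isometry_on :: "'a::chilbert_space set \<Rightarrow> ('a \<Rightarrow> 'a) \<Rightarrow> bool" where
  "isometry_on M T \<longleftrightarrow> bounded_op_on M T \<and> (\<forall>x\<in>M. norm (T x) = norm x)"

definition reducing_on :: "'a::chilbert_space set \<Rightarrow> ('a \<Rightarrow> 'a) \<Rightarrow> 'a set \<Rightarrow> bool" where
  "reducing_on M T N \<longleftrightarrow>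
     closed_csubspace N \<and> N \<subseteq> M \<and> T ` N \<subseteq> N \<and> adjoint_on M T ` N \<subseteq> N"

definition cnu_contraction_on :: "'a::chilbert_space set \<Rightarrow> ('a \<Rightarrow> 'a) \<Rightarrow> bool" where
  "cnu_contraction_on M T \<longleftrightarrow>
     contraction_on M T \<and> \<not> (\<exists>N. reducing_on M T N \<and> N \<noteq> {0} \<and> unitary_on N T)"

definition orthogonal_decomposition :: "'a::chilbert_space set \<Rightarrow> 'a set \<Rightarrow> bool" where
  "orthogonal_decomposition M N \<longleftrightarrow>
     closed_csubspace M \<and> closed_csubspace N \<and> (\<forall>x\<in>M. \<forall>y\<in>N. cinner x y = 0) \<and>
     (\<forall>z. \<exists>x\<in>M. \<exists>y\<in>N. z = x + y)"

definition maximal_subspace :: "('a::chilbert_space set \<Rightarrow> bool) \<Rightarrow> 'a set \<Rightarrow> bool" where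
  "maximal_subspace Q M \<longleftrightarrow>
     closed_csubspace M \<and> Q M \<and> (\<forall>N. closed_csubspace N \<and> Q N \<and> M \<subseteq> N \<longrightarrow> N = M)"


section \<open>Operator tuples and the Taylor joint spectrum\<close>

text \<open>An \<open>n\<close>-tuple is a function of which only the values on \<open>{1..n}\<close> matter; points of
  \<open>n\<close>-dimensional complex space are normalized to be extensional on \<open>{1..n}\<close>. On that set the
  product topology of \<^typ>\<open>nat \<Rightarrow> complex\<close> is the Euclidean one.\<close>

definition joint_invariant :: "nat \<Rightarrow> 'a set \<Rightarrow> (nat \<Rightarrow> 'a \<Rightarrow> 'a) \<Rightarrow> bool" where
  "joint_invariant n M T \<longleftrightarrow> (\<forall>i\<in>{1..n}. T i ` M \<subseteq> M)"

definition commuting_tuple_on ::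
    "nat \<Rightarrow> 'a::chilbert_space set \<Rightarrow> (nat \<Rightarrow> 'a \<Rightarrow> 'a) \<Rightarrow> bool" where
  "commuting_tuple_on n M T \<longleftrightarrow>
     (\<forall>i\<in>{1..n}. bounded_op_on M (T i)) \<and>
     (\<forall>i\<in>{1..n}. \<forall>j\<in>{1..n}. \<forall>x\<in>M. T i (T j x) = T j (T i x))"

text \<open>The Koszul complex of \<open>T\<close> on \<open>M\<close>, all degrees taken together. The form
  \<open>\<Sum>\<^sub>J x\<^sub>J \<otimes> e\<^sub>J\<close>, where \<open>e\<^sub>J = e\<^bsub>j1\<^esub> \<and> \<dots> \<and> e\<^bsub>jk\<^esub>\<close> for \<open>J = {j1 < \<dots> < jk}\<close>,
  is represented by its coefficients \<open>x\<^sub>J\<close>, and the differential is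
  \<open>x \<otimes> e\<^sub>J \<mapsto> \<Sum>\<^sub>j T\<^sub>j x \<otimes> (e\<^sub>j \<and> e\<^sub>J)\<close>.\<close>

definition koszul_space :: "nat \<Rightarrow> 'a set \<Rightarrow> (nat set \<Rightarrow> 'a) set" where
  "koszul_space n M = Pow {1..n} \<rightarrow>\<^sub>E M"

definition koszul_diff ::
    "nat \<Rightarrow> (nat \<Rightarrow> 'a::chilbert_space \<Rightarrow> 'a) \<Rightarrow> (nat set \<Rightarrow> 'a) \<Rightarrow> nat set \<Rightarrow> 'a" where
  "koszul_diff n T x =
     (\<lambda>J\<in>Pow {1..n}. \<Sum>j\<in>J. (-1) ^ card {i\<in>J. i < j} *\<^sub>C T j (x (J - {j})))"

definition koszul_exact :: "nat \<Rightarrow> 'a::chilbert_space set \<Rightarrow> (nat \<Rightarrow> 'a \<Rightarrow> 'a) \<Rightarrow> bool" where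
  "koszul_exact n M T \<longleftrightarrow>
     {x \<in> koszul_space n M. \<forall>J\<in>Pow {1..n}. koszul_diff n T x J = 0}
       = koszul_diff n T ` koszul_space n M"

definition taylor_spectrum ::
    "nat \<Rightarrow> 'a::chilbert_space set \<Rightarrow> (nat \<Rightarrow> 'a \<Rightarrow> 'a) \<Rightarrow> (nat \<Rightarrow> complex) set" where
  "taylor_spectrum n M T =
     {w \<in> {1..n} \<rightarrow>\<^sub>E UNIV. \<not> koszul_exact n M (\<lambda>i x. T i x - w i *\<^sub>C x)}"


section \<open>Rational functions and spectral sets\<close>

text \<open>A polynomial in the variables \<open>z\<^sub>1, z\<^sub>2, \<dots>\<close> maps exponent vectors to coefficients.\<close>

type_synonym cpoly = "(nat \<Rightarrow>\<^sub>0 nat) \<Rightarrow>\<^sub>0 complex"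

definition poly_vars_le :: "nat \<Rightarrow> cpoly \<Rightarrow> bool" where
  "poly_vars_le n p \<longleftrightarrow>
     (\<forall>m\<in>Poly_Mapping.keys p. Poly_Mapping.keys m \<subseteq> {1..n})"

definition poly_eval :: "nat \<Rightarrow> cpoly \<Rightarrow> (nat \<Rightarrow> complex) \<Rightarrow> complex" where
  "poly_eval n p z =
     (\<Sum>m\<in>Poly_Mapping.keys p. Poly_Mapping.lookup p m * (\<Prod>i=1..n. z i ^ Poly_Mapping.lookup m i))"

definition poly_op :: "nat \<Rightarrow> cpoly \<Rightarrow> (nat \<Rightarrow> 'a::chilbert_space \<Rightarrow> 'a) \<Rightarrow> 'a \<Rightarrow> 'a" where
  "poly_op n p T x =
     (\<Sum>m\<in>Poly_Mapping.keys p. Poly_Mapping.lookup p m *\<^sub>C foldr (\<lambda>i. T i ^^ Poly_Mapping.lookup m i) [1..<Suc n] x)"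

text \<open>\<open>f(T) = p(T) q(T)\<^sup>-\<^sup>1\<close> for \<open>f = p / q\<close>. If \<open>q\<close> has no zero on the Taylor
  spectrum of \<open>T\<close> on \<open>M\<close>, then \<open>q(T)\<close> is invertible on \<open>M\<close> by the spectral mapping theorem.\<close>

definition rational_op ::
    "nat \<Rightarrow> 'a::chilbert_space set \<Rightarrow> cpoly \<Rightarrow> cpoly \<Rightarrow> (nat \<Rightarrow> 'a \<Rightarrow> 'a) \<Rightarrow> 'a \<Rightarrow> 'a" where
  "rational_op n M p q T x = poly_op n p T (inv_into M (poly_op n q T) x)"

definition spectral_set_on ::
    "nat \<Rightarrow> 'a::chilbert_space set \<Rightarrow> (nat \<Rightarrow> complex) set \<Rightarrow> (nat \<Rightarrow> 'a \<Rightarrow> 'a) \<Rightarrow> bool" where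
  "spectral_set_on n M K T \<longleftrightarrow>
     K \<subseteq> {1..n} \<rightarrow>\<^sub>E UNIV \<and> compact K \<and> taylor_spectrum n M T \<subseteq> K \<and>
     (\<forall>p q. poly_vars_le n p \<and> poly_vars_le n q \<and> (\<forall>z\<in>K. poly_eval n q z \<noteq> 0) \<longrightarrow>
        (\<forall>x\<in>M. norm (rational_op n M p q T x)
                  \<le> (SUP z\<in>K. cmod (poly_eval n p z / poly_eval n q z)) * norm x))"


section \<open>The symmetrized polydisc and its operator classes\<close>

definition sym_map :: "nat \<Rightarrow> (nat \<Rightarrow> complex) \<Rightarrow> nat \<Rightarrow> complex" where
  "sym_map n z = (\<lambda>k\<in>{1..n}. \<Sum>J | J \<subseteq> {1..n} \<and> card J = k. \<Prod>j\<in>J. z j)"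

definition Gamma_set :: "nat \<Rightarrow> (nat \<Rightarrow> complex) set" where
  "Gamma_set n = sym_map n ` ({1..n} \<rightarrow>\<^sub>E cball 0 1)"

definition bGamma_set :: "nat \<Rightarrow> (nat \<Rightarrow> complex) set" where
  "bGamma_set n = sym_map n ` ({1..n} \<rightarrow>\<^sub>E sphere 0 1)"

definition Gamma_contraction_on ::
    "nat \<Rightarrow> 'a::chilbert_space set \<Rightarrow> (nat \<Rightarrow> 'a \<Rightarrow> 'a) \<Rightarrow> bool" where
  "Gamma_contraction_on n M T \<longleftrightarrow>
     commuting_tuple_on n M T \<and> spectral_set_on n M (Gamma_set n) T"

definition Gamma_unitary_on ::
    "nat \<Rightarrow> 'a::chilbert_space set \<Rightarrow> (nat \<Rightarrow> 'a \<Rightarrow> 'a) \<Rightarrow> bool" where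
  "Gamma_unitary_on n M T \<longleftrightarrow>
     commuting_tuple_on n M T \<and> (\<forall>i\<in>{1..n}. normal_on M (T i)) \<and>
     taylor_spectrum n M T \<subseteq> bGamma_set n"

text \<open>A \<open>\<Gamma>\<^sub>n\<close>-isometry on \<open>M\<close> is, up to the unitary identification \<open>V\<close> of \<open>M\<close> with a closed
  subspace of \<open>K\<close>, the restriction of a \<open>\<Gamma>\<^sub>n\<close>-unitary \<open>U\<close> on a Hilbert space \<open>K\<close> to a
  joint invariant subspace. HOL cannot quantify over all Hilbert spaces \<open>K\<close>, but letting \<open>K\<close> range over
  the closed subspaces of \<^typ>\<open>'a l2\<close> loses nothing: \<open>K\<close> may be replaced by the smallest subspace
  that contains \<open>V ` M\<close> and reduces every \<open>U\<^sub>i\<close>. This is the closed span of the images of \<open>V ` M\<close> under the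
  countably many monomials in the \<open>U\<^sub>i\<close> and \<open>U\<^sub>i\<^sup>*\<close>, so its Hilbert dimension is at most
  \<open>\<aleph>\<^sub>0 \<cdot> dim M\<close>, and it embeds isometrically into \<^typ>\<open>'a l2\<close>.\<close>

definition Gamma_isometry_on ::
    "nat \<Rightarrow> 'a::chilbert_space set \<Rightarrow> (nat \<Rightarrow> 'a \<Rightarrow> 'a) \<Rightarrow> bool" where
  "Gamma_isometry_on n M T \<longleftrightarrow>
     (\<forall>i\<in>{1..n}. bounded_op_on M (T i)) \<and>
     (\<exists>(K :: 'a l2 set) U V.
        closed_csubspace K \<and> Gamma_unitary_on n K U \<and>
        clinear_on M V \<and> (\<forall>x\<in>M. norm (V x) = norm x) \<and> V ` M \<subseteq> K \<and>
        (\<forall>i\<in>{1..n}. \<forall>x\<in>M. U i (V x) = V (T i x)))"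

definition cnu_Gamma_contraction_on ::
    "nat \<Rightarrow> 'a::chilbert_space set \<Rightarrow> (nat \<Rightarrow> 'a \<Rightarrow> 'a) \<Rightarrow> bool" where
  "cnu_Gamma_contraction_on n M T \<longleftrightarrow>
     Gamma_contraction_on n M T \<and> cnu_contraction_on M (T n)"

definition cnu_Gamma_isometry_on ::
    "nat \<Rightarrow> 'a::chilbert_space set \<Rightarrow> (nat \<Rightarrow> 'a \<Rightarrow> 'a) \<Rightarrow> bool" where
  "cnu_Gamma_isometry_on n M T \<longleftrightarrow>
     Gamma_isometry_on n M T \<and> cnu_contraction_on M (T n)"


section \<open>Levan-type decompositions\<close>

definition maximal_cnu_isometry_subspace ::
    "('a::chilbert_space \<Rightarrow> 'a) \<Rightarrow> 'a set \<Rightarrow> bool" where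
  "maximal_cnu_isometry_subspace P = maximal_subspace
     (\<lambda>M. P ` M \<subseteq> M \<and> isometry_on M P \<and> cnu_contraction_on M P)"

definition maximal_cnu_Gamma_isometry_subspace ::
    "nat \<Rightarrow> (nat \<Rightarrow> 'a::chilbert_space \<Rightarrow> 'a) \<Rightarrow> 'a set \<Rightarrow> bool" where
  "maximal_cnu_Gamma_isometry_subspace n T = maximal_subspace
     (\<lambda>M. joint_invariant n M T \<and> cnu_Gamma_isometry_on n M T)"

text \<open>The co-invariant counterpart, for the tuple of adjoints. The property
  \<open>lim \<parallel>P\<^sup>k x\<parallel> < \<parallel>x\<parallel>\<close> for \<open>x \<noteq> 0\<close>, where \<open>P = T\<^sub>n\<close>, is the one that
  distinguishes the second summand of Levan's decomposition. It cannot be omitted from the class in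
  which the summand is maximal: the adjoints of a c.n.u. \<open>\<Gamma>\<^sub>n\<close>-contraction again form a
  c.n.u. \<open>\<Gamma>\<^sub>n\<close>-contraction, so without it the only maximal subspace would be the whole space.\<close>

definition maximal_cnu_Gamma_contraction_cosubspace ::
    "nat \<Rightarrow> (nat \<Rightarrow> 'a::chilbert_space \<Rightarrow> 'a) \<Rightarrow> 'a set \<Rightarrow> bool" where
  "maximal_cnu_Gamma_contraction_cosubspace n T = maximal_subspace
     (\<lambda>M. joint_invariant n M (\<lambda>i. cadjoint (T i)) \<and>
          cnu_Gamma_contraction_on n M (\<lambda>i. cadjoint (T i)) \<and>
          (\<forall>x\<in>M. x \<noteq> 0 \<longrightarrow> lim (\<lambda>k. norm ((T n ^^ k) x)) < norm x))"

end

theory Submission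
  imports Defs "HOL-Complex_Analysis.Conformal_Mappings"
    "HOL-Computational_Algebra.Fundamental_Theorem_Algebra"
begin

text \<open>
  Write \<open>P = T\<^sub>n\<close>, and let \<open>M = {x. \<parallel>P\<^sup>k x\<parallel> = \<parallel>x\<parallel> for all k}\<close> be the isometric part of the contraction \<open>P\<close>.
  It is the largest invariant subspace on which \<open>P\<close> acts isometrically, hence it is the
  summand \<open>H\<^sub>1'\<close>. As \<open>M\<close> is the set of all \<open>x\<close> with \<open>P\<^sup>*\<^sup>k P\<^sup>k x = x\<close>, every operator that commutes with \<open>P\<close> and \<open>P\<^sup>*\<close>
  maps \<open>M\<close> into itself; thus \<open>M\<close> reduces \<open>S\<^sub>1, \<dots>, S\<^sub>n\<^sub>-\<^sub>1\<close>.

  In fact \<open>S\<^sub>i\<close> vanishes on \<open>M\<close>. Von Neumann's inequality for the polynomial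
  \<open>s\<^sub>n + t (e s\<^sub>i s\<^sub>n - e\<^sup>* s\<^sub>n\<^sub>-\<^sub>i)\<close>, whose modulus is at most \<open>1 + O(t\<^sup>2)\<close> on \<open>\<Gamma>\<^sub>n\<close>, yields in first order \<open>S\<^sub>i = S\<^sub>n\<^sub>-\<^sub>i\<^sup>* P\<close>
  on \<open>M\<close> (\<open>fundamental_relation\<close>). Since \<open>P\<close> commutes with \<open>S\<^sub>i\<close> and with \<open>S\<^sub>i\<^sup>*\<close>, it follows that \<open>S\<^sub>i\<close> maps \<open>M\<close> into \<open>P\<^sup>k M\<close> for every
  \<open>k\<close>; but \<open>P\<close> is unitary on the intersection of these spaces, which is therefore \<open>0\<close>
  (\<open>isometric_part_T_zero\<close>). A tuple \<open>(0, \<dots>, 0, P)\<close> with an isometry \<open>P\<close> is the restriction of \<open>(0, \<dots>, 0, W)\<close> with a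
  unitary extension \<open>W\<close> of \<open>P\<close>, and the Taylor spectrum of the latter lies in \<open>{0} \<times> \<dots> \<times> {0} \<times> \<T>\<close>, which is part
  of \<open>b\<Gamma>\<^sub>n\<close> because of the \<open>n\<close>-th roots of unimodular numbers. This gives the \<open>\<Gamma>\<^sub>n\<close>-isometry.

  For its maximality, the last component of a \<open>\<Gamma>\<^sub>n\<close>-unitary has to be isometric (\<open>Gamma_unitary_last_isometric\<close>).
  Otherwise there are joint approximate eigenvectors of the tuple for a joint eigenvalue \<open>w\<close> with \<open>|w\<^sub>n| \<noteq> 1\<close>. They
  are found one operator after the other by an extremal argument (\<open>approx_null_insert_modulus\<close>), which replaces
  the spectral theorem, and a gliding hump shows that such a \<open>w\<close> belongs to the Taylor spectrum.

  The second summand rests on the criterion \<open>gamma_tuple.Gamma_contraction\<close>: a commuting tuple is a \<open>\<Gamma>\<^sub>n\<close>-contraction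
  as soon as von Neumann's inequality on \<open>\<Gamma>\<^sub>n\<close> holds for polynomials. This condition passes to adjoints and to
  invariant subspaces, in particular to the adjoint tuple on the orthogonal complement of \<open>M\<close>. The criterion
  holds since the reciprocal of a polynomial without zeros on \<open>\<Gamma>\<^sub>n\<close> is a uniform limit of polynomials there
  (\<open>poly_invertible_on_Gamma\<close>), so that \<open>q(T)\<close> is invertible for such \<open>q\<close>; and a point \<open>w\<close> outside \<open>\<Gamma>\<^sub>n\<close> is
  separated from \<open>\<Gamma>\<^sub>n\<close> by a polynomial \<open>q\<close> of degree one, for which the invertible operator \<open>q(T)\<close> is a linear
  combination of the \<open>T\<^sub>i - w\<^sub>i\<close>. This makes the Koszul complex exact (\<open>koszul_exact_if_bij\<close>).

  Finally, \<open>lim \<parallel>P\<^sup>k x\<parallel> < \<parallel>x\<parallel>\<close> holds if and only if \<open>x \<notin> M\<close>. Hence a subspace that contains the complement of \<open>M\<close>, and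
  on whose nonzero vectors this inequality holds, meets \<open>M\<close> only in \<open>0\<close> and equals the complement.
  Uniqueness holds because the maximality properties of the first summand characterize \<open>M\<close>.
\<close>

section \<open>Geometry of complex Hilbert spaces\<close>

lemma scaleC_one [simp]: "1 *\<^sub>C x = (x::'a::chilbert_space)"
  using scaleC_of_real[of 1 x] by simp

lemma scaleC_zero_left [simp]: "0 *\<^sub>C x = (0::'a::chilbert_space)"
  using scaleC_of_real[of 0 x] by simp

lemma scaleC_zero_right [simp]: "c *\<^sub>C (0::'a::chilbert_space) = 0"
  using scaleC_add_right[of c "0::'a" 0] by simp

lemma scaleC_minus_right [simp]: "c *\<^sub>C (- x) = - (c *\<^sub>C (x::'a::chilbert_space))"
  by (metis add.right_inverse add_eq_0_iff scaleC_add_right scaleC_zero_right)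

lemma scaleC_minus_left [simp]: "(- c) *\<^sub>C x = - (c *\<^sub>C (x::'a::chilbert_space))"
  by (metis add.right_inverse add_eq_0_iff scaleC_add_left scaleC_zero_left)

lemma scaleC_diff_right: "c *\<^sub>C (x - y) = c *\<^sub>C x - c *\<^sub>C (y::'a::chilbert_space)"
  using scaleC_add_right[of c x "- y"] by simp

lemma scaleC_diff_left: "(c - d) *\<^sub>C x = c *\<^sub>C x - d *\<^sub>C (x::'a::chilbert_space)"
  using scaleC_add_left[of c "- d" x] by simp

lemma scaleC_sum_right: "c *\<^sub>C (\<Sum>i\<in>I. f i) = (\<Sum>i\<in>I. c *\<^sub>C (f i::'a::chilbert_space))"
  by (induction I rule: infinite_finite_induct) (auto simp: scaleC_add_right)

lemma scaleC_sum_left: "(\<Sum>i\<in>I. f i) *\<^sub>C x = (\<Sum>i\<in>I. f i *\<^sub>C (x::'a::chilbert_space))"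
  by (induction I rule: infinite_finite_induct) (auto simp: scaleC_add_left)

lemma cinner_zero_left [simp]: "cinner 0 (x::'a::chilbert_space) = 0"
  using cinner_add_left[of "0::'a" 0 x] by simp

lemma cinner_zero_right [simp]: "cinner (x::'a::chilbert_space) 0 = 0"
  using cinner_add_right[of x 0 0] by simp

lemma cinner_minus_left [simp]: "cinner (- x) (y::'a::chilbert_space) = - cinner x y"
  by (metis add.right_inverse add_eq_0_iff cinner_add_left cinner_zero_left)

lemma cinner_minus_right [simp]: "cinner (x::'a::chilbert_space) (- y) = - cinner x y"
  by (metis add.right_inverse add_eq_0_iff cinner_add_right cinner_zero_right)

lemma cinner_diff_left: "cinner (x - y) (z::'a::chilbert_space) = cinner x z - cinner y z"
  using cinner_add_left[of x "- y" z] by simp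

lemma cinner_diff_right: "cinner (x::'a::chilbert_space) (y - z) = cinner x y - cinner x z"
  using cinner_add_right[of x y "- z"] by simp

lemma cinner_sum_left: "cinner (\<Sum>i\<in>I. f i) (x::'a::chilbert_space) = (\<Sum>i\<in>I. cinner (f i) x)"
  by (induction I rule: infinite_finite_induct) (auto simp: cinner_add_left)

lemma cinner_sum_right: "cinner (x::'a::chilbert_space) (\<Sum>i\<in>I. f i) = (\<Sum>i\<in>I. cinner x (f i))"
  by (induction I rule: infinite_finite_induct) (auto simp: cinner_add_right)

lemma cinner_eq_zero_iff [simp]: "cinner x x = 0 \<longleftrightarrow> (x::'a::chilbert_space) = 0"
  by (simp add: cinner_self)

lemma Re_cinner_self: "Re (cinner x x) = (norm (x::'a::chilbert_space))\<^sup>2"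
  by (simp add: cinner_self)

lemmas cinner_simps = cinner_add_left cinner_add_right cinner_diff_left cinner_diff_right
  cinner_scaleC_left cinner_scaleC_right

lemma norm_add_sq:
  "(norm (x + y))\<^sup>2 = (norm x)\<^sup>2 + 2 * Re (cinner x y) + (norm (y::'a::chilbert_space))\<^sup>2"
proof -
  have "Re (cinner y x) = Re (cinner x y)" by (metis cinner_commute cnj.simps(1))
  then show ?thesis
    unfolding Re_cinner_self[symmetric] by (simp add: cinner_simps)
qed

lemma norm_diff_sq:
  "(norm (x - y))\<^sup>2 = (norm x)\<^sup>2 - 2 * Re (cinner x y) + (norm (y::'a::chilbert_space))\<^sup>2"
  using norm_add_sq[of x "- y"] by simp

lemma cinner_eq_zero_commute: "cinner x y = 0 \<Longrightarrow> cinner y (x::'a::chilbert_space) = 0"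
  by (metis cinner_commute complex_cnj_zero)

text \<open>The vector subtracted from \<open>x\<close> is its projection to the line spanned by \<open>y\<close>. The identity gives both the
  Cauchy-Schwarz inequality and the orthogonality of the residual of a best approximation.\<close>

lemma norm_diff_line_sq:
  fixes x y :: "'a::chilbert_space"
  assumes "y \<noteq> 0"
  shows "(norm (x - (cinner x y / complex_of_real ((norm y)\<^sup>2)) *\<^sub>C y))\<^sup>2
    = (norm x)\<^sup>2 - (cmod (cinner x y))\<^sup>2 / (norm y)\<^sup>2"
proof -
  define c where "c = cinner x y / complex_of_real ((norm y)\<^sup>2)"
  have "cinner x (c *\<^sub>C y) = complex_of_real ((cmod (cinner x y))\<^sup>2 / (norm y)\<^sup>2)"
    using complex_norm_square[of "cinner x y"]
    by (simp add: cinner_scaleC_right c_def mult.commute)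
  then have "Re (cinner x (c *\<^sub>C y)) = (cmod (cinner x y))\<^sup>2 / (norm y)\<^sup>2" by (metis Re_complex_of_real)
  moreover have "cmod c = cmod (cinner x y) / (norm y)\<^sup>2" by (simp add: c_def norm_divide norm_power)
  then have "(norm (c *\<^sub>C y))\<^sup>2 = (cmod (cinner x y))\<^sup>2 / (norm y)\<^sup>2"
    using assms by (simp add: norm_scaleC power_mult_distrib power_divide power4_eq_xxxx power2_eq_square)
  ultimately show ?thesis unfolding c_def[symmetric] norm_diff_sq by simp
qed

lemma cauchy_schwarz: "cmod (cinner x y) \<le> norm x * norm (y::'a::chilbert_space)"
proof (cases "y = 0")
  case False
  then have "(cmod (cinner x y))\<^sup>2 / (norm y)\<^sup>2 \<le> (norm x)\<^sup>2"
    using norm_diff_line_sq[OF False, of x] by (metis diff_ge_0_iff_ge zero_le_power2)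
  then have "(cmod (cinner x y))\<^sup>2 \<le> (norm x * norm y)\<^sup>2"
    using False by (simp add: divide_le_eq power_mult_distrib)
  then show ?thesis by (rule power2_le_imp_le) simp
qed simp

lemma cinner_scaleR_left: "cinner (r *\<^sub>R x) (y::'a::chilbert_space) = r *\<^sub>R cinner x y"
  by (simp flip: scaleC_of_real add: cinner_scaleC_left scaleC_complex_def)

lemma bounded_linear_cinner_left: "bounded_linear (\<lambda>x. cinner x (y::'a::chilbert_space))"
  by (rule bounded_linear_intro[where K = "norm y"])
     (simp_all add: cinner_add_left cinner_scaleR_left cauchy_schwarz)

lemma cinner_ext_on:
  assumes "closed_csubspace M" "(x::'a::chilbert_space) \<in> M" "y \<in> M" "\<And>z. z \<in> M \<Longrightarrow> cinner z x = cinner z y"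
  shows "x = y"
proof -
  have "x - y \<in> M"
    using assms(1-3) unfolding closed_csubspace_def
    by (metis add_uminus_conv_diff scaleC_minus_left scaleC_one)
  then have "cinner (x - y) (x - y) = 0" using assms(4) by (simp add: cinner_diff_right)
  then show ?thesis by simp
qed

text \<open>Over the complex numbers the quadratic form determines the operator.\<close>

lemma quadratic_form_zero:
  assumes M: "closed_csubspace M" and B: "clinear_on M B" "B ` M \<subseteq> M"
    and q: "\<And>x. x \<in> M \<Longrightarrow> cinner (B x) (x::'a::chilbert_space) = 0" and x: "x \<in> M"
  shows "B x = 0"
proof -
  let ?y = "B x"
  have y: "?y \<in> M" using B x by auto
  have iy: "\<i> *\<^sub>C ?y \<in> M" using y M unfolding closed_csubspace_def by blast
  have "cinner (B (x + ?y)) (x + ?y) = 0" "cinner (B (x + \<i> *\<^sub>C ?y)) (x + \<i> *\<^sub>C ?y) = 0"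
    using q M x y iy unfolding closed_csubspace_def by blast+
  moreover have "B (x + ?y) = B x + B ?y" "B (x + \<i> *\<^sub>C ?y) = B x + \<i> *\<^sub>C B ?y"
    using B(1) x y iy unfolding clinear_on_def by auto
  ultimately have "cinner ?y ?y + cinner (B ?y) x = 0" "- (\<i> * cinner ?y ?y) + \<i> * cinner (B ?y) x = 0"
    using q[OF x] q[OF y] by (auto simp: cinner_simps algebra_simps)
  moreover from this have "\<i> * (cinner (B ?y) x - cinner ?y ?y) = 0" by (simp add: algebra_simps)
  ultimately have "cinner ?y ?y = 0" by simp
  then show ?thesis by simp
qed

section \<open>Closed subspaces, bounded operators, adjoints\<close>

lemma csubspace_0: "closed_csubspace M \<Longrightarrow> 0 \<in> M"
  and csubspace_add: "closed_csubspace M \<Longrightarrow> x \<in> M \<Longrightarrow> y \<in> M \<Longrightarrow> x + y \<in> M"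
  and csubspace_scaleC: "closed_csubspace M \<Longrightarrow> x \<in> M \<Longrightarrow> c *\<^sub>C x \<in> M"
  and csubspace_closed: "closed_csubspace M \<Longrightarrow> closed M"
  by (auto simp: closed_csubspace_def)

lemma csubspace_minus: "closed_csubspace M \<Longrightarrow> x \<in> M \<Longrightarrow> - x \<in> M"
  by (metis csubspace_scaleC scaleC_minus_left scaleC_one)

lemma csubspace_diff: "closed_csubspace M \<Longrightarrow> x \<in> M \<Longrightarrow> y \<in> M \<Longrightarrow> x - y \<in> M"
  using csubspace_add[of M x "- y"] csubspace_minus by auto

lemma csubspace_scaleR: "closed_csubspace M \<Longrightarrow> x \<in> M \<Longrightarrow> r *\<^sub>R x \<in> M"
  by (metis csubspace_scaleC scaleC_of_real)

lemma csubspace_sum: "closed_csubspace M \<Longrightarrow> (\<And>i. i \<in> I \<Longrightarrow> f i \<in> M) \<Longrightarrow> (\<Sum>i\<in>I. f i) \<in> M"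
  by (induction I rule: infinite_finite_induct) (auto simp: csubspace_0 csubspace_add)

lemmas csubspace_intros = csubspace_0 csubspace_add csubspace_scaleC csubspace_minus csubspace_diff
  csubspace_scaleR csubspace_sum

lemma csubspace_UNIV [simp]: "closed_csubspace UNIV"
  by (simp add: closed_csubspace_def)

lemma csubspace_limit:
  "closed_csubspace M \<Longrightarrow> X \<longlonglongrightarrow> l \<Longrightarrow> (\<And>k. X k \<in> M) \<Longrightarrow> l \<in> M"
  by (meson closed_sequentially csubspace_closed)

context
  fixes M :: "'a::chilbert_space set" and T :: "'a \<Rightarrow> 'b::chilbert_space"
  assumes M: "closed_csubspace M" and T: "clinear_on M T"
begin

lemma clinear_on_add: "x \<in> M \<Longrightarrow> y \<in> M \<Longrightarrow> T (x + y) = T x + T y"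
  using T by (auto simp: clinear_on_def)

lemma clinear_on_scaleC: "x \<in> M \<Longrightarrow> T (c *\<^sub>C x) = c *\<^sub>C T x"
  using T by (auto simp: clinear_on_def)

lemma clinear_on_0: "T 0 = 0"
  using clinear_on_scaleC[OF csubspace_0[OF M], of 0] by simp

lemma clinear_on_minus: "x \<in> M \<Longrightarrow> T (- x) = - T x"
  using clinear_on_scaleC[of x "-1"] by simp

lemma clinear_on_diff: "x \<in> M \<Longrightarrow> y \<in> M \<Longrightarrow> T (x - y) = T x - T y"
  using clinear_on_add[of x "- y"] csubspace_minus[OF M] clinear_on_minus by simp

lemma clinear_on_sum: "(\<And>i. i \<in> I \<Longrightarrow> f i \<in> M) \<Longrightarrow> T (\<Sum>i\<in>I. f i) = (\<Sum>i\<in>I. T (f i))"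
  by (induction I rule: infinite_finite_induct) (auto simp: clinear_on_0 clinear_on_add csubspace_sum M)

end

lemma clinear_on_lincomb:
  assumes M: "closed_csubspace M" and T: "clinear_on M T" and f: "\<And>i. i \<in> I \<Longrightarrow> f i \<in> M"
  shows "T (\<Sum>i\<in>I. c i *\<^sub>C f i) = (\<Sum>i\<in>I. c i *\<^sub>C T (f i))"
proof -
  have "T (\<Sum>i\<in>I. c i *\<^sub>C f i) = (\<Sum>i\<in>I. T (c i *\<^sub>C f i))"
    by (rule clinear_on_sum[OF M T]) (rule csubspace_scaleC[OF M f])
  also have "\<dots> = (\<Sum>i\<in>I. c i *\<^sub>C T (f i))"
    by (intro sum.cong refl clinear_on_scaleC[OF M T] f)
  finally show ?thesis .
qed

lemma bounded_op_onD:
  assumes "bounded_op_on M T"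
  shows "clinear_on M T" "x \<in> M \<Longrightarrow> T x \<in> M"
  using assms by (auto simp: bounded_op_on_def)

lemma bop_add: "closed_csubspace M \<Longrightarrow> bounded_op_on M T \<Longrightarrow> x \<in> M \<Longrightarrow> y \<in> M \<Longrightarrow> T (x + y) = T x + T y"
  and bop_diff: "closed_csubspace M \<Longrightarrow> bounded_op_on M T \<Longrightarrow> x \<in> M \<Longrightarrow> y \<in> M \<Longrightarrow> T (x - y) = T x - T y"
  and bop_scaleC: "closed_csubspace M \<Longrightarrow> bounded_op_on M T \<Longrightarrow> x \<in> M \<Longrightarrow> T (c *\<^sub>C x) = c *\<^sub>C T x"
  and bop_0: "closed_csubspace M \<Longrightarrow> bounded_op_on M T \<Longrightarrow> T 0 = 0"
  by (simp_all add: clinear_on_add clinear_on_diff clinear_on_scaleC clinear_on_0 bounded_op_onD(1))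

lemma bop_sum:
  "closed_csubspace M \<Longrightarrow> bounded_op_on M T \<Longrightarrow> (\<And>i. i \<in> I \<Longrightarrow> f i \<in> M) \<Longrightarrow> T (\<Sum>i\<in>I. f i) = (\<Sum>i\<in>I. T (f i))"
  by (simp add: clinear_on_sum bounded_op_onD(1))

lemma bounded_op_on_bound:
  assumes "bounded_op_on M T"
  shows "\<exists>B>0. \<forall>x\<in>M. norm (T x) \<le> B * norm x"
proof -
  obtain B where B: "\<forall>x\<in>M. norm (T x) \<le> B * norm x" using assms by (auto simp: bounded_op_on_def)
  have "norm (T x) \<le> (\<bar>B\<bar> + 1) * norm x" if "x \<in> M" for x
  proof -
    have "norm (T x) \<le> B * norm x" using B that by blast
    also have "\<dots> \<le> (\<bar>B\<bar> + 1) * norm x" by (intro mult_right_mono) auto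
    finally show ?thesis .
  qed
  then show ?thesis by (intro exI[of _ "\<bar>B\<bar> + 1"]) auto
qed

lemma bounded_op_onI:
  assumes "\<And>x. x \<in> M \<Longrightarrow> T x \<in> M" "clinear_on M T" "\<And>x. x \<in> M \<Longrightarrow> norm (T x) \<le> B * norm x"
  shows "bounded_op_on M T"
  using assms unfolding bounded_op_on_def by blast

lemma bounded_op_on_continuous:
  assumes "closed_csubspace M" "bounded_op_on M T"
  shows "continuous_on M T"
proof -
  obtain B where B: "B > 0" "\<And>x. x \<in> M \<Longrightarrow> norm (T x) \<le> B * norm x"
    using bounded_op_on_bound[OF assms(2)] by blast
  have "dist (T x) (T y) \<le> B * dist x y" if "x \<in> M" "y \<in> M" for x y
    using B(2)[of "x - y"] that csubspace_diff[OF assms(1)]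
    by (simp add: dist_norm clinear_on_diff[OF assms(1) bounded_op_onD(1)[OF assms(2)]])
  then have "B-lipschitz_on M T" using B(1) by (intro lipschitz_onI) auto
  then show ?thesis by (rule lipschitz_on_continuous_on)
qed

lemma bounded_op_on_subspace:
  assumes "bounded_op_on M T" "N \<subseteq> M" "T ` N \<subseteq> N"
  shows "bounded_op_on N T"
  using assms unfolding bounded_op_on_def clinear_on_def by blast

lemma bounded_op_on_comp:
  assumes "bounded_op_on M S" "bounded_op_on M T"
  shows "bounded_op_on M (\<lambda>x. S (T x))"
proof -
  obtain B where B: "B > 0" "\<And>x. x \<in> M \<Longrightarrow> norm (S x) \<le> B * norm x"
    using bounded_op_on_bound[OF assms(1)] by blast
  obtain C where C: "C > 0" "\<And>x. x \<in> M \<Longrightarrow> norm (T x) \<le> C * norm x"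
    using bounded_op_on_bound[OF assms(2)] by blast
  show ?thesis
  proof (rule bounded_op_onI)
    fix x assume x: "x \<in> M"
    have "norm (S (T x)) \<le> B * norm (T x)" using B(2) bounded_op_onD(2)[OF assms(2) x] .
    also have "\<dots> \<le> B * (C * norm x)" using B(1) C(2)[OF x] by simp
    finally show "norm (S (T x)) \<le> (B * C) * norm x" by simp
  qed (use bounded_op_onD[OF assms(1)] bounded_op_onD[OF assms(2)] in \<open>auto simp: clinear_on_def\<close>)
qed

lemma bounded_op_on_funpow:
  assumes "bounded_op_on M T"
  shows "bounded_op_on M (T ^^ k)"
proof (induction k)
  case 0
  show ?case by (auto simp: bounded_op_on_def clinear_on_def intro!: exI[of _ 1])
next
  case (Suc k)
  then show ?case using bounded_op_on_comp[OF assms Suc] by (simp add: o_def)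
qed

lemma bounded_op_on_add:
  assumes M: "closed_csubspace M" and "bounded_op_on M S" "bounded_op_on M T"
  shows "bounded_op_on M (\<lambda>x. S x + T x)"
proof -
  obtain B where B: "B > 0" "\<And>x. x \<in> M \<Longrightarrow> norm (S x) \<le> B * norm x"
    using bounded_op_on_bound[OF assms(2)] by blast
  obtain C where C: "C > 0" "\<And>x. x \<in> M \<Longrightarrow> norm (T x) \<le> C * norm x"
    using bounded_op_on_bound[OF assms(3)] by blast
  show ?thesis
  proof (rule bounded_op_onI)
    fix x assume x: "x \<in> M"
    show "S x + T x \<in> M"
      using x bounded_op_onD(2)[OF assms(2) x] bounded_op_onD(2)[OF assms(3) x] M by (intro csubspace_intros)
    show "norm (S x + T x) \<le> (B + C) * norm x"
      using norm_triangle_ineq[of "S x" "T x"] B(2)[OF x] C(2)[OF x] by (simp add: algebra_simps)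
  qed (use bounded_op_onD[OF assms(2)] bounded_op_onD[OF assms(3)] in
      \<open>auto simp: clinear_on_def scaleC_add_right\<close>)
qed

lemma bounded_op_on_scaleC:
  assumes M: "closed_csubspace M" and "bounded_op_on M S"
  shows "bounded_op_on M (\<lambda>x. c *\<^sub>C S x)"
proof -
  obtain B where B: "B > 0" "\<And>x. x \<in> M \<Longrightarrow> norm (S x) \<le> B * norm x"
    using bounded_op_on_bound[OF assms(2)] by blast
  show ?thesis
  proof (rule bounded_op_onI)
    fix x assume x: "x \<in> M"
    show "c *\<^sub>C S x \<in> M" using bounded_op_onD(2)[OF assms(2) x] M by (intro csubspace_intros)
    show "norm (c *\<^sub>C S x) \<le> (cmod c * B) * norm x"
      using B(2)[OF x] by (simp add: norm_scaleC mult.assoc mult_left_mono)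
  qed (use bounded_op_onD[OF assms(2)] in
      \<open>auto simp: clinear_on_def scaleC_add_right scaleC_scaleC mult.commute\<close>)
qed

lemma bounded_op_on_id: "bounded_op_on M (\<lambda>x. x)"
  by (auto simp: bounded_op_on_def clinear_on_def intro!: exI[of _ 1])

lemma bounded_op_on_diff:
  assumes M: "closed_csubspace M" and "bounded_op_on M S" "bounded_op_on M T"
  shows "bounded_op_on M (\<lambda>x. S x - T x)"
  using bounded_op_on_add[OF M assms(2) bounded_op_on_scaleC[OF M assms(3), of "-1"]] by simp

lemma bounded_op_on_sum:
  assumes M: "closed_csubspace M" and "\<And>i. i \<in> I \<Longrightarrow> bounded_op_on M (A i)"
  shows "bounded_op_on M (\<lambda>x. \<Sum>i\<in>I. A i x)"
  using assms(2)
proof (induction I rule: infinite_finite_induct)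
  case (insert i I)
  then show ?case using bounded_op_on_add[OF M] by simp
qed (use bounded_op_on_scaleC[OF M bounded_op_on_id, of 0] in auto)

text \<open>A minimizing sequence for the distance is Cauchy by the parallelogram law.\<close>

lemma orthogonal_projection_exists:
  fixes M :: "'a::chilbert_space set"
  assumes M: "closed_csubspace M"
  shows "\<exists>x\<in>M. \<forall>y\<in>M. cinner y (z - x) = 0"
proof -
  define d where "d = (INF x\<in>M. norm (z - x))"
  have bdd: "bdd_below ((\<lambda>x. norm (z - x)) ` M)" by (rule bdd_belowI2[of _ 0]) simp
  have d_le: "d \<le> norm (z - x)" if "x \<in> M" for x unfolding d_def using bdd that by (rule cINF_lower)
  have d0: "0 \<le> d" unfolding d_def using csubspace_0[OF M] by (intro cINF_greatest) auto
  have "\<exists>x\<in>M. norm (z - x) < d + inverse (Suc k)" for k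
  proof -
    have "(INF x\<in>M. norm (z - x)) < d + inverse (Suc k)" unfolding d_def by simp
    then show ?thesis using cINF_less_iff[OF _ bdd] csubspace_0[OF M] by blast
  qed
  then obtain X where X: "\<And>k. X k \<in> M" "\<And>k. norm (z - X k) < d + inverse (Suc k)" by metis
  have lim: "(\<lambda>k. norm (z - X k)) \<longlonglongrightarrow> d"
  proof (rule tendsto_sandwich[of "\<lambda>_. d" _ _ "\<lambda>k. d + inverse (real (Suc k))"])
    show "(\<lambda>k. d + inverse (real (Suc k))) \<longlonglongrightarrow> d"
      using LIMSEQ_inverse_real_of_nat_add by blast
  qed (use d_le X in \<open>auto intro!: always_eventually less_imp_le\<close>)
  have par: "(norm (x - y))\<^sup>2 \<le> 2 * (norm (z - x))\<^sup>2 + 2 * (norm (z - y))\<^sup>2 - 4 * d\<^sup>2"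
    if "x \<in> M" "y \<in> M" for x y
  proof -
    have "d \<le> norm (z - (1/2) *\<^sub>R (x + y))" using that M by (intro d_le csubspace_intros)
    then have "d\<^sup>2 \<le> (norm (z - (1/2) *\<^sub>R (x + y)))\<^sup>2" using d0 by (intro power_mono)
    also have "z - (1/2) *\<^sub>R (x + y) = (1/2) *\<^sub>R ((z - x) + (z - y))"
    proof -
      have "(z - x) + (z - y) = 2 *\<^sub>R z - (x + y)" by (simp add: scaleR_2)
      then show ?thesis by (simp only: scaleR_diff_right) simp
    qed
    also have "(norm ((1/2) *\<^sub>R ((z - x) + (z - y))))\<^sup>2 = (norm ((z - x) + (z - y)))\<^sup>2 / 4"
      unfolding norm_scaleR power_mult_distrib by (simp add: power_divide)
    finally have "4 * d\<^sup>2 \<le> (norm ((z - x) + (z - y)))\<^sup>2" by simp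
    moreover have "(norm (x - y))\<^sup>2 = (norm ((z - y) - (z - x)))\<^sup>2" by simp
    moreover have "Re (cinner (z - x) (z - y)) = Re (cinner (z - y) (z - x))"
      by (metis cinner_commute cnj.simps(1))
    ultimately show ?thesis using norm_add_sq[of "z - x" "z - y"] norm_diff_sq[of "z - y" "z - x"]
      by simp
  qed
  have "Cauchy X"
  proof (rule metric_CauchyI)
    fix e :: real assume e: "0 < e"
    have "(\<lambda>k. 4 * (norm (z - X k))\<^sup>2) \<longlonglongrightarrow> 4 * d\<^sup>2" by (intro tendsto_intros lim)
    moreover have "4 * d\<^sup>2 < 4 * d\<^sup>2 + e\<^sup>2" using e by simp
    ultimately have "\<forall>\<^sub>F k in sequentially. 4 * (norm (z - X k))\<^sup>2 < 4 * d\<^sup>2 + e\<^sup>2"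
      by (rule order_tendstoD)
    then obtain K where K: "\<And>k. k \<ge> K \<Longrightarrow> 4 * (norm (z - X k))\<^sup>2 < 4 * d\<^sup>2 + e\<^sup>2"
      unfolding eventually_sequentially by blast
    have "dist (X m) (X k) < e" if "m \<ge> K" "k \<ge> K" for m k
    proof -
      have "(norm (X m - X k))\<^sup>2 < e\<^sup>2"
        using par[OF X(1) X(1), of m k] K[OF that(1)] K[OF that(2)] by linarith
      then show ?thesis using e by (simp add: dist_norm power2_less_imp_less)
    qed
    then show "\<exists>K. \<forall>m\<ge>K. \<forall>k\<ge>K. dist (X m) (X k) < e" by blast
  qed
  then obtain p where p: "X \<longlonglongrightarrow> p" using Cauchy_convergent convergent_def by blast
  have pM: "p \<in> M" using csubspace_limit[OF M p X(1)] .
  have "(\<lambda>k. norm (z - X k)) \<longlonglongrightarrow> norm (z - p)" by (intro tendsto_intros p)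
  then have np: "norm (z - p) = d" using lim LIMSEQ_unique by blast
  have "cinner y (z - p) = 0" if y: "y \<in> M" for y
  proof (cases "y = 0")
    case False
    define c where "c = cinner (z - p) y / complex_of_real ((norm y)\<^sup>2)"
    have "p + c *\<^sub>C y \<in> M" using pM y M by (intro csubspace_intros)
    then have "d\<^sup>2 \<le> (norm (z - p - c *\<^sub>C y))\<^sup>2" using d_le[of "p + c *\<^sub>C y"] d0 by (simp add: diff_diff_eq power_mono)
    also have "\<dots> = d\<^sup>2 - (cmod (cinner (z - p) y))\<^sup>2 / (norm y)\<^sup>2"
      unfolding c_def norm_diff_line_sq[OF False] np ..
    finally have "(cmod (cinner (z - p) y))\<^sup>2 / (norm y)\<^sup>2 \<le> 0" by simp
    moreover have "0 < (norm y)\<^sup>2" using False by simp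
    ultimately have "(cmod (cinner (z - p) y))\<^sup>2 \<le> 0" by (simp add: divide_le_0_iff)
    then have "cinner (z - p) y = 0" by simp
    then show ?thesis by (rule cinner_eq_zero_commute)
  qed simp
  then show ?thesis using pM by blast
qed

text \<open>The Riesz representation of the functional \<open>x \<mapsto> \<langle>T x, y\<rangle>\<close> on \<open>M\<close>: it is represented by a
  multiple of any vector orthogonal to its kernel.\<close>

lemma adjoint_on_exists:
  fixes M :: "'a::chilbert_space set"
  assumes M: "closed_csubspace M" and T: "bounded_op_on M T"
  shows "\<exists>z\<in>M. \<forall>x\<in>M. cinner (T x) y = cinner x z"
proof -
  define f where "f x = cinner (T x) y" for x
  have lin: "clinear_on M T" using T by (rule bounded_op_onD)
  have f_add: "f (a + b) = f a + f b" if "a \<in> M" "b \<in> M" for a b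
    using that by (simp add: f_def clinear_on_add[OF M lin] cinner_add_left)
  have f_sc: "f (c *\<^sub>C a) = c * f a" if "a \<in> M" for a c
    using that by (simp add: f_def clinear_on_scaleC[OF M lin] cinner_scaleC_left)
  have f0: "f 0 = 0" by (simp add: f_def clinear_on_0[OF M lin])
  define N where "N = {x\<in>M. f x = 0}"
  have contf: "continuous_on M f"
    unfolding f_def
    by (rule continuous_on_compose2[OF linear_continuous_on[OF bounded_linear_cinner_left, of UNIV y]])
       (use bounded_op_on_continuous[OF M T] in auto)
  have N: "closed_csubspace N"
    unfolding closed_csubspace_def
  proof (intro conjI ballI allI)
    show "closed N" unfolding N_def
      by (rule continuous_closed_preimage_constant[OF contf csubspace_closed[OF M]])
  qed (auto simp: N_def f_add f_sc f0 csubspace_intros M)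
  show ?thesis
  proof (cases "N = M")
    case True
    then show ?thesis using csubspace_0[OF M] by (intro bexI[of _ 0]) (auto simp: N_def f_def)
  next
    case False
    then obtain u where u: "u \<in> M" "f u \<noteq> 0" by (auto simp: N_def)
    obtain p where p: "p \<in> N" "\<And>x. x \<in> N \<Longrightarrow> cinner x (u - p) = 0"
      using orthogonal_projection_exists[OF N, of u] by blast
    define v where "v = u - p"
    have v: "v \<in> M" using u p M by (auto simp: v_def N_def intro: csubspace_intros)
    have fv: "f v \<noteq> 0"
      using f_add[of v p] v p u by (auto simp: v_def N_def)
    then have v0: "v \<noteq> 0" using f0 by auto
    define z where "z = cnj (f v / complex_of_real ((norm v)\<^sup>2)) *\<^sub>C v"
    have "f x = cinner x z" if x: "x \<in> M" for x
    proof -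
      define w where "w = x + (- (f x / f v)) *\<^sub>C v"
      have "f w = 0" unfolding w_def using x v fv M by (subst f_add) (auto simp: f_sc csubspace_intros simp del: scaleC_minus_left)
      then have "w \<in> N" unfolding N_def w_def using x v M by (auto intro!: csubspace_intros)
      then have "cinner w v = 0" using p(2) by (simp add: v_def)
      then have "cinner x v = (f x / f v) * cinner v v"
        by (simp add: w_def cinner_simps)
      then show ?thesis using fv v0 by (simp add: z_def cinner_scaleC_right cinner_self)
    qed
    then show ?thesis using v M unfolding f_def z_def by (blast intro: csubspace_intros)
  qed
qed

lemma adjoint_on_unique:
  assumes M: "closed_csubspace M" and "z \<in> M" "\<And>x. x \<in> M \<Longrightarrow> cinner (T x) y = cinner x z"
  shows "adjoint_on M T y = z"
  unfolding adjoint_on_def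
proof (rule the_equality)
  fix z' assume "z' \<in> M \<and> (\<forall>x\<in>M. cinner (T x) y = cinner x z')"
  then show "z' = z" using assms by (intro cinner_ext_on[OF M]) auto
qed (use assms in auto)

lemma adjoint_on:
  assumes M: "closed_csubspace M" and T: "bounded_op_on M T"
  shows adjoint_on_mem: "adjoint_on M T y \<in> M"
    and cinner_adjoint_on: "x \<in> M \<Longrightarrow> cinner (T x) y = cinner x (adjoint_on M T y)"
proof -
  obtain z where z: "z \<in> M" "\<And>x. x \<in> M \<Longrightarrow> cinner (T x) y = cinner x z"
    using adjoint_on_exists[OF M T] by blast
  then have "adjoint_on M T y = z" by (rule adjoint_on_unique[OF M])
  then show "adjoint_on M T y \<in> M" "x \<in> M \<Longrightarrow> cinner (T x) y = cinner x (adjoint_on M T y)"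
    using z by auto
qed

lemma cinner_adjoint_on':
  assumes "closed_csubspace M" "bounded_op_on M T" "x \<in> M"
  shows "cinner y (T x) = cinner (adjoint_on M T y) x"
  using cinner_adjoint_on[OF assms, of y] by (metis cinner_commute)

lemma bounded_op_on_adjoint:
  fixes M :: "'a::chilbert_space set"
  assumes M: "closed_csubspace M" and T: "bounded_op_on M T"
  shows "bounded_op_on M (adjoint_on M T)"
proof -
  obtain B where B: "B > 0" "\<And>x. x \<in> M \<Longrightarrow> norm (T x) \<le> B * norm x"
    using bounded_op_on_bound[OF T] by blast
  note mem = adjoint_on_mem[OF M T] note ad = cinner_adjoint_on[OF M T]
  show ?thesis
  proof (rule bounded_op_onI)
    show "clinear_on M (adjoint_on M T)"
      unfolding clinear_on_def
    proof (intro conjI ballI allI)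
      fix x y show "adjoint_on M T (x + y) = adjoint_on M T x + adjoint_on M T y"
        by (rule adjoint_on_unique[OF M]) (auto simp: M mem csubspace_intros cinner_add_right ad)
    next
      fix c x show "adjoint_on M T (c *\<^sub>C x) = c *\<^sub>C adjoint_on M T x"
        by (rule adjoint_on_unique[OF M]) (auto simp: M mem csubspace_intros cinner_scaleC_right ad)
    qed
  next
    fix y assume y: "y \<in> M"
    let ?z = "adjoint_on M T y"
    have "complex_of_real ((norm ?z)\<^sup>2) = cinner (T ?z) y"
      using ad[OF mem] by (simp add: cinner_self)
    then have "(norm ?z)\<^sup>2 = cmod (cinner (T ?z) y)" by (metis abs_of_nonneg norm_of_real zero_le_power2)
    also have "\<dots> \<le> B * norm ?z * norm y"
      using cauchy_schwarz[of "T ?z" y] B(2)[OF mem, of y] by (smt (verit) mult_right_mono norm_ge_zero)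
    finally have "norm ?z * norm ?z \<le> norm ?z * (B * norm y)"
      by (simp add: power2_eq_square mult_ac)
    then show "norm ?z \<le> B * norm y"
      using B(1) by (cases "norm ?z = 0") (auto simp: mult_le_cancel_left)
  qed (rule mem)
qed

lemma adjoint_on_adjoint:
  assumes M: "closed_csubspace M" and T: "bounded_op_on M T" and x: "x \<in> M"
  shows "adjoint_on M (adjoint_on M T) x = T x"
  by (rule adjoint_on_unique[OF M])
     (auto simp: bounded_op_onD[OF T] x cinner_adjoint_on'[OF M T x, symmetric])

lemma closed_equalizer:
  assumes "bounded_op_on UNIV A" "bounded_op_on UNIV (B :: 'a::chilbert_space \<Rightarrow> 'a)"
  shows "closed_csubspace {x. A x = B x}"
  unfolding closed_csubspace_def
proof (intro conjI)
  note lA = bounded_op_onD(1)[OF assms(1)] and lB = bounded_op_onD(1)[OF assms(2)]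
  show "0 \<in> {x. A x = B x}" by (simp add: clinear_on_0[OF csubspace_UNIV lA] clinear_on_0[OF csubspace_UNIV lB])
  show "closed {x. A x = B x}"
    by (intro closed_Collect_eq bounded_op_on_continuous[OF csubspace_UNIV] assms)
qed (auto simp: bop_add[OF csubspace_UNIV assms(1)]
    bop_add[OF csubspace_UNIV assms(2)]
    bop_scaleC[OF csubspace_UNIV assms(1)]
    bop_scaleC[OF csubspace_UNIV assms(2)])

lemma closed_csubspace_Inter:
  "(\<And>i. closed_csubspace (M i)) \<Longrightarrow> closed_csubspace (\<Inter>i. M i :: 'a::chilbert_space set)"
  unfolding closed_csubspace_def by (auto intro: closed_INT)

text \<open>By polarization.\<close>

lemma norm_preserving_cinner:
  fixes K :: "'a::chilbert_space set"
  assumes K: "closed_csubspace K" and A: "clinear_on K A" "\<And>x. x \<in> K \<Longrightarrow> norm (A x) = norm x"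
    and xy: "x \<in> K" "y \<in> K"
  shows "cinner (A x) (A y) = cinner x y"
proof -
  have "norm (A x + c *\<^sub>C A y) = norm (x + c *\<^sub>C y)" for c
  proof -
    have "A (x + c *\<^sub>C y) = A x + c *\<^sub>C A y"
      using clinear_on_add[OF K A(1) xy(1) csubspace_scaleC[OF K xy(2)]] clinear_on_scaleC[OF K A(1) xy(2)] by simp
    then show ?thesis using A(2)[of "x + c *\<^sub>C y"] xy K by (metis csubspace_add csubspace_scaleC)
  qed
  note eq = this[of 1] this[of "-1"] this[of \<i>] this[of "- \<i>"]
  have "4 * cinner (A x) (A y) = 4 * cinner x y"
    unfolding cinner_polarization using eq by simp
  then show ?thesis by simp
qed

lemma complete_csubspace: "closed_csubspace M \<Longrightarrow> complete (M::'a::chilbert_space set)"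
  using csubspace_closed complete_eq_closed by blast

text \<open>\<open>L x = y\<close> is the fixed point equation of the contraction \<open>x \<mapsto> y + (x - L x)\<close>.\<close>

lemma near_identity_bij:
  fixes M :: "'a::chilbert_space set"
  assumes M: "closed_csubspace M" and L: "clinear_on M L" "\<And>x. x \<in> M \<Longrightarrow> L x \<in> M"
    and c: "0 \<le> c" "c < 1" "\<And>x. x \<in> M \<Longrightarrow> norm (x - L x) \<le> c * norm x"
  shows "bij_betw L M M"
proof -
  have "\<exists>!x\<in>M. L x = y" if y: "y \<in> M" for y
  proof -
    have "\<exists>!x\<in>M. y + (x - L x) = x"
    proof (rule Banach_fix[OF complete_csubspace[OF M] _ c(1,2)])
      show "M \<noteq> {}" using csubspace_0[OF M] by blast
      show "(\<lambda>x. y + (x - L x)) ` M \<subseteq> M" using y L M by (auto intro!: csubspace_intros)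
      fix a b assume ab: "a \<in> M" "b \<in> M"
      have "dist (y + (a - L a)) (y + (b - L b)) = norm ((a - b) - L (a - b))"
        using ab by (simp add: dist_norm clinear_on_diff[OF M L(1)] algebra_simps)
      also have "\<dots> \<le> c * dist a b" unfolding dist_norm using c(3) csubspace_diff[OF M ab] by blast
      finally show "dist (y + (a - L a)) (y + (b - L b)) \<le> c * dist a b" .
    qed
    moreover have "y + (x - L x) = x \<longleftrightarrow> L x = y" for x
      by (auto simp: algebra_simps)
    ultimately show ?thesis by simp
  qed
  then show ?thesis using L(2) unfolding bij_betw_def inj_on_def by (metis (no_types, lifting) image_eqI image_subsetI subsetI subset_antisym)
qed

section \<open>Polynomials in commuting operators\<close>

abbreviation cvar :: "nat \<Rightarrow> cpoly" where
  "cvar i \<equiv> Poly_Mapping.single (Poly_Mapping.single i 1) 1"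

abbreviation cconst :: "complex \<Rightarrow> cpoly" where
  "cconst c \<equiv> Poly_Mapping.single 0 c"

text \<open>The linear extension of a map on monomials; evaluation at a point and at an operator tuple are
  both of this form.\<close>

definition lin_ext :: "('m \<Rightarrow> 'b::chilbert_space) \<Rightarrow> ('m \<Rightarrow>\<^sub>0 complex) \<Rightarrow> 'b" where
  "lin_ext \<phi> p = (\<Sum>m\<in>Poly_Mapping.keys p. Poly_Mapping.lookup p m *\<^sub>C \<phi> m)"

lemma lin_ext_superset:
  assumes "finite K" "Poly_Mapping.keys p \<subseteq> K"
  shows "lin_ext \<phi> p = (\<Sum>m\<in>K. Poly_Mapping.lookup p m *\<^sub>C \<phi> m)"
  unfolding lin_ext_def using assms by (intro sum.mono_neutral_left) (auto simp: in_keys_iff)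

lemma lin_ext_add: "lin_ext \<phi> (p + q) = lin_ext \<phi> p + lin_ext \<phi> q"
proof -
  let ?K = "Poly_Mapping.keys p \<union> Poly_Mapping.keys q"
  have "lin_ext \<phi> (p + q) = (\<Sum>m\<in>?K. Poly_Mapping.lookup (p + q) m *\<^sub>C \<phi> m)"
    using keys_add[of p q] by (intro lin_ext_superset) auto
  also have "\<dots> = lin_ext \<phi> p + lin_ext \<phi> q"
    by (simp add: lookup_add scaleC_add_left sum.distrib lin_ext_superset[of ?K p] lin_ext_superset[of ?K q])
  finally show ?thesis .
qed

lemma lin_ext_zero [simp]: "lin_ext \<phi> 0 = 0"
  by (simp add: lin_ext_def)

lemma lin_ext_sum: "lin_ext \<phi> (\<Sum>i\<in>I. f i) = (\<Sum>i\<in>I. lin_ext \<phi> (f i))"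
  by (induction I rule: infinite_finite_induct) (auto simp: lin_ext_add)

lemma lin_ext_single [simp]: "lin_ext \<phi> (Poly_Mapping.single m c) = c *\<^sub>C \<phi> m"
  by (simp add: lin_ext_def)

lemma poly_mapping_sum_singles:
  "p = (\<Sum>m\<in>Poly_Mapping.keys p. Poly_Mapping.single m (Poly_Mapping.lookup p m))"
proof (rule poly_mapping_eqI)
  fix k
  show "Poly_Mapping.lookup p k
    = Poly_Mapping.lookup (\<Sum>m\<in>Poly_Mapping.keys p. Poly_Mapping.single m (Poly_Mapping.lookup p m)) k"
    by (simp add: lookup_sum lookup_single when_def in_keys_iff)
qed

lemma lin_ext_mult:
  "lin_ext \<phi> (p * q) = (\<Sum>m\<in>Poly_Mapping.keys p. \<Sum>l\<in>Poly_Mapping.keys q.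
     (Poly_Mapping.lookup p m * Poly_Mapping.lookup q l) *\<^sub>C \<phi> (m + l))"
proof -
  have "p * q = (\<Sum>m\<in>Poly_Mapping.keys p. \<Sum>l\<in>Poly_Mapping.keys q.
      Poly_Mapping.single (m + l) (Poly_Mapping.lookup p m * Poly_Mapping.lookup q l))"
    by (subst poly_mapping_sum_singles[of p], subst poly_mapping_sum_singles[of q])
       (simp add: sum_product mult_single)
  then show ?thesis by (simp only: lin_ext_sum lin_ext_single)
qed

definition mon_eval :: "nat \<Rightarrow> (nat \<Rightarrow> complex) \<Rightarrow> (nat \<Rightarrow>\<^sub>0 nat) \<Rightarrow> complex" where
  "mon_eval n z m = (\<Prod>i=1..n. z i ^ Poly_Mapping.lookup m i)"

definition mon_op :: "nat \<Rightarrow> (nat \<Rightarrow> 'a \<Rightarrow> 'a) \<Rightarrow> (nat \<Rightarrow>\<^sub>0 nat) \<Rightarrow> 'a \<Rightarrow> 'a" where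
  "mon_op n T m = foldr (\<lambda>i. T i ^^ Poly_Mapping.lookup m i) [1..<Suc n]"

lemma poly_eval_lin_ext: "poly_eval n p z = lin_ext (mon_eval n z) p"
  by (simp add: poly_eval_def lin_ext_def mon_eval_def scaleC_complex_def)

lemma poly_op_lin_ext: "poly_op n p T x = lin_ext (\<lambda>m. mon_op n T m x) p"
  by (simp add: poly_op_def lin_ext_def mon_op_def)

lemma poly_eval_add: "poly_eval n (p + q) z = poly_eval n p z + poly_eval n q z"
  by (simp add: poly_eval_lin_ext lin_ext_add)

lemma poly_op_add: "poly_op n (p + q) T x = poly_op n p T x + poly_op n q T x"
  by (simp add: poly_op_lin_ext lin_ext_add)

lemma mon_eval_0 [simp]: "mon_eval n z 0 = 1"
  by (simp add: mon_eval_def)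

lemma mon_eval_add: "mon_eval n z (m + l) = mon_eval n z m * mon_eval n z l"
  by (simp add: mon_eval_def lookup_add power_add prod.distrib)

lemma poly_eval_mult: "poly_eval n (p * q) z = poly_eval n p z * poly_eval n q z"
  unfolding poly_eval_lin_ext lin_ext_mult
  by (simp add: lin_ext_def mon_eval_add scaleC_complex_def sum_product mult_ac)

lemma poly_eval_const [simp]: "poly_eval n (cconst c) z = c"
  by (simp add: poly_eval_lin_ext scaleC_complex_def)

lemma poly_eval_var [simp]:
  assumes "i \<in> {1..n}"
  shows "poly_eval n (cvar i) z = z i"
proof -
  have "mon_eval n z (Poly_Mapping.single i 1) = (\<Prod>j=1..n. if j = i then z i else 1)"
    unfolding mon_eval_def by (intro prod.cong) (auto simp: lookup_single when_def)
  then show ?thesis using assms by (simp add: poly_eval_lin_ext scaleC_complex_def)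
qed

lemma poly_eval_sum: "poly_eval n (\<Sum>i\<in>I. f i) z = (\<Sum>i\<in>I. poly_eval n (f i) z)"
  by (simp add: poly_eval_lin_ext lin_ext_sum)

lemma poly_vars_le_add: "poly_vars_le n p \<Longrightarrow> poly_vars_le n q \<Longrightarrow> poly_vars_le n (p + q)"
  using keys_add[of p q] unfolding poly_vars_le_def by blast

lemma poly_vars_le_mult:
  assumes "poly_vars_le n p" "poly_vars_le n q"
  shows "poly_vars_le n (p * q)"
  unfolding poly_vars_le_def
proof
  fix m assume "m \<in> Poly_Mapping.keys (p * q)"
  then obtain a b where m: "m = a + b" "a \<in> Poly_Mapping.keys p" "b \<in> Poly_Mapping.keys q"
    using keys_mult[of p q] by auto
  then show "Poly_Mapping.keys m \<subseteq> {1..n}"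
    using assms keys_add[of a b] unfolding poly_vars_le_def by blast
qed

lemma poly_vars_le_const [simp]: "poly_vars_le n (cconst c)"
  by (simp add: poly_vars_le_def)

lemma poly_vars_le_var [simp]: "i \<in> {1..n} \<Longrightarrow> poly_vars_le n (cvar i)"
  by (simp add: poly_vars_le_def)

lemma poly_eval_one [simp]: "poly_eval n 1 z = 1"
  by (metis poly_eval_const single_one)

lemma poly_vars_le_one [simp]: "poly_vars_le n 1"
  by (metis poly_vars_le_const single_one)

lemma poly_vars_le_sum: "(\<And>i. i \<in> I \<Longrightarrow> poly_vars_le n (f i)) \<Longrightarrow> poly_vars_le n (\<Sum>i\<in>I. f i)"
  by (induction I rule: infinite_finite_induct) (auto intro: poly_vars_le_add simp: poly_vars_le_def[of n 0])

text \<open>On an invariant subspace on which the tuple commutes, \<open>p \<mapsto> p(T)\<close> is multiplicative.\<close>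

locale commuting_tuple =
  fixes n :: nat and M :: "'a::chilbert_space set" and T :: "nat \<Rightarrow> 'a \<Rightarrow> 'a"
  assumes M: "closed_csubspace M" and ct: "commuting_tuple_on n M T"
begin

lemma bnd: "i \<in> {1..n} \<Longrightarrow> bounded_op_on M (T i)"
  using ct unfolding commuting_tuple_on_def by blast

lemma comm: "i \<in> {1..n} \<Longrightarrow> j \<in> {1..n} \<Longrightarrow> x \<in> M \<Longrightarrow> T i (T j x) = T j (T i x)"
  using ct unfolding commuting_tuple_on_def by blast

lemma funpow_mem: "i \<in> {1..n} \<Longrightarrow> x \<in> M \<Longrightarrow> (T i ^^ k) x \<in> M"
  using bounded_op_onD(2)[OF bounded_op_on_funpow[OF bnd]] .

lemma comm_funpow:
  assumes "bounded_op_on M A" "\<And>x. x \<in> M \<Longrightarrow> A (T i x) = T i (A x)" "i \<in> {1..n}" "x \<in> M"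
  shows "A ((T i ^^ k) x) = (T i ^^ k) (A x)"
  by (induction k) (use assms funpow_mem in auto)

lemma bounded_foldr:
  "set js \<subseteq> {1..n} \<Longrightarrow> bounded_op_on M (foldr (\<lambda>i. T i ^^ a i) js)"
proof (induction js)
  case (Cons i js)
  then show ?case
    using bounded_op_on_comp[OF bounded_op_on_funpow[OF bnd], of i "foldr (\<lambda>i. T i ^^ a i) js" "a i"]
    by (simp add: o_def)
qed (use bounded_op_on_id in \<open>simp add: id_def\<close>)

lemma comm_foldr:
  assumes A: "bounded_op_on M A" "\<And>i x. i \<in> {1..n} \<Longrightarrow> x \<in> M \<Longrightarrow> A (T i x) = T i (A x)"
    and x: "x \<in> M"
  shows "set js \<subseteq> {1..n} \<Longrightarrow> A (foldr (\<lambda>i. T i ^^ a i) js x) = foldr (\<lambda>i. T i ^^ a i) js (A x)"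
proof (induction js)
  case (Cons i js)
  have "foldr (\<lambda>i. T i ^^ a i) js x \<in> M"
    using bounded_op_onD(2)[OF bounded_foldr x] Cons by simp
  then show ?case using Cons comm_funpow[where i = i, OF A(1) A(2)] by simp
qed simp

lemma bounded_mon_op: "bounded_op_on M (mon_op n T m)"
  unfolding mon_op_def by (rule bounded_foldr) auto

lemma mon_op_0 [simp]: "mon_op n T 0 x = x"
proof -
  have "foldr (\<lambda>i::nat. id) js x = x" for js by (induction js) auto
  then show ?thesis by (simp add: mon_op_def)
qed

lemma mon_op_add:
  assumes x: "x \<in> M"
  shows "mon_op n T (m + l) x = mon_op n T m (mon_op n T l x)"
proof -
  have "set js \<subseteq> {1..n} \<Longrightarrow> foldr (\<lambda>i. T i ^^ (a i + b i)) js x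
      = foldr (\<lambda>i. T i ^^ a i) js (foldr (\<lambda>i. T i ^^ b i) js x)" for js a b
  proof (induction js)
    case (Cons i js)
    let ?f = "\<lambda>a. foldr (\<lambda>i. T i ^^ a i) js"
    have i: "i \<in> {1..n}" and s: "set js \<subseteq> {1..n}" using Cons by auto
    have "?f a ((T i ^^ b i) y) = (T i ^^ b i) (?f a y)" if "y \<in> M" for y
      by (rule comm_funpow[OF bounded_foldr[OF s] _ i that])
         (use comm_foldr[OF bnd[OF i] comm _ s] i in auto)
    moreover have "?f b x \<in> M" using bounded_op_onD(2)[OF bounded_foldr[OF s] x] .
    ultimately show ?case using Cons by (simp add: funpow_add)
  qed simp
  from this[of "[1..<Suc n]" "Poly_Mapping.lookup m" "Poly_Mapping.lookup l"] show ?thesis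
    by (simp add: mon_op_def lookup_add atLeastLessThanSuc_atLeastAtMost del: upt_Suc)
qed

lemma bounded_poly_op: "bounded_op_on M (poly_op n p T)"
  unfolding poly_op_lin_ext lin_ext_def
  by (intro bounded_op_on_sum[OF M] bounded_op_on_scaleC[OF M] bounded_mon_op)

lemma poly_op_mem: "x \<in> M \<Longrightarrow> poly_op n p T x \<in> M"
  using bounded_op_onD(2)[OF bounded_poly_op] .

lemma poly_op_mult:
  assumes x: "x \<in> M"
  shows "poly_op n (p * q) T x = poly_op n p T (poly_op n q T x)"
proof -
  have mem: "mon_op n T l x \<in> M" for l using bounded_op_onD(2)[OF bounded_mon_op x] .
  have "mon_op n T m (poly_op n q T x)
      = (\<Sum>l\<in>Poly_Mapping.keys q. Poly_Mapping.lookup q l *\<^sub>C mon_op n T (m + l) x)" for m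
    using bop_sum[OF M bounded_mon_op, of "Poly_Mapping.keys q"
        "\<lambda>l. Poly_Mapping.lookup q l *\<^sub>C mon_op n T l x" m]
    by (simp add: poly_op_lin_ext lin_ext_def csubspace_scaleC[OF M mem] mon_op_add x
        bop_scaleC[OF M bounded_mon_op mem])
  then show ?thesis
    unfolding poly_op_lin_ext lin_ext_mult lin_ext_def[of _ p]
    by (simp add: poly_op_lin_ext scaleC_sum_right scaleC_scaleC)
qed

lemma poly_op_const [simp]: "poly_op n (cconst c) T x = c *\<^sub>C x"
  by (simp add: poly_op_lin_ext)

lemma poly_op_one [simp]: "poly_op n 1 T x = x"
  by (metis poly_op_const single_one scaleC_one)

lemma poly_op_var [simp]:
  assumes "i \<in> {1..n}"
  shows "poly_op n (cvar i) T x = T i x"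
proof -
  have "distinct js \<Longrightarrow> foldr (\<lambda>j. T j ^^ Poly_Mapping.lookup (Poly_Mapping.single i (1::nat)) j) js x
      = (if i \<in> set js then T i x else x)" for js
    by (induction js) (auto simp: lookup_single when_def)
  from this[of "[1..<Suc n]"] show ?thesis
    using assms by (simp add: poly_op_lin_ext mon_op_def del: upt_Suc)
qed

lemma poly_op_commute: "x \<in> M \<Longrightarrow> poly_op n p T (poly_op n q T x) = poly_op n q T (poly_op n p T x)"
  by (metis mult.commute poly_op_mult)

end

lemma poly_op_sum: "poly_op n (\<Sum>i\<in>I. f i) T x = (\<Sum>i\<in>I. poly_op n (f i) T x)"
  by (simp add: poly_op_lin_ext lin_ext_sum)

text \<open>The adjoint of \<open>p(T)\<close> is obtained by conjugating the coefficients of \<open>p\<close> and taking the adjoints of the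
  \<open>T\<^sub>i\<close>.\<close>

abbreviation cpoly_cnj :: "cpoly \<Rightarrow> cpoly" where
  "cpoly_cnj p \<equiv> Poly_Mapping.map cnj p"

lemma lookup_cpoly_cnj [simp]: "Poly_Mapping.lookup (cpoly_cnj p) m = cnj (Poly_Mapping.lookup p m)"
  by (simp add: Poly_Mapping.map.rep_eq when_def)

lemma keys_cpoly_cnj [simp]: "Poly_Mapping.keys (cpoly_cnj p) = Poly_Mapping.keys p"
  by (auto simp: in_keys_iff)

lemma poly_vars_le_cnj: "poly_vars_le n p \<Longrightarrow> poly_vars_le n (cpoly_cnj p)"
  by (simp add: poly_vars_le_def)

lemma poly_eval_cnj: "poly_eval n (cpoly_cnj p) z = cnj (poly_eval n p (\<lambda>i. cnj (z i)))"
  by (simp add: poly_eval_def)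

lemma cinner_poly_op_adjoint:
  assumes A: "commuting_tuple_on n UNIV (A :: nat \<Rightarrow> 'a::chilbert_space \<Rightarrow> 'a)"
    and B: "commuting_tuple_on n UNIV B"
    and ad: "\<And>i x y. i \<in> {1..n} \<Longrightarrow> cinner (A i x) y = cinner x (B i y)"
  shows "cinner (poly_op n (cpoly_cnj p) A x) y = cinner x (poly_op n p B y)"
proof -
  interpret A: commuting_tuple n UNIV A by unfold_locales (use A in auto)
  interpret B: commuting_tuple n UNIV B by unfold_locales (use B in auto)
  have pow: "cinner ((A i ^^ k) x) y = cinner x ((B i ^^ k) y)" if "i \<in> {1..n}" for i k x y
    by (induction k arbitrary: y) (use that ad in \<open>simp_all add: funpow_swap1[of "B i"]\<close>)
  have "set js \<subseteq> {1..n} \<Longrightarrow>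
      cinner (foldr (\<lambda>i. A i ^^ a i) js x) y = cinner x (foldr (\<lambda>i. B i ^^ a i) js y)" for js a x y
  proof (induction js arbitrary: y)
    case (Cons i js)
    have i: "i \<in> {1..n}" and s: "set js \<subseteq> {1..n}" using Cons by auto
    have "foldr (\<lambda>i. B i ^^ a i) js ((B i ^^ a i) y) = (B i ^^ a i) (foldr (\<lambda>i. B i ^^ a i) js y)"
      by (rule B.comm_funpow[OF B.bounded_foldr[OF s] _ i])
         (use B.comm_foldr[OF B.bnd[OF i] B.comm _ s] i in auto)
    then show ?case using Cons pow[OF i] by simp
  qed simp
  from this[of "[1..<Suc n]"] have "cinner (mon_op n A m x) y = cinner x (mon_op n B m y)" for m
    unfolding mon_op_def by (simp add: atLeastLessThanSuc_atLeastAtMost del: upt_Suc)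
  then show ?thesis
    by (simp add: poly_op_lin_ext lin_ext_def cinner_sum_left cinner_sum_right cinner_scaleC_left
        cinner_scaleC_right)
qed

section \<open>Exactness of the Koszul complex\<close>

definition koszul_sign :: "nat \<Rightarrow> nat set \<Rightarrow> complex" where
  "koszul_sign j J = (-1) ^ card {i\<in>J. i < j}"

lemma koszul_sign_sq: "koszul_sign j J * koszul_sign j J = 1"
  by (simp add: koszul_sign_def flip: power_add mult_2)

lemma koszul_sign_insert:
  assumes "finite J" "m \<notin> J"
  shows "koszul_sign j (insert m J) = koszul_sign j J * (if m < j then -1 else 1)"
proof (cases "m < j")
  case True
  then have "{i\<in>insert m J. i < j} = insert m {i\<in>J. i < j}" by auto
  then show ?thesis using assms True by (simp add: koszul_sign_def)
next
  case False
  then have "{i\<in>insert m J. i < j} = {i\<in>J. i < j}" by auto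
  then show ?thesis using False by (simp add: koszul_sign_def)
qed

lemma koszul_sign_remove: "koszul_sign j (J - {j}) = koszul_sign j J"
proof -
  have "{i\<in>J - {j}. i < j} = {i\<in>J. i < j}" by auto
  then show ?thesis by (simp add: koszul_sign_def)
qed

text \<open>Exchanging the order in which two indices are removed changes the sign.\<close>

lemma koszul_sign_swap:
  assumes "finite J" "j \<in> J" "k \<in> J" "j \<noteq> k"
  shows "koszul_sign j J * koszul_sign k (J - {j}) = - (koszul_sign k J * koszul_sign j (J - {k}))"
proof -
  define I where "I = J - {j} - {k}"
  have "koszul_sign j J = koszul_sign j (insert k I)"
    using koszul_sign_remove[of j J] assms by (simp add: I_def insert_absorb)
  moreover have "koszul_sign k J = koszul_sign k (insert j I)"
  proof -
    have "insert j I = J - {k}" using assms by (auto simp: I_def)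
    then show ?thesis using koszul_sign_remove[of k J] by simp
  qed
  moreover have "koszul_sign k (J - {j}) = koszul_sign k I"
    using koszul_sign_remove[of k "J - {j}"] by (simp add: I_def)
  moreover have "koszul_sign j (J - {k}) = koszul_sign j I"
    proof -
    have "J - {k} - {j} = I" by (auto simp: I_def)
    then show ?thesis using koszul_sign_remove[of j "J - {k}"] by simp
  qed
  moreover have "finite I" "k \<notin> I" "j \<notin> I" using assms by (auto simp: I_def)
  ultimately show ?thesis using assms(4) by (auto simp: koszul_sign_insert)
qed

locale koszul_tuple =
  fixes n :: nat and M :: "'a::chilbert_space set" and A :: "nat \<Rightarrow> 'a \<Rightarrow> 'a"
  assumes M: "closed_csubspace M"
    and lin: "\<And>i. i \<in> {1..n} \<Longrightarrow> clinear_on M (A i)"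
    and mem: "\<And>i x. i \<in> {1..n} \<Longrightarrow> x \<in> M \<Longrightarrow> A i x \<in> M"
    and comm: "\<And>i j x. i \<in> {1..n} \<Longrightarrow> j \<in> {1..n} \<Longrightarrow> x \<in> M \<Longrightarrow> A i (A j x) = A j (A i x)"
begin

lemma fin: "J \<in> Pow {1..n} \<Longrightarrow> finite J"
  using finite_subset by auto

lemma koszul_diff_eq:
  "J \<in> Pow {1..n} \<Longrightarrow> koszul_diff n A x J = (\<Sum>j\<in>J. koszul_sign j J *\<^sub>C A j (x (J - {j})))"
  by (simp add: koszul_diff_def koszul_sign_def)

lemma koszul_spaceD: "x \<in> koszul_space n M \<Longrightarrow> J \<in> Pow {1..n} \<Longrightarrow> x J \<in> M"
  unfolding koszul_space_def by (rule PiE_mem)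

lemma koszul_diff_mem:
  assumes x: "x \<in> koszul_space n M"
  shows "koszul_diff n A x \<in> koszul_space n M"
  unfolding koszul_space_def
proof (rule PiE_I)
  fix J assume J: "J \<in> Pow {1..n}"
  have "x (J - {j}) \<in> M" for j using J by (intro koszul_spaceD[OF x]) auto
  then show "koszul_diff n A x J \<in> M"
    unfolding koszul_diff_eq[OF J] using J mem by (intro csubspace_sum csubspace_scaleC M) auto
qed (auto simp: koszul_diff_def)

lemma koszul_diff_diff:
  assumes x: "x \<in> koszul_space n M" and J: "J \<in> Pow {1..n}"
  shows "koszul_diff n A (koszul_diff n A x) J = 0"
proof -
  define g where "g j k = (if j = k then 0 else
    (koszul_sign j J * koszul_sign k (J - {j})) *\<^sub>C A j (A k (x (J - {j} - {k}))))" for j k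
  have xM: "x (J - {j} - {k}) \<in> M" for j k using J by (intro koszul_spaceD[OF x]) auto
  have J1: "j \<in> {1..n}" if "j \<in> J" for j using that J by auto
  have dd: "koszul_diff n A (koszul_diff n A x) J = (\<Sum>j\<in>J. \<Sum>k\<in>J. g j k)"
    unfolding koszul_diff_eq[OF J]
  proof (rule sum.cong[OF refl])
    fix j assume j: "j \<in> J"
    have "A j (koszul_diff n A x (J - {j}))
        = (\<Sum>k\<in>J - {j}. koszul_sign k (J - {j}) *\<^sub>C A j (A k (x (J - {j} - {k}))))"
    proof -
      have Jj: "J - {j} \<in> Pow {1..n}" using J by auto
      have AM: "A k (x (J - {j} - {k})) \<in> M" if "k \<in> J - {j}" for k
        using that by (intro mem J1 xM) auto
      have "A j (koszul_diff n A x (J - {j}))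
          = (\<Sum>k\<in>J - {j}. A j (koszul_sign k (J - {j}) *\<^sub>C A k (x (J - {j} - {k}))))"
        unfolding koszul_diff_eq[OF Jj]
        by (rule clinear_on_sum[OF M lin[OF J1[OF j]]]) (rule csubspace_scaleC[OF M AM])
      then show ?thesis using AM by (simp add: clinear_on_scaleC[OF M lin[OF J1[OF j]]])
    qed
    then have "koszul_sign j J *\<^sub>C A j (koszul_diff n A x (J - {j})) = (\<Sum>k\<in>J - {j}. g j k)"
      by (auto simp: scaleC_sum_right scaleC_scaleC g_def intro!: sum.cong)
    also have "\<dots> = (\<Sum>k\<in>J. g j k)"
      using fin[OF J] by (intro sum.mono_neutral_left) (auto simp: g_def)
    finally show "koszul_sign j J *\<^sub>C A j (koszul_diff n A x (J - {j})) = (\<Sum>k\<in>J. g j k)" .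
  qed
  have anti: "g j k = - g k j" if "j \<in> J" "k \<in> J" for j k
  proof (cases "j = k")
    case False
    have "J - {j} - {k} = J - {k} - {j}" by auto
    then show ?thesis
      unfolding g_def using False koszul_sign_swap[OF fin[OF J] that False] comm[OF J1 J1 xM, of j k k j] that
      by simp
  qed (simp add: g_def)
  have "(\<Sum>j\<in>J. \<Sum>k\<in>J. g j k) = (\<Sum>j\<in>J. \<Sum>k\<in>J. - g k j)"
    by (intro sum.cong refl anti)
  also have "\<dots> = - (\<Sum>j\<in>J. \<Sum>k\<in>J. g k j)" by (simp only: sum_negf)
  also have "(\<Sum>j\<in>J. \<Sum>k\<in>J. g k j) = (\<Sum>j\<in>J. \<Sum>k\<in>J. g j k)" by (rule sum.swap)
  finally have "(\<Sum>j\<in>J. \<Sum>k\<in>J. g j k) = - (\<Sum>j\<in>J. \<Sum>k\<in>J. g j k)" .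
  then have "2 *\<^sub>R (\<Sum>j\<in>J. \<Sum>k\<in>J. g j k) = 0"
    unfolding scaleR_2 by (simp only: eq_neg_iff_add_eq_0)
  then show ?thesis using dd by simp
qed

text \<open>Contraction with the \<open>m\<close>-th basis covector: a chain homotopy between \<open>A\<^sub>m\<close> and \<open>0\<close>.\<close>

definition contract :: "nat \<Rightarrow> (nat set \<Rightarrow> 'a) \<Rightarrow> nat set \<Rightarrow> 'a" where
  "contract m x J = (if m \<in> J then 0 else koszul_sign m J *\<^sub>C x (insert m J))"

lemma koszul_diff_contract:
  assumes x: "x \<in> koszul_space n M" and cyc: "\<And>J. J \<in> Pow {1..n} \<Longrightarrow> koszul_diff n A x J = 0"
    and m: "m \<in> {1..n}" and J: "J \<in> Pow {1..n}"
  shows "koszul_diff n A (contract m x) J = A m (x J)"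
proof (cases "m \<in> J")
  case True
  have "koszul_diff n A (contract m x) J
      = (\<Sum>j\<in>{m}. koszul_sign j J *\<^sub>C A j (contract m x (J - {j})))"
    unfolding koszul_diff_eq[OF J]
  proof (rule sum.mono_neutral_right[OF fin[OF J]])
    show "\<forall>j\<in>J - {m}. koszul_sign j J *\<^sub>C A j (contract m x (J - {j})) = 0"
      using True J by (auto simp: contract_def clinear_on_0[OF M lin] subset_iff)
  qed (use True in auto)
  also have "\<dots> = A m (x J)"
    using True koszul_spaceD[OF x J]
    by (simp add: contract_def koszul_sign_remove insert_absorb clinear_on_scaleC[OF M lin[OF m]]
        scaleC_scaleC koszul_sign_sq)
  finally show ?thesis .
next
  case False
  have mJ: "insert m J \<in> Pow {1..n}" using m J by auto
  let ?S = "\<Sum>j\<in>J. koszul_sign j (insert m J) *\<^sub>C A j (x (insert m J - {j}))"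
  have "0 = koszul_sign m (insert m J) *\<^sub>C A m (x (insert m J - {m})) + ?S"
    unfolding cyc[OF mJ, symmetric] koszul_diff_eq[OF mJ] using fin[OF J] False by simp
  moreover have "koszul_sign m (insert m J) = koszul_sign m J" "insert m J - {m} = J"
    using False koszul_sign_remove[of m "insert m J"] by auto
  ultimately have S: "?S = - (koszul_sign m J *\<^sub>C A m (x J))"
    by (simp add: eq_neg_iff_add_eq_0 add.commute)
  have "koszul_diff n A (contract m x) J = (\<Sum>j\<in>J. - koszul_sign m J *\<^sub>C
      (koszul_sign j (insert m J) *\<^sub>C A j (x (insert m J - {j}))))"
    unfolding koszul_diff_eq[OF J]
  proof (rule sum.cong[OF refl])
    fix j assume j: "j \<in> J"
    then have jn: "j \<in> {1..n}" and jm: "j \<noteq> m" using J False by auto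
    have e: "insert m (J - {j}) = insert m J - {j}" using jm by auto
    have "x (insert m J - {j}) \<in> M" using mJ by (intro koszul_spaceD[OF x]) auto
    moreover have "koszul_sign j J * koszul_sign m (J - {j}) = - koszul_sign m J * koszul_sign j (insert m J)"
    proof -
      have "koszul_sign m J = koszul_sign m (J - {j}) * (if j < m then -1 else 1)"
        using koszul_sign_insert[of "J - {j}" j m] fin[OF J] j by (simp add: insert_absorb)
      moreover have "koszul_sign j (insert m J) = koszul_sign j J * (if m < j then -1 else 1)"
        using koszul_sign_insert fin[OF J] False by simp
      ultimately show ?thesis using jm by auto
    qed
    ultimately show "koszul_sign j J *\<^sub>C A j (contract m x (J - {j}))
        = - koszul_sign m J *\<^sub>C koszul_sign j (insert m J) *\<^sub>C A j (x (insert m J - {j}))"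
      using False by (simp add: contract_def e clinear_on_scaleC[OF M lin[OF jn]] scaleC_scaleC)
  qed
  also have "\<dots> = - koszul_sign m J *\<^sub>C ?S" by (simp only: scaleC_sum_right)
  also have "\<dots> = A m (x J)" by (simp add: S scaleC_scaleC koszul_sign_sq)
  finally show ?thesis .
qed

lemma contract_mem:
  assumes "x \<in> koszul_space n M" "m \<in> {1..n}" "J \<in> Pow {1..n}"
  shows "contract m x J \<in> M"
  using assms koszul_spaceD[of x "insert m J"] by (auto simp: contract_def csubspace_0 csubspace_scaleC M)

text \<open>If some linear combination \<open>L\<close> of the operators is invertible, then \<open>L\<^sup>-\<^sup>1\<close> times the corresponding
  combination of contractions is a contracting homotopy.\<close>

lemma koszul_exact_if_bij:
  assumes bij: "bij_betw (\<lambda>x. \<Sum>k=1..n. c k *\<^sub>C A k x) M M"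
  shows "koszul_exact n M A"
  unfolding koszul_exact_def
proof (intro subset_antisym subsetI)
  fix y assume "y \<in> koszul_diff n A ` koszul_space n M"
  then show "y \<in> {x \<in> koszul_space n M. \<forall>J\<in>Pow {1..n}. koszul_diff n A x J = 0}"
    using koszul_diff_mem koszul_diff_diff by auto
next
  fix x assume "x \<in> {x \<in> koszul_space n M. \<forall>J\<in>Pow {1..n}. koszul_diff n A x J = 0}"
  then have x: "x \<in> koszul_space n M" and cyc: "\<And>J. J \<in> Pow {1..n} \<Longrightarrow> koszul_diff n A x J = 0" by auto
  define L where "L x = (\<Sum>k=1..n. c k *\<^sub>C A k x)" for x
  define z where "z J = (\<Sum>m=1..n. c m *\<^sub>C contract m x J)" for J
  have zM: "z J \<in> M" if "J \<in> Pow {1..n}" for J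
    unfolding z_def using that contract_mem[OF x] M by (intro csubspace_sum csubspace_scaleC) auto
  \<comment> \<open>The cochain \<open>L\<^sup>-\<^sup>1 z\<close>, where \<open>z\<close> is the contraction of \<open>x\<close> for which \<open>d z = L x\<close>.\<close>
  define y where "y = (\<lambda>J\<in>Pow {1..n}. inv_into M L (z J))"
  have bijL: "bij_betw L M M" using bij unfolding L_def .
  have y: "y J \<in> M" "L (y J) = z J" if J: "J \<in> Pow {1..n}" for J
    using zM[OF J] bijL J by (auto simp: y_def bij_betw_def inv_into_into f_inv_into_f)
  have yK: "y \<in> koszul_space n M"
    unfolding koszul_space_def using y(1) by (intro PiE_I) (auto simp: y_def)
  have L_A: "L (s *\<^sub>C A j v) = s *\<^sub>C A j (L v)" if "j \<in> {1..n}" "v \<in> M" for j v s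
  proof -
    have AM: "A k v \<in> M" if "k \<in> {1..n}" for k using that \<open>v \<in> M\<close> by (rule mem)
    have "A j (L v) = (\<Sum>k=1..n. A j (c k *\<^sub>C A k v))"
      unfolding L_def by (rule clinear_on_sum[OF M lin[OF that(1)]]) (rule csubspace_scaleC[OF M AM])
    also have "\<dots> = (\<Sum>k=1..n. c k *\<^sub>C A k (A j v))"
      by (intro sum.cong refl) (simp only: clinear_on_scaleC[OF M lin[OF that(1)] AM] comm[OF that(1) _ that(2)])
    finally have "s *\<^sub>C A j (L v) = (\<Sum>k=1..n. c k *\<^sub>C s *\<^sub>C A k (A j v))"
      by (simp add: scaleC_sum_right scaleC_scaleC mult.commute)
    also have "\<dots> = L (s *\<^sub>C A j v)"
      unfolding L_def by (intro sum.cong refl) (simp only: clinear_on_scaleC[OF M lin mem[OF that]])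
    finally show ?thesis by simp
  qed
  have L_sum: "L (\<Sum>i\<in>I. f i) = (\<Sum>i\<in>I. L (f i))" if "\<And>i. i \<in> I \<Longrightarrow> f i \<in> M" for I :: "nat set" and f
    unfolding L_def
  proof -
    have "(\<Sum>k=1..n. c k *\<^sub>C A k (\<Sum>i\<in>I. f i)) = (\<Sum>k=1..n. \<Sum>i\<in>I. c k *\<^sub>C A k (f i))"
      by (intro sum.cong refl) (simp only: clinear_on_sum[OF M lin that] scaleC_sum_right)
    then show "(\<Sum>k=1..n. c k *\<^sub>C A k (\<Sum>i\<in>I. f i)) = (\<Sum>i\<in>I. \<Sum>k=1..n. c k *\<^sub>C A k (f i))"
      by (simp only: sum.swap[of _ "{1..n}" I])
  qed
  have "koszul_diff n A y J = x J" if J: "J \<in> Pow {1..n}" for J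
  proof -
    have Jj: "J - {j} \<in> Pow {1..n}" for j using J by auto
    have "L (koszul_diff n A y J) = (\<Sum>j\<in>J. koszul_sign j J *\<^sub>C A j (z (J - {j})))"
    proof -
      have "L (koszul_diff n A y J) = (\<Sum>j\<in>J. L (koszul_sign j J *\<^sub>C A j (y (J - {j}))))"
        unfolding koszul_diff_eq[OF J] using J
        by (intro L_sum csubspace_scaleC[OF M] mem y(1)[OF Jj]) auto
      also have "\<dots> = (\<Sum>j\<in>J. koszul_sign j J *\<^sub>C A j (L (y (J - {j}))))"
        using J by (intro sum.cong refl L_A y(1)[OF Jj]) auto
      finally show ?thesis by (simp only: y(2)[OF Jj])
    qed
    also have "\<dots> = (\<Sum>j\<in>J. \<Sum>m=1..n. c m *\<^sub>C koszul_sign j J *\<^sub>C A j (contract m x (J - {j})))"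
    proof (rule sum.cong[OF refl])
      fix j assume "j \<in> J"
      then have "j \<in> {1..n}" using J by auto
      then have "A j (z (J - {j})) = (\<Sum>m=1..n. c m *\<^sub>C A j (contract m x (J - {j})))"
        unfolding z_def by (intro clinear_on_lincomb[OF M lin] contract_mem[OF x _ Jj])
      then show "koszul_sign j J *\<^sub>C A j (z (J - {j}))
          = (\<Sum>m=1..n. c m *\<^sub>C koszul_sign j J *\<^sub>C A j (contract m x (J - {j})))"
        by (simp add: scaleC_sum_right scaleC_scaleC mult.commute)
    qed
    also have "\<dots> = (\<Sum>m=1..n. c m *\<^sub>C koszul_diff n A (contract m x) J)"
      by (subst sum.swap) (simp only: koszul_diff_eq[OF J] scaleC_sum_right)
    also have "\<dots> = L (x J)"
      unfolding L_def by (intro sum.cong refl) (simp only: koszul_diff_contract[OF x cyc _ J])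
    finally show ?thesis
      by (rule inj_onD[OF bij_betw_imp_inj_on[OF bijL] _ koszul_spaceD[OF koszul_diff_mem[OF yK] J] koszul_spaceD[OF x J]])
  qed
  moreover have "koszul_diff n A y \<in> extensional (Pow {1..n})" "x \<in> extensional (Pow {1..n})"
    using koszul_diff_mem[OF yK] x by (auto simp: koszul_space_def PiE_def)
  ultimately have "koszul_diff n A y = x" by (intro extensionalityI) auto
  then show "x \<in> koszul_diff n A ` koszul_space n M" using yK by blast
qed

end

lemma (in commuting_tuple) koszul_tuple_shift: "koszul_tuple n M (\<lambda>i x. T i x - w i *\<^sub>C x)"
proof -
  define A where "A i x = T i x - w i *\<^sub>C x" for i x
  have "koszul_tuple n M A"
  proof
    fix i assume i: "i \<in> {1..n}"
    have bA: "bounded_op_on M (A i)" unfolding A_def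
      by (intro bounded_op_on_diff bounded_op_on_scaleC bounded_op_on_id M bnd i)
    then show "clinear_on M (A i)" "\<And>x. x \<in> M \<Longrightarrow> A i x \<in> M" by (auto dest: bounded_op_onD)
    fix j x assume j: "j \<in> {1..n}" and x: "x \<in> M"
    have e: "T i (A j x) = T i (T j x) - w j *\<^sub>C T i x" if "i \<in> {1..n}" "j \<in> {1..n}" for i j
      unfolding A_def
      using bop_diff[OF M bnd[OF that(1)] bounded_op_onD(2)[OF bnd[OF that(2)] x]
          csubspace_scaleC[OF M x]] bop_scaleC[OF M bnd[OF that(1)] x] by simp
    have "A i (A j x) = T i (A j x) - w i *\<^sub>C A j x" "A j (A i x) = T j (A i x) - w j *\<^sub>C A i x"
      by (simp_all add: A_def)
    then show "A i (A j x) = A j (A i x)"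
      unfolding e[OF i j] e[OF j i] comm[OF i j x]
      by (simp add: A_def scaleC_diff_right scaleC_scaleC mult.commute)
  qed (rule M)
  then show ?thesis unfolding A_def[abs_def] .
qed

text \<open>In the top degree exactness means that the ranges of the operators span \<open>M\<close>.\<close>

lemma koszul_exact_surj:
  assumes M: "closed_csubspace M" and lin: "\<And>i. i \<in> {1..n} \<Longrightarrow> clinear_on M (A i)"
    and ex: "koszul_exact n M A" and y: "y \<in> M"
  shows "\<exists>u. (\<forall>j\<in>{1..n}. u j \<in> M) \<and> y = (\<Sum>j=1..n. A j (u j))"
proof -
  define Y where "Y = (\<lambda>J\<in>Pow {1..n}. if J = {1..n} then y else 0)"
  have "Y \<in> koszul_space n M" unfolding koszul_space_def Y_def using y csubspace_0[OF M] by auto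
  moreover have "koszul_diff n A Y J = 0" if J: "J \<in> Pow {1..n}" for J
  proof -
    have "A j (Y (J - {j})) = 0" if "j \<in> J" for j
    proof -
      have "J - {j} \<noteq> {1..n}" "J - {j} \<in> Pow {1..n}" "j \<in> {1..n}" using that J by auto
      then show ?thesis by (simp add: Y_def clinear_on_0[OF M lin])
    qed
    then show ?thesis using J by (simp add: koszul_diff_def)
  qed
  ultimately have "Y \<in> {x \<in> koszul_space n M. \<forall>J\<in>Pow {1..n}. koszul_diff n A x J = 0}" by simp
  then have "Y \<in> koszul_diff n A ` koszul_space n M" unfolding ex[unfolded koszul_exact_def] .
  then obtain x where x: "x \<in> koszul_space n M" "Y = koszul_diff n A x" by (elim imageE)
  define u where "u j = koszul_sign j {1..n} *\<^sub>C x ({1..n} - {j})" for j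
  have xM: "x ({1..n} - {j}) \<in> M" for j
    using x(1) unfolding koszul_space_def by (auto intro: PiE_mem)
  have "y = Y {1..n}" by (simp add: Y_def)
  also have "\<dots> = (\<Sum>j=1..n. koszul_sign j {1..n} *\<^sub>C A j (x ({1..n} - {j})))"
    by (simp add: x(2) koszul_diff_def koszul_sign_def)
  also have "\<dots> = (\<Sum>j=1..n. A j (u j))"
    by (intro sum.cong refl) (simp only: u_def clinear_on_scaleC[OF M lin xM])
  finally have "y = (\<Sum>j=1..n. A j (u j))" .
  moreover have "u j \<in> M" for j unfolding u_def by (rule csubspace_scaleC[OF M xM])
  ultimately show ?thesis by (intro exI[of _ u] conjI ballI)
qed

section \<open>The symmetrized polydisc\<close>

text \<open>Beyond the components of \<open>sym_map\<close>, the coefficients of \<open>(X - z\<^sub>1) \<dots> (X - z\<^sub>n)\<close> include \<open>e\<^sub>0 = 1\<close>.\<close>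

definition elem_sym :: "nat \<Rightarrow> (nat \<Rightarrow> complex) \<Rightarrow> nat \<Rightarrow> complex" where
  "elem_sym n z k = (\<Sum>J | J \<subseteq> {1..n} \<and> card J = k. \<Prod>j\<in>J. z j)"

lemma sym_map_elem_sym: "k \<in> {1..n} \<Longrightarrow> sym_map n z k = elem_sym n z k"
  by (simp add: sym_map_def elem_sym_def)

lemma sym_map_cong: "(\<And>j. j \<in> {1..n} \<Longrightarrow> z j = z' j) \<Longrightarrow> sym_map n z = sym_map n z'"
  unfolding sym_map_def by (intro restrict_ext sum.cong prod.cong refl) auto

lemma elem_sym_0: "elem_sym n z 0 = 1"
proof -
  have "{J. J \<subseteq> {1..n} \<and> card J = 0} = {{}}"
    using finite_subset[of _ "{1..n}"] by auto
  then show ?thesis by (simp add: elem_sym_def)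
qed

lemma elem_sym_top: "elem_sym n z n = (\<Prod>j=1..n. z j)"
proof -
  have "{J. J \<subseteq> {1..n} \<and> card J = n} = {{1..n}}"
    using card_subset_eq[of "{1..n}"] by auto
  then show ?thesis by (simp add: elem_sym_def)
qed

lemma prod_linear_factors:
  "(\<Prod>i=1..n. X - z i) = (\<Sum>k\<le>n. (-1) ^ k * elem_sym n z k * X ^ (n - k))"
proof -
  have "(\<Prod>i=1..n. X - z i) = (\<Sum>J\<in>Pow {1..n}. (-1) ^ card J * (\<Prod>j\<in>J. z j) * X ^ (n - card J))"
    unfolding prod_diff_conv_sum[OF finite_atLeastAtMost]
  proof (intro sum.cong refl)
    fix J assume "J \<in> Pow {1..n}"
    then have "J \<subseteq> {1..n}" by simp
    then have "card ({1..n} - J) = n - card J"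
      using card_Diff_subset[OF finite_subset[OF _ finite_atLeastAtMost], of J 1 n] by simp
    then show "(-1) ^ card J * (\<Prod>x\<in>J. z x) * (\<Prod>x\<in>{1..n} - J. X) = (-1) ^ card J * (\<Prod>j\<in>J. z j) * X ^ (n - card J)"
      by simp
  qed
  also have "\<dots> = (\<Sum>k\<le>n. \<Sum>J\<in>{J \<in> Pow {1..n}. card J = k}. (-1) ^ card J * (\<Prod>j\<in>J. z j) * X ^ (n - card J))"
  proof (rule sum.group[symmetric])
    show "card ` Pow {1..n} \<subseteq> {..n}" using card_mono[of "{1..n}"] by auto
  qed auto
  also have "\<dots> = (\<Sum>k\<le>n. (-1) ^ k * elem_sym n z k * X ^ (n - k))"
  proof (intro sum.cong refl)
    fix k
    have "{J \<in> Pow {1..n}. card J = k} = {J. J \<subseteq> {1..n} \<and> card J = k}" by auto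
    then show "(\<Sum>J\<in>{J \<in> Pow {1..n}. card J = k}. (-1) ^ card J * (\<Prod>j\<in>J. z j) * X ^ (n - card J))
        = (-1) ^ k * elem_sym n z k * X ^ (n - k)"
      by (simp add: elem_sym_def sum_distrib_left sum_distrib_right)
  qed
  finally show ?thesis .
qed

lemma Gamma_set_ext: "Gamma_set n \<subseteq> {1..n} \<rightarrow>\<^sub>E UNIV"
  unfolding Gamma_set_def sym_map_def by auto

lemma Gamma_setE:
  assumes "s \<in> Gamma_set n"
  obtains z where "\<And>j. j \<in> {1..n} \<Longrightarrow> cmod (z j) \<le> 1" "s = sym_map n z"
proof -
  obtain z where z: "z \<in> {1..n} \<rightarrow>\<^sub>E cball 0 1" "s = sym_map n z"
    using assms unfolding Gamma_set_def by blast
  have "cmod (z j) \<le> 1" if "j \<in> {1..n}" for j using PiE_mem[OF z(1) that] by simp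
  then show thesis using that z(2) by blast
qed

lemma Gamma_setI:
  assumes "\<And>j. j \<in> {1..n} \<Longrightarrow> cmod (z j) \<le> 1"
  shows "sym_map n z \<in> Gamma_set n"
proof -
  have "sym_map n z = sym_map n (restrict z {1..n})" by (rule sym_map_cong) simp
  moreover have "restrict z {1..n} \<in> {1..n} \<rightarrow>\<^sub>E cball 0 1" using assms by auto
  ultimately show ?thesis unfolding Gamma_set_def by blast
qed

lemma Gamma_set_nonempty: "Gamma_set n \<noteq> {}"
  using Gamma_setI[of n "\<lambda>_. 0"] by auto

lemma compact_Gamma_set: "compact (Gamma_set n)"
proof -
  define Z where "Z = PiE UNIV (\<lambda>i. if i \<in> {1..n} then cball (0::complex) 1 else {undefined})"
  have Z: "({1..n} \<rightarrow>\<^sub>E cball (0::complex) 1) = Z"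
    unfolding Z_def by (auto simp: PiE_iff extensional_def split: if_split_asm)
  have "compactin (product_topology (\<lambda>_. euclidean) UNIV) Z"
    unfolding Z_def compactin_PiE by (auto simp: compactin_euclidean_iff)
  then have "compact Z" by (simp add: euclidean_product_topology compactin_euclidean_iff)
  moreover have "continuous_on Z (sym_map n)"
  proof (rule continuous_on_coordinatewise_then_product)
    fix k
    show "continuous_on Z (\<lambda>z. sym_map n z k)"
      unfolding sym_map_def
      by (cases "k \<in> {1..n}")
         (auto intro!: continuous_intros continuous_on_subset[OF continuous_on_product_coordinates])
  qed
  ultimately show ?thesis unfolding Gamma_set_def Z by (intro compact_continuous_image)
qed

lemma Gamma_set_dilate:
  assumes s: "s \<in> Gamma_set n" and r: "0 \<le> r" "r \<le> 1"
  shows "(\<lambda>i\<in>{1..n}. complex_of_real r ^ i * s i) \<in> Gamma_set n"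
proof -
  obtain z where z: "\<And>j. j \<in> {1..n} \<Longrightarrow> cmod (z j) \<le> 1" "s = sym_map n z"
    using Gamma_setE[OF s] by blast
  have "(\<lambda>i\<in>{1..n}. complex_of_real r ^ i * s i) = sym_map n (\<lambda>j. complex_of_real r * z j)"
    unfolding z(2) sym_map_def
    by (intro restrict_ext) (auto simp: prod.distrib sum_distrib_left intro!: sum.cong)
  moreover have "cmod (complex_of_real r * z j) \<le> 1" if "j \<in> {1..n}" for j
    using z(1)[OF that] r by (simp add: norm_mult mult_le_one)
  ultimately show ?thesis using Gamma_setI[of n "\<lambda>j. complex_of_real r * z j"] by simp
qed

lemma Gamma_set_cnj:
  assumes s: "s \<in> Gamma_set n"
  shows "(\<lambda>i\<in>{1..n}. cnj (s i)) \<in> Gamma_set n"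
proof -
  obtain z where z: "\<And>j. j \<in> {1..n} \<Longrightarrow> cmod (z j) \<le> 1" "s = sym_map n z"
    using Gamma_setE[OF s] by blast
  have "(\<lambda>i\<in>{1..n}. cnj (s i)) = sym_map n (\<lambda>j. cnj (z j))"
    unfolding z(2) sym_map_def by (intro restrict_ext) simp
  then show ?thesis using Gamma_setI[of n "\<lambda>j. cnj (z j)"] z(1) by simp
qed

text \<open>By the factorization of \<open>X\<^sup>n - w\<^sub>1 X\<^sup>n\<^sup>-\<^sup>1 + w\<^sub>2 X\<^sup>n\<^sup>-\<^sup>2 - \<dots>\<close> into linear factors, every \<open>w\<close>
  is the image of its roots.\<close>

lemma root_outside_disc:
  assumes w: "w \<in> {1..n} \<rightarrow>\<^sub>E UNIV" "w \<notin> Gamma_set n"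
  shows "\<exists>a. 1 < cmod a \<and> a ^ n + (\<Sum>k=1..n. (-1) ^ k * w k * a ^ (n - k)) = 0"
proof -
  define c where "c k = (-1) ^ k * (if k = 0 then 1 else w k)" for k
  have c0: "c 0 = 1" by (simp add: c_def)
  define p where "p = (\<Sum>k\<le>n. monom (c k) (n - k))"
  have pX: "poly p X = (\<Sum>k\<le>n. c k * X ^ (n - k))" for X
    by (simp add: p_def poly_sum poly_monom)
  have coeff_p: "coeff p n = 1" "\<And>j. j > n \<Longrightarrow> coeff p j = 0"
  proof -
    have "coeff p n = (\<Sum>k\<le>n. if k = 0 then 1 else 0)"
      unfolding p_def coeff_sum by (intro sum.cong) (auto simp: c0)
    then show "coeff p n = 1" by simp
  qed (auto simp: p_def coeff_sum intro!: sum.neutral)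
  have deg: "degree p = n"
    using coeff_p by (intro antisym degree_le le_degree) auto
  obtain A where A: "size A = n" "p = smult (lead_coeff p) (\<Prod>x\<in>#A. [:-x, 1:])"
    using alg_closed_imp_factorization[of p] deg coeff_p(1) by (metis coeff_0 zero_neq_one)
  obtain xs where xs: "mset xs = A" using ex_mset by blast
  have len: "length xs = n" using xs A(1) by (metis size_mset)
  define z where "z i = xs ! (i - 1)" for i
  have pz: "poly p X = (\<Prod>i=1..n. X - z i)" for X
  proof -
    have "p = (\<Prod>x\<leftarrow>xs. [:-x, 1:])"
      using A(2) deg coeff_p(1) by (simp add: xs[symmetric] prod_mset_prod_list flip: mset_map)
    moreover have "poly (\<Prod>x\<leftarrow>ys. [:-x, 1:]) X = (\<Prod>x\<leftarrow>ys. X - x)" for ys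
      by (induction ys) (auto simp: algebra_simps)
    ultimately have "poly p X = (\<Prod>x\<leftarrow>xs. X - x)" by simp
    also have "\<dots> = (\<Prod>i<n. X - xs ! i)" by (subst prod.list_conv_set_nth) (simp add: len atLeast0LessThan)
    also have "\<dots> = (\<Prod>i=1..n. X - z i)"
      unfolding z_def by (rule prod.reindex_bij_witness[of _ "\<lambda>i. i - 1" Suc]) auto
    finally show ?thesis .
  qed
  have eq: "(\<Sum>k\<le>n. c k * X ^ (n - k)) = (\<Sum>k\<le>n. (-1) ^ k * elem_sym n z k * X ^ (n - k))" for X
    using pX[of X] pz[of X] prod_linear_factors[where n = n and z = z and X = X] by simp
  have rev: "(\<Sum>k\<le>n. f k * X ^ (n - k)) = (\<Sum>i\<le>n. f (n - i) * X ^ i)" for f and X :: complex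
    by (rule sum.reindex_bij_witness[of _ "\<lambda>i. n - i" "\<lambda>i. n - i"]) auto
  have "(\<Sum>i\<le>n. c (n - i) * X ^ i) = (\<Sum>i\<le>n. (-1) ^ (n - i) * elem_sym n z (n - i) * X ^ i)" for X
    using eq[of X] unfolding rev .
  then have coeffs: "c (n - i) = (-1) ^ (n - i) * elem_sym n z (n - i)" if "i \<le> n" for i
    using polyfun_eq_coeffs[where n = n and c = "\<lambda>i. c (n - i)" and d = "\<lambda>i. (-1) ^ (n - i) * elem_sym n z (n - i)"]
      that by blast
  have "w k = elem_sym n z k" if k: "k \<in> {1..n}" for k
  proof -
    have "n - (n - k) = k" "k \<noteq> 0" using k by auto
    then have "(-1) ^ k * w k = (-1) ^ k * elem_sym n z k" using coeffs[of "n - k"] by (simp add: c_def)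
    then show ?thesis by simp
  qed
  then have "w = sym_map n z" using w(1) by (intro ext) (auto simp: sym_map_def elem_sym_def PiE_iff extensional_def)
  then obtain i where i: "i \<in> {1..n}" "\<not> cmod (z i) \<le> 1" using w(2) Gamma_setI[of n z] by blast
  have "poly p (z i) = 0" unfolding pz using i(1) by (intro prod_zero) auto
  moreover have "poly p (z i) = z i ^ n + (\<Sum>k=1..n. (-1) ^ k * w k * z i ^ (n - k))"
    unfolding pX atMost_atLeast0 sum.atLeast_Suc_atMost[OF le0] by (auto simp: c_def intro!: sum.cong)
  ultimately show ?thesis using i(2) by (intro exI[of _ "z i"]) auto
qed

section \<open>Reciprocals of polynomials on the symmetrized polydisc\<close>

lemma poly_eval_cong: "(\<And>i. i \<in> {1..n} \<Longrightarrow> z i = z' i) \<Longrightarrow> poly_eval n p z = poly_eval n p z'"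
  unfolding poly_eval_def by (intro sum.cong refl arg_cong2[of _ _ _ _ "(*)"] prod.cong) auto

lemma continuous_poly_eval:
  assumes "\<And>i. i \<in> {1..n} \<Longrightarrow> continuous_on S (\<lambda>x. f x i)"
  shows "continuous_on S (\<lambda>x. poly_eval n p (f x))"
  unfolding poly_eval_def by (intro continuous_intros assms) auto

definition poly_fun :: "nat \<Rightarrow> ((nat \<Rightarrow> complex) \<Rightarrow> complex) \<Rightarrow> bool" where
  "poly_fun n f \<longleftrightarrow> (\<exists>p. poly_vars_le n p \<and> (\<forall>z. poly_eval n p z = f z))"

lemma poly_fun_const: "poly_fun n (\<lambda>_. c)"
  unfolding poly_fun_def by (intro exI[of _ "cconst c"]) simp

lemma poly_fun_var: "i \<in> {1..n} \<Longrightarrow> poly_fun n (\<lambda>z. z i)"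
  unfolding poly_fun_def by (intro exI[of _ "cvar i"]) (simp only: poly_vars_le_var poly_eval_var simp_thms)

lemma poly_fun_add: "poly_fun n f \<Longrightarrow> poly_fun n g \<Longrightarrow> poly_fun n (\<lambda>z. f z + g z)"
  unfolding poly_fun_def by (metis poly_eval_add poly_vars_le_add)

lemma poly_fun_mult: "poly_fun n f \<Longrightarrow> poly_fun n g \<Longrightarrow> poly_fun n (\<lambda>z. f z * g z)"
  unfolding poly_fun_def by (metis poly_eval_mult poly_vars_le_mult)

lemma poly_fun_diff: "poly_fun n f \<Longrightarrow> poly_fun n g \<Longrightarrow> poly_fun n (\<lambda>z. f z - g z)"
  using poly_fun_add[OF _ poly_fun_mult[OF poly_fun_const[of n "-1"]], of f g] by simp

lemma poly_fun_sum: "(\<And>i. i \<in> I \<Longrightarrow> poly_fun n (f i)) \<Longrightarrow> poly_fun n (\<lambda>z. \<Sum>i\<in>I. f i z)"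
  by (induction I rule: infinite_finite_induct) (auto intro: poly_fun_add poly_fun_const)

lemma poly_fun_prod: "(\<And>i. i \<in> I \<Longrightarrow> poly_fun n (f i)) \<Longrightarrow> poly_fun n (\<lambda>z. \<Prod>i\<in>I. f i z)"
  by (induction I rule: infinite_finite_induct) (auto intro: poly_fun_mult poly_fun_const)

lemma poly_fun_power: "poly_fun n f \<Longrightarrow> poly_fun n (\<lambda>z. f z ^ k)"
  by (induction k) (auto intro: poly_fun_mult poly_fun_const)

lemma poly_fun_dilate: "poly_fun n (\<lambda>z. poly_eval n p (\<lambda>i. c i * z i))"
  unfolding poly_eval_def
  by (intro poly_fun_sum poly_fun_mult poly_fun_const poly_fun_prod poly_fun_power poly_fun_var)

definition poly_invertible_on :: "nat \<Rightarrow> (nat \<Rightarrow> complex) set \<Rightarrow> ((nat \<Rightarrow> complex) \<Rightarrow> complex) \<Rightarrow> bool" where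
  "poly_invertible_on n K f \<longleftrightarrow> (\<forall>e>0. \<exists>r. poly_fun n r \<and> (\<forall>s\<in>K. cmod (1 - r s * f s) \<le> e))"

text \<open>The Neumann series improves a crude polynomial inverse to an arbitrarily good one.\<close>

lemma poly_invertible_onI:
  assumes r: "poly_fun n r" and f: "poly_fun n f" and c: "c < 1" "\<And>s. s \<in> K \<Longrightarrow> cmod (1 - r s * f s) \<le> c"
  shows "poly_invertible_on n K f"
  unfolding poly_invertible_on_def
proof (intro allI impI)
  fix e :: real assume e: "0 < e"
  obtain N where N: "(max c 0) ^ N < e" using real_arch_pow_inv[OF e, of "max c 0"] c(1) by auto
  define g where "g s = 1 - r s * f s" for s
  have g: "poly_fun n g" unfolding g_def by (intro poly_fun_diff poly_fun_mult poly_fun_const r f)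
  have "1 - r s * (\<Sum>k<N. g s ^ k) * f s = g s ^ N" for s
    using one_diff_power_eq[of "g s" N] by (simp add: g_def algebra_simps)
  moreover have "cmod (g s ^ N) \<le> e" if "s \<in> K" for s
  proof -
    have "cmod (g s) ^ N \<le> max c 0 ^ N" using c(2)[OF that] by (intro power_mono) (auto simp: g_def)
    then show ?thesis using N by (simp add: norm_power)
  qed
  ultimately show "\<exists>r. poly_fun n r \<and> (\<forall>s\<in>K. cmod (1 - r s * f s) \<le> e)"
    by (intro exI[of _ "\<lambda>s. r s * (\<Sum>k<N. g s ^ k)"] conjI ballI poly_fun_mult poly_fun_sum poly_fun_power r g) simp
qed

text \<open>Continuation along the dilations \<open>s \<mapsto> (\<rho> s\<^sub>1, \<rho>\<^sup>2 s\<^sub>2, \<dots>, \<rho>\<^sup>n s\<^sub>n)\<close>, which map \<open>\<Gamma>\<^sub>n\<close> into itself for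
  \<open>0 \<le> \<rho> \<le> 1\<close>. For \<open>\<rho> = 0\<close> the dilated polynomial is a nonzero constant. All dilations of \<open>q\<close> are bounded
  below on \<open>\<Gamma>\<^sub>n\<close> by the same constant \<open>m\<close>, so a good polynomial inverse for one value of \<open>\<rho>\<close>, having
  modulus at most about \<open>1/m\<close>, is a crude inverse for all \<open>\<rho>\<close> within a fixed distance.\<close>

lemma poly_invertible_on_Gamma:
  assumes q: "poly_vars_le n q" and nz: "\<And>s. s \<in> Gamma_set n \<Longrightarrow> poly_eval n q s \<noteq> 0"
  shows "poly_invertible_on n (Gamma_set n) (poly_eval n q)"
proof -
  define \<Gamma> where "\<Gamma> = Gamma_set n"
  have comp: "compact \<Gamma>" unfolding \<Gamma>_def by (rule compact_Gamma_set)
  define g where "g r s = poly_eval n q (\<lambda>i. complex_of_real r ^ i * s i)" for r :: real and s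
  have g_fun: "poly_fun n (g r)" for r unfolding g_def by (rule poly_fun_dilate)
  have "continuous_on \<Gamma> (poly_eval n q)"
    by (intro continuous_poly_eval continuous_on_subset[OF continuous_on_product_coordinates]) auto
  then have "continuous_on \<Gamma> (\<lambda>s. cmod (poly_eval n q s))" by (intro continuous_intros)
  then obtain s0 where s0: "s0 \<in> \<Gamma>" "\<And>s. s \<in> \<Gamma> \<Longrightarrow> cmod (poly_eval n q s0) \<le> cmod (poly_eval n q s)"
    using continuous_attains_inf[OF comp] Gamma_set_nonempty unfolding \<Gamma>_def by blast
  define m where "m = cmod (poly_eval n q s0)"
  have m0: "m > 0" using nz s0(1) by (simp add: m_def \<Gamma>_def)
  have low: "m \<le> cmod (g r s)" if "s \<in> \<Gamma>" "0 \<le> r" "r \<le> 1" for r s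
  proof -
    have "g r s = poly_eval n q (\<lambda>i\<in>{1..n}. complex_of_real r ^ i * s i)"
      unfolding g_def by (rule poly_eval_cong) simp
    then show ?thesis using s0(2) Gamma_set_dilate that unfolding m_def \<Gamma>_def by metis
  qed
  have "continuous_on ({0..1} \<times> \<Gamma>) (\<lambda>x. g (fst x) (snd x))"
    unfolding g_def
  proof (rule continuous_poly_eval)
    fix i
    have "continuous_on ({0..1} \<times> \<Gamma>) (\<lambda>x. snd x i)"
      by (rule continuous_on_product_then_coordinatewise) (intro continuous_intros)
    then show "continuous_on ({0..1} \<times> \<Gamma>) (\<lambda>x. complex_of_real (fst x) ^ i * snd x i)"
      by (intro continuous_intros)
  qed
  then have "uniformly_continuous_on ({0..1} \<times> \<Gamma>) (\<lambda>x. g (fst x) (snd x))"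
    by (intro compact_uniformly_continuous compact_Times comp) auto
  then obtain d where d: "d > 0" "\<And>x y. x \<in> {0..1} \<times> \<Gamma> \<Longrightarrow> y \<in> {0..1} \<times> \<Gamma> \<Longrightarrow> dist y x < d \<Longrightarrow>
      dist (g (fst y) (snd y)) (g (fst x) (snd x)) < m / 4"
    unfolding uniformly_continuous_on_def using m0 by (metis zero_less_divide_iff zero_less_numeral)
  have step: "poly_invertible_on n \<Gamma> (g r')"
    if inv: "poly_invertible_on n \<Gamma> (g r)" and r: "0 \<le> r" "r \<le> 1" "0 \<le> r'" "r' \<le> 1" "\<bar>r - r'\<bar> < d" for r r'
  proof -
    obtain h where h: "poly_fun n h" "\<And>s. s \<in> \<Gamma> \<Longrightarrow> cmod (1 - h s * g r s) \<le> 1 / 4"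
      using inv unfolding poly_invertible_on_def by (metis zero_less_divide_1_iff zero_less_numeral)
    \<comment> \<open>The bound is \<open>1/4 + (5/4) (1/m) (m/4)\<close>.\<close>
    have "cmod (1 - h s * g r' s) \<le> 9 / 16" if s: "s \<in> \<Gamma>" for s
    proof -
      have "cmod (h s * g r s) \<le> cmod (1 - (1 - h s * g r s))" by simp
      also have "\<dots> \<le> 5 / 4" using norm_triangle_ineq4[of 1 "1 - h s * g r s"] h(2)[OF s] by simp
      finally have "cmod (h s) * m \<le> 5 / 4"
        using mult_left_mono[OF low[OF s r(1,2)], of "cmod (h s)"] by (simp add: norm_mult)
      moreover have "cmod (g r s - g r' s) \<le> m / 4"
        using d(2)[of "(r', s)" "(r, s)"] r s by (simp add: dist_Pair_Pair dist_norm)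
      then have "cmod (h s) * cmod (g r s - g r' s) \<le> cmod (h s) * (m / 4)" by (intro mult_left_mono) auto
      ultimately have "cmod (h s * (g r s - g r' s)) \<le> 5 / 16" by (simp add: norm_mult)
      moreover have e: "1 - h s * g r' s = (1 - h s * g r s) + h s * (g r s - g r' s)"
        by (simp add: algebra_simps)
      have "cmod (1 - h s * g r' s) \<le> cmod (1 - h s * g r s) + cmod (h s * (g r s - g r' s))"
        by (subst e) (rule norm_triangle_ineq)
      ultimately show ?thesis using h(2)[OF s] by linarith
    qed
    then show ?thesis by (intro poly_invertible_onI[OF h(1) g_fun, of "9/16"]) auto
  qed
  have "poly_invertible_on n \<Gamma> (g 0)"
  proof -
    define c where "c = poly_eval n q (\<lambda>_. 0)"
    have g0: "g 0 s = c" for s unfolding g_def c_def by (rule poly_eval_cong) simp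
    have "c \<noteq> 0" using low[OF s0(1), of 0] m0 g0[of s0] by auto
    then show ?thesis
      by (intro poly_invertible_onI[OF poly_fun_const[of n "inverse c"] g_fun, of 0]) (auto simp: g0)
  qed
  obtain N :: nat where N: "N > 0" "inverse (real N) < d" using ex_inverse_of_nat_less[OF d(1)] by auto
  have "k \<le> N \<Longrightarrow> poly_invertible_on n \<Gamma> (g (real k / real N))" for k
  proof (induction k)
    case 0
    then show ?case using \<open>poly_invertible_on n \<Gamma> (g 0)\<close> by simp
  next
    case (Suc k)
    have "real k / real N - real (Suc k) / real N = - inverse (real N)" using N(1) by (simp add: field_simps)
    then have "\<bar>real k / real N - real (Suc k) / real N\<bar> < d" using N by simp
    moreover have "real k / real N \<le> 1" "real (Suc k) / real N \<le> 1" using Suc.prems N(1) by (auto simp: divide_le_eq_1)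
    moreover have "poly_invertible_on n \<Gamma> (g (real k / real N))" using Suc by simp
    ultimately show ?case by (intro step[of "real k / real N" "real (Suc k) / real N"]) simp_all
  qed
  from this[of N] have "poly_invertible_on n \<Gamma> (g 1)" using N(1) by simp
  then show ?thesis by (simp add: g_def[abs_def] \<Gamma>_def)
qed

section \<open>Von Neumann's inequality for polynomials suffices\<close>

text \<open>The inequality is stated for arbitrary upper bounds \<open>c\<close> of \<open>|p|\<close> on \<open>\<Gamma>\<^sub>n\<close> instead of the supremum, so that it
  can be applied to estimates of \<open>p\<close>.\<close>

locale gamma_tuple = commuting_tuple +
  assumes vn: "\<And>p c x. poly_vars_le n p \<Longrightarrow> (\<And>s. s \<in> Gamma_set n \<Longrightarrow> cmod (poly_eval n p s) \<le> c) \<Longrightarrow>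
    x \<in> M \<Longrightarrow> norm (poly_op n p T x) \<le> c * norm x"
begin

lemma almost_inverse:
  assumes q: "poly_vars_le n q" "\<And>s. s \<in> Gamma_set n \<Longrightarrow> poly_eval n q s \<noteq> 0" and e: "e > 0"
  obtains r where "poly_vars_le n r" "\<And>s. s \<in> Gamma_set n \<Longrightarrow> cmod (1 - poly_eval n r s * poly_eval n q s) \<le> e"
  using poly_invertible_on_Gamma[OF q] e unfolding poly_invertible_on_def poly_fun_def by metis

lemma poly_op_one_minus: "poly_op n (cconst 1 + cconst (-1) * p) T x = x - poly_op n p T x" if "x \<in> M"
  by (simp add: poly_op_add poly_op_mult that)

text \<open>A polynomial \<open>r\<close> that inverts \<open>q\<close> on \<open>\<Gamma>\<^sub>n\<close> up to \<open>1/2\<close> makes \<open>r(T) q(T)\<close> differ from the identity by an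
  operator of norm at most \<open>1/2\<close>.\<close>

lemma poly_op_bij:
  assumes q: "poly_vars_le n q" "\<And>s. s \<in> Gamma_set n \<Longrightarrow> poly_eval n q s \<noteq> 0"
  shows "bij_betw (poly_op n q T) M M"
proof -
  obtain r where r: "poly_vars_le n r" "\<And>s. s \<in> Gamma_set n \<Longrightarrow> cmod (1 - poly_eval n r s * poly_eval n q s) \<le> 1/2"
    using almost_inverse[OF q, of "1/2"] by auto
  have "bij_betw (poly_op n (r * q) T) M M"
  proof (rule near_identity_bij[where c = "1/2", OF M bounded_op_onD(1)[OF bounded_poly_op]])
    fix x assume x: "x \<in> M"
    have "norm (poly_op n (cconst 1 + cconst (-1) * (r * q)) T x) \<le> 1/2 * norm x"
      by (rule vn[OF _ _ x])
         (use r q in \<open>auto simp: poly_eval_add poly_eval_mult intro!: poly_vars_le_add poly_vars_le_mult\<close>)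
    then show "norm (x - poly_op n (r * q) T x) \<le> 1/2 * norm x" unfolding poly_op_one_minus[OF x] .
  qed (use poly_op_mem in auto)
  then have bij: "inj_on (poly_op n (r * q) T) M" "poly_op n (r * q) T ` M = M" by (auto simp: bij_betw_def)
  show ?thesis
  proof (intro bij_betw_imageI inj_onI)
    fix x y assume "x \<in> M" "y \<in> M" "poly_op n q T x = poly_op n q T y"
    then show "x = y" using inj_onD[OF bij(1), of x y] by (simp add: poly_op_mult)
  next
    show "poly_op n q T ` M = M"
    proof (intro subset_antisym subsetI)
      fix y assume "y \<in> M"
      then obtain x where x: "x \<in> M" "y = poly_op n (r * q) T x" using bij(2) by blast
      then have "y = poly_op n q T (poly_op n r T x)" by (simp add: poly_op_mult poly_op_commute)
      then show "y \<in> poly_op n q T ` M" using poly_op_mem[OF x(1)] by blast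
    qed (use poly_op_mem in auto)
  qed
qed

text \<open>With an almost inverse \<open>r\<close> of \<open>q\<close>, the polynomial \<open>p r\<close> is close to \<open>p / q\<close> on \<open>\<Gamma>\<^sub>n\<close>, and \<open>p(T) r(T)\<close> is close
  to \<open>p(T) q(T)\<^sup>-\<^sup>1\<close>.\<close>

lemma rational_op_bound:
  assumes p: "poly_vars_le n p" and q: "poly_vars_le n q" "\<And>s. s \<in> Gamma_set n \<Longrightarrow> poly_eval n q s \<noteq> 0"
    and x: "x \<in> M"
  shows "norm (rational_op n M p q T x)
    \<le> (SUP z\<in>Gamma_set n. cmod (poly_eval n p z / poly_eval n q z)) * norm x"
proof -
  define C where "C = (SUP z\<in>Gamma_set n. cmod (poly_eval n p z / poly_eval n q z))"
  have cont: "continuous_on (Gamma_set n) (poly_eval n p')" for p'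
    by (intro continuous_poly_eval continuous_on_subset[OF continuous_on_product_coordinates]) auto
  have "compact ((\<lambda>z. cmod (poly_eval n p z / poly_eval n q z)) ` Gamma_set n)"
    by (intro compact_continuous_image compact_Gamma_set continuous_intros cont) (use q in auto)
  then have bdd: "bdd_above ((\<lambda>z. cmod (poly_eval n p z / poly_eval n q z)) ` Gamma_set n)"
    by (intro bounded_imp_bdd_above compact_imp_bounded)
  have C: "cmod (poly_eval n p s / poly_eval n q s) \<le> C" if "s \<in> Gamma_set n" for s
    unfolding C_def using that by (rule cSUP_upper[OF _ bdd])
  have C0: "0 \<le> C" using C Gamma_set_nonempty by (metis all_not_in_conv norm_ge_zero order_trans)
  have "bounded (poly_eval n p ` Gamma_set n)"
    by (intro compact_imp_bounded compact_continuous_image compact_Gamma_set cont)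
  then obtain B where B: "B > 0" "\<And>s. s \<in> Gamma_set n \<Longrightarrow> cmod (poly_eval n p s) \<le> B"
    unfolding bounded_pos by blast
  define y where "y = inv_into M (poly_op n q T) x"
  have y: "y \<in> M" "poly_op n q T y = x"
    using poly_op_bij[OF q] x by (auto simp: y_def bij_betw_def inv_into_into f_inv_into_f)
  have "norm (poly_op n p T y) \<le> C * norm x + e" if e: "e > 0" for e
  proof -
    define d where "d = e / (B * norm y + C * norm x + 1)"
    have den: "B * norm y + C * norm x + 1 > 0" using B(1) C0 by (intro add_nonneg_pos add_nonneg_nonneg) auto
    have d: "d > 0" unfolding d_def using e den by simp
    obtain r where r: "poly_vars_le n r" "\<And>s. s \<in> Gamma_set n \<Longrightarrow> cmod (1 - poly_eval n r s * poly_eval n q s) \<le> d"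
      using almost_inverse[OF q d] by blast
    have 1: "norm (poly_op n (p * (cconst 1 + cconst (-1) * (r * q))) T y) \<le> (B * d) * norm y"
    proof (rule vn[OF _ _ y(1)])
      fix s assume s: "s \<in> Gamma_set n"
      show "cmod (poly_eval n (p * (cconst 1 + cconst (-1) * (r * q))) s) \<le> B * d"
        using mult_mono[OF B(2)[OF s] r(2)[OF s]] B(1) by (simp add: poly_eval_add poly_eval_mult norm_mult)
    qed (intro poly_vars_le_mult poly_vars_le_add p r q poly_vars_le_const)
    have 2: "norm (poly_op n (p * r) T x) \<le> (C * (1 + d)) * norm x"
    proof (rule vn[OF _ _ x])
      fix s assume s: "s \<in> Gamma_set n"
      have "cmod (poly_eval n r s * poly_eval n q s) \<le> 1 + d"
        using norm_triangle_ineq4[of 1 "1 - poly_eval n r s * poly_eval n q s"] r(2)[OF s] by simp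
      then have "cmod (poly_eval n p s / poly_eval n q s) * cmod (poly_eval n r s * poly_eval n q s) \<le> C * (1 + d)"
        using C[OF s] C0 by (intro mult_mono) auto
      then show "cmod (poly_eval n (p * r) s) \<le> C * (1 + d)"
        using q(2)[OF s] by (simp add: poly_eval_mult norm_mult norm_divide)
    qed (intro poly_vars_le_mult p r)
    have "poly_op n p T y = poly_op n (p * (cconst 1 + cconst (-1) * (r * q))) T y + poly_op n (p * r) T x"
    proof -
      have "poly_op n (p * (cconst 1 + cconst (-1) * (r * q))) T y = poly_op n p T y - poly_op n p T (poly_op n (r * q) T y)"
        unfolding poly_op_mult[OF y(1), of p] poly_op_one_minus[OF y(1)]
        using bop_diff[OF M bounded_poly_op y(1) poly_op_mem[OF y(1)]] .
      moreover have "poly_op n p T (poly_op n (r * q) T y) = poly_op n (p * r) T x"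
        unfolding poly_op_mult[OF y(1), of r] y(2) poly_op_mult[OF x] ..
      ultimately show ?thesis by simp
    qed
    then have "norm (poly_op n p T y) \<le> (B * d) * norm y + (C * (1 + d)) * norm x"
      using norm_triangle_ineq 1 2 by (smt (verit))
    also have "\<dots> = C * norm x + d * (B * norm y + C * norm x)" by (simp add: algebra_simps)
    also have "\<dots> \<le> C * norm x + e" using d den unfolding d_def
      by (simp add: field_simps)
    finally show ?thesis .
  qed
  then have "norm (poly_op n p T y) \<le> C * norm x" by (rule field_le_epsilon)
  then show ?thesis by (simp add: rational_op_def y_def C_def)
qed

text \<open>If \<open>w \<notin> \<Gamma>\<^sub>n\<close> has a root \<open>a\<close> outside the disc, then \<open>q(s) = a\<^sup>n - s\<^sub>1 a\<^sup>n\<^sup>-\<^sup>1 + s\<^sub>2 a\<^sup>n\<^sup>-\<^sup>2 - \<dots>\<close> vanishes at \<open>w\<close> but not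
  on \<open>\<Gamma>\<^sub>n\<close>. Since \<open>q\<close> has degree one, \<open>q(T)\<close> is a linear combination of the \<open>T\<^sub>i - w\<^sub>i\<close>, and it is
  invertible.\<close>

lemma taylor_spectrum_subset_Gamma: "taylor_spectrum n M T \<subseteq> Gamma_set n"
proof
  fix w assume "w \<in> taylor_spectrum n M T"
  then have w: "w \<in> {1..n} \<rightarrow>\<^sub>E UNIV" and nex: "\<not> koszul_exact n M (\<lambda>i x. T i x - w i *\<^sub>C x)"
    by (auto simp: taylor_spectrum_def)
  show "w \<in> Gamma_set n"
  proof (rule ccontr)
    assume "w \<notin> Gamma_set n"
    then obtain a where a: "1 < cmod a" "a ^ n + (\<Sum>k=1..n. (-1) ^ k * w k * a ^ (n - k)) = 0"
      using root_outside_disc[OF w] by blast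
    define c where "c k = (-1) ^ k * a ^ (n - k)" for k
    define q where "q = cconst (a ^ n) + (\<Sum>k=1..n. cconst (c k) * cvar k)"
    have q: "poly_vars_le n q" unfolding q_def
      by (intro poly_vars_le_add poly_vars_le_const poly_vars_le_sum poly_vars_le_mult poly_vars_le_var)
    have q_eval: "poly_eval n q s = a ^ n + (\<Sum>k=1..n. c k * s k)" for s
      unfolding q_def poly_eval_add poly_eval_sum poly_eval_mult poly_eval_const
      by (intro arg_cong2[of _ _ _ _ "(+)"] refl sum.cong) (simp only: poly_eval_var)
    have q_op: "poly_op n q T x = a ^ n *\<^sub>C x + (\<Sum>k=1..n. c k *\<^sub>C T k x)" if x: "x \<in> M" for x
      unfolding q_def poly_op_add poly_op_sum poly_op_mult[OF x] poly_op_const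
      by (intro arg_cong2[of _ _ _ _ "(+)"] refl sum.cong) (simp only: poly_op_var)
    have nz: "poly_eval n q s \<noteq> 0" if s: "s \<in> Gamma_set n" for s
    proof -
      obtain z where z: "\<And>j. j \<in> {1..n} \<Longrightarrow> cmod (z j) \<le> 1" "s = sym_map n z"
        using Gamma_setE[OF s] by blast
      have "poly_eval n q s = (\<Sum>k\<le>n. (-1) ^ k * elem_sym n z k * a ^ (n - k))"
        unfolding q_eval z(2) atMost_atLeast0 sum.atLeast_Suc_atMost[OF le0]
        by (auto simp: elem_sym_0 c_def sym_map_elem_sym intro!: sum.cong)
      also have "\<dots> = (\<Prod>i=1..n. a - z i)" by (rule prod_linear_factors[symmetric])
      also have "\<dots> \<noteq> 0" using z(1) a(1) by (auto simp: prod_zero_iff) (metis One_nat_def leD)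
      finally show ?thesis .
    qed
    define A where "A i x = T i x - w i *\<^sub>C x" for i x
    have "poly_op n q T x = (\<Sum>k=1..n. c k *\<^sub>C A k x)" if x: "x \<in> M" for x
    proof -
      have "a ^ n = - (\<Sum>k=1..n. c k * w k)"
        using a(2) by (simp add: c_def eq_neg_iff_add_eq_0 mult_ac)
      then have "a ^ n *\<^sub>C x = - (\<Sum>k=1..n. c k *\<^sub>C w k *\<^sub>C x)"
        by (simp add: scaleC_sum_left scaleC_scaleC)
      then show ?thesis
        unfolding q_op[OF x] A_def scaleC_diff_right sum_subtractf by simp
    qed
    then have "bij_betw (\<lambda>x. \<Sum>k=1..n. c k *\<^sub>C A k x) M M"
      using poly_op_bij[OF q nz] bij_betw_cong[of M "poly_op n q T" "\<lambda>x. \<Sum>k=1..n. c k *\<^sub>C A k x" M] by blast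
    moreover have "koszul_tuple n M A" unfolding A_def[abs_def] by (rule koszul_tuple_shift)
    ultimately show False using koszul_tuple.koszul_exact_if_bij nex unfolding A_def by blast
  qed
qed

theorem Gamma_contraction: "Gamma_contraction_on n M T"
  unfolding Gamma_contraction_on_def spectral_set_on_def
  using ct Gamma_set_ext compact_Gamma_set taylor_spectrum_subset_Gamma rational_op_bound by blast

end

text \<open>This is the condition for a spectral set in the case of the denominator \<open>1\<close>.\<close>

lemma Gamma_contraction_vn:
  fixes T :: "nat \<Rightarrow> 'a::chilbert_space \<Rightarrow> 'a"
  assumes T: "Gamma_contraction_on n UNIV T"
  shows "gamma_tuple n UNIV T"
proof -
  interpret commuting_tuple n UNIV T using T by unfold_locales (auto simp: Gamma_contraction_on_def)
  show ?thesis
  proof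
    fix p c x
    assume p: "poly_vars_le n p" and c: "\<And>s. s \<in> Gamma_set n \<Longrightarrow> cmod (poly_eval n p s) \<le> c"
    have one: "poly_op n 1 T = id" by (rule ext) simp
    have "norm (rational_op n UNIV p q T x)
        \<le> (SUP z\<in>Gamma_set n. cmod (poly_eval n p z / poly_eval n q z)) * norm x"
      if "poly_vars_le n q" "\<forall>z\<in>Gamma_set n. poly_eval n q z \<noteq> 0" for q
      using T p that unfolding Gamma_contraction_on_def spectral_set_on_def by blast
    from this[of "cconst 1"] have "norm (rational_op n UNIV p (cconst 1) T x)
        \<le> (SUP z\<in>Gamma_set n. cmod (poly_eval n p z / poly_eval n (cconst 1) z)) * norm x" by simp
    also have "\<dots> \<le> c * norm x"
      using c Gamma_set_nonempty by (intro mult_right_mono cSUP_least) auto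
    finally show "norm (poly_op n p T x) \<le> c * norm x" by (simp add: rational_op_def one)
  qed
qed

section \<open>Joint approximate eigenvalues of commuting normal operators\<close>

text \<open>If \<open>F\<close> consists of the \<open>A\<^sub>i - w\<^sub>i\<close>, this says that \<open>w\<close> is a joint approximate eigenvalue. Further operators
  in \<open>F\<close> serve to control which \<open>w\<close> can occur.\<close>

definition approx_null :: "'a::chilbert_space set \<Rightarrow> ('a \<Rightarrow> 'a) set \<Rightarrow> bool" where
  "approx_null M F \<longleftrightarrow> (\<forall>e>0. \<exists>x\<in>M. norm x = 1 \<and> (\<forall>B\<in>F. norm (B x) \<le> e))"

lemma approx_null_subset: "approx_null M G \<Longrightarrow> F \<subseteq> G \<Longrightarrow> approx_null M F"
  unfolding approx_null_def by blast

text \<open>Carrying the adjoint along makes translates \<open>A - c\<close> easy to handle.\<close>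

definition normal_pair :: "'a::chilbert_space set \<Rightarrow> ('a \<Rightarrow> 'a) \<Rightarrow> ('a \<Rightarrow> 'a) \<Rightarrow> bool" where
  "normal_pair M A A' \<longleftrightarrow> bounded_op_on M A \<and> bounded_op_on M A' \<and>
     (\<forall>x\<in>M. \<forall>y\<in>M. cinner (A x) y = cinner x (A' y)) \<and> (\<forall>x\<in>M. A (A' x) = A' (A x))"

lemma normal_pairD:
  assumes "normal_pair M A A'"
  shows "bounded_op_on M A" "bounded_op_on M A'"
    "x \<in> M \<Longrightarrow> y \<in> M \<Longrightarrow> cinner (A x) y = cinner x (A' y)"
    "x \<in> M \<Longrightarrow> y \<in> M \<Longrightarrow> cinner (A' x) y = cinner x (A y)"
    "x \<in> M \<Longrightarrow> A (A' x) = A' (A x)"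
    "x \<in> M \<Longrightarrow> A x \<in> M" "x \<in> M \<Longrightarrow> A' x \<in> M"
  using assms unfolding normal_pair_def bounded_op_on_def by (auto) (metis cinner_commute)+

lemma normal_pair_norm:
  assumes "normal_pair M A A'" "x \<in> M"
  shows "norm (A' x) = norm (A x)"
proof -
  note D = normal_pairD[OF assms(1)]
  have "cinner (A' x) (A' x) = cinner (A x) (A x)"
    using D(4)[OF assms(2) D(7)[OF assms(2)]] D(3)[OF assms(2) D(6)[OF assms(2)]] D(5)[OF assms(2)] by simp
  then have "(norm (A' x))\<^sup>2 = (norm (A x))\<^sup>2" unfolding cinner_self of_real_eq_iff .
  then show ?thesis by (simp add: power2_eq_iff_nonneg)
qed

lemma normal_on_pair:
  assumes "closed_csubspace M" "normal_on M T"
  shows "normal_pair M T (adjoint_on M T)"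
  using assms bounded_op_on_adjoint[OF assms(1), of T] cinner_adjoint_on[OF assms(1), of T]
  unfolding normal_pair_def normal_on_def by auto

lemma normal_pair_shift:
  assumes M: "closed_csubspace M" and A: "normal_pair M A A'"
  shows "normal_pair M (\<lambda>x. A x - c *\<^sub>C x) (\<lambda>x. A' x - cnj c *\<^sub>C x)"
proof -
  note D = normal_pairD[OF A]
  have l: "A (A' x - cnj c *\<^sub>C x) = A (A' x) - cnj c *\<^sub>C A x" "A' (A x - c *\<^sub>C x) = A' (A x) - c *\<^sub>C A' x"
    if "x \<in> M" for x
    using that D(6,7)[OF that] M
    by (simp_all add: bop_diff[OF M D(1)] bop_diff[OF M D(2)]
        bop_scaleC[OF M D(1)] bop_scaleC[OF M D(2)]
        csubspace_scaleC)
  show ?thesis unfolding normal_pair_def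
  proof (intro conjI ballI)
    fix x y assume "x \<in> M" "y \<in> M"
    then show "cinner (A x - c *\<^sub>C x) y = cinner x (A' y - cnj c *\<^sub>C y)"
      by (simp add: cinner_diff_left cinner_diff_right cinner_scaleC_left cinner_scaleC_right D(3))
  next
    fix x assume x: "x \<in> M"
    show "A (A' x - cnj c *\<^sub>C x) - c *\<^sub>C (A' x - cnj c *\<^sub>C x) = A' (A x - c *\<^sub>C x) - cnj c *\<^sub>C (A x - c *\<^sub>C x)"
      unfolding l[OF x] D(5)[OF x] by (simp add: scaleC_diff_right scaleC_scaleC mult.commute)
  qed (intro bounded_op_on_diff bounded_op_on_scaleC bounded_op_on_id M D(1,2))+
qed

lemma commute_shift:
  assumes M: "closed_csubspace M" and B: "bounded_op_on M B"
    and A: "\<And>x. x \<in> M \<Longrightarrow> A x \<in> M" and c: "\<And>x. x \<in> M \<Longrightarrow> B (A x) = A (B x)" and x: "x \<in> M"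
  shows "B (A x - c *\<^sub>C x) = A (B x) - c *\<^sub>C B x"
  using bop_diff[OF M B A[OF x] csubspace_scaleC[OF M x]] c[OF x]
    bop_scaleC[OF M B x] by simp

text \<open>Let \<open>\<mu>\<close> be the asymptotically largest factor by which \<open>A\<close> stretches common approximate null vectors of \<open>F\<close>.
  If \<open>x\<close> is such a vector that \<open>A\<close> stretches by nearly \<open>\<mu>\<close>, then \<open>A x\<close> is again an approximate null
  vector of \<open>F\<close>, so \<open>\<parallel>A\<^sup>* A x\<parallel> = \<parallel>A\<^sup>2 x\<parallel>\<close> is at most about \<open>\<mu>\<^sup>2\<close>, and expanding the square shows that
  \<open>A\<^sup>* A x\<close> is close to \<open>\<mu>\<^sup>2 x\<close>.\<close>

lemma approx_null_insert_modulus: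
  fixes M :: "'a::chilbert_space set"
  assumes M: "closed_csubspace M" and A: "normal_pair M A A'"
    and F: "\<And>B. B \<in> F \<Longrightarrow> bounded_op_on M B" "\<And>B x. B \<in> F \<Longrightarrow> x \<in> M \<Longrightarrow> B (A x) = A (B x)"
    and an: "approx_null M F"
  shows "\<exists>l\<ge>0. approx_null M (insert (\<lambda>x. A' (A x) - complex_of_real l *\<^sub>C x) F) \<and>
    (F = {} \<longrightarrow> (\<forall>x\<in>M. (norm (A x))\<^sup>2 \<le> l * (norm x)\<^sup>2))"
proof -
  note D = normal_pairD[OF A]
  note linA = bounded_op_onD(1)[OF D(1)]
  obtain b where b: "b > 0" "\<And>x. x \<in> M \<Longrightarrow> norm (A x) \<le> b * norm x"
    using bounded_op_on_bound[OF D(1)] by blast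
  define E where "E e = {x\<in>M. norm x = 1 \<and> (\<forall>B\<in>F. norm (B x) \<le> e)}" for e :: real
  define \<beta> where "\<beta> e = (SUP x\<in>E e. norm (A x))" for e
  have E_ne: "E e \<noteq> {}" if "e > 0" for e using an that unfolding approx_null_def E_def by blast
  have bdd: "bdd_above ((\<lambda>x. norm (A x)) ` E e)" for e
    by (rule bdd_aboveI2[of _ _ b]) (use b in \<open>force simp: E_def\<close>)
  have le_\<beta>: "norm (A x) \<le> \<beta> e" if "x \<in> E e" for x e
    unfolding \<beta>_def using that by (rule cSUP_upper[OF _ bdd])
  have E_mono: "E e \<subseteq> E e'" if "e \<le> e'" for e e' using that unfolding E_def by force
  have \<beta>0: "0 \<le> \<beta> e" if e: "e > 0" for e
  proof -
    obtain x where "x \<in> E e" using E_ne[OF e] by blast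
    then show ?thesis using le_\<beta>[of x e] norm_ge_zero[of "A x"] by linarith
  qed
  define \<mu> where "\<mu> = (INF e\<in>{0<..}. \<beta> e)"
  have bddb: "bdd_below (\<beta> ` {0<..})" by (rule bdd_belowI2[of _ 0]) (use \<beta>0 in auto)
  have \<mu>0: "0 \<le> \<mu>" unfolding \<mu>_def by (rule cINF_greatest) (use \<beta>0 in auto)
  have \<mu>_le: "\<mu> \<le> \<beta> e" if "e > 0" for e unfolding \<mu>_def using that by (intro cINF_lower[OF bddb]) auto
  have near: "\<exists>e>0. \<beta> e < \<mu> + d" if "d > 0" for d
  proof -
    have "(INF e\<in>{0<..}. \<beta> e) < \<mu> + d" using that unfolding \<mu>_def by simp
    then show ?thesis using cINF_less_iff[OF _ bddb] by auto
  qed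
  have norm_eq: "norm (A' (A x)) = norm (A (A x))" if "x \<in> M" for x
    using normal_pair_norm[OF A D(6)[OF that]] .
  have "\<exists>x\<in>M. norm x = 1 \<and> (\<forall>B\<in>insert (\<lambda>x. A' (A x) - complex_of_real (\<mu>\<^sup>2) *\<^sub>C x) F. norm (B x) \<le> h)"
    if h: "h > 0" for h
  proof (cases "\<mu> = 0")
    case True
    obtain e0 where e0: "e0 > 0" "\<beta> e0 < h / b" using near[of "h / b"] h b(1) True by auto
    obtain x where x: "x \<in> E (min e0 h)" using E_ne[of "min e0 h"] e0 h by auto
    then have x0: "x \<in> E e0" "x \<in> E h" using E_mono[of "min e0 h" e0] E_mono[of "min e0 h" h] by auto
    then have xM: "x \<in> M" by (simp add: E_def)
    have "norm (A' (A x)) \<le> b * norm (A x)" using norm_eq[OF xM] b(2)[OF D(6)[OF xM]] by simp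
    also have "\<dots> \<le> b * (h / b)" using le_\<beta>[OF x0(1)] e0(2) b(1) by (intro mult_left_mono) auto
    finally show ?thesis using True x0(2) b(1) unfolding E_def by (intro bexI[of _ x]) auto
  next
    case False
    then have \<mu>: "\<mu> > 0" using \<mu>0 by simp
    have "((\<lambda>d. (\<mu> + d) ^ 4 - 2 * \<mu>\<^sup>2 * (\<mu> - d)\<^sup>2 + \<mu> ^ 4) \<longlongrightarrow> (\<mu> + 0) ^ 4 - 2 * \<mu>\<^sup>2 * (\<mu> - 0)\<^sup>2 + \<mu> ^ 4) (at_right 0)"
      by (intro tendsto_intros)
    moreover have "(\<mu> + 0) ^ 4 - 2 * \<mu>\<^sup>2 * (\<mu> - 0)\<^sup>2 + \<mu> ^ 4 < h\<^sup>2"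
      using h by (simp add: power2_eq_square power4_eq_xxxx)
    ultimately have ev: "\<forall>\<^sub>F d in at_right 0. (\<mu> + d) ^ 4 - 2 * \<mu>\<^sup>2 * (\<mu> - d)\<^sup>2 + \<mu> ^ 4 < h\<^sup>2"
      by (rule order_tendstoD(2))
    have "\<forall>\<^sub>F d in at_right 0. d \<in> {0<..<\<mu> / 2}" using \<mu> by (intro eventually_at_right_real) simp
    then have "\<forall>\<^sub>F d in at_right 0. d < \<mu> / 2 \<and> 0 < d \<and> (\<mu> + d) ^ 4 - 2 * \<mu>\<^sup>2 * (\<mu> - d)\<^sup>2 + \<mu> ^ 4 < h\<^sup>2"
      using ev by eventually_elim simp
    then obtain d where d: "d < \<mu> / 2" "0 < d" "(\<mu> + d) ^ 4 - 2 * \<mu>\<^sup>2 * (\<mu> - d)\<^sup>2 + \<mu> ^ 4 < h\<^sup>2"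
      using eventually_happens[of _ "at_right (0::real)"] by (auto simp: trivial_limit_at_right_real)
    obtain e0 where e0: "e0 > 0" "\<beta> e0 < \<mu> + d" using near[OF d(2)] by blast
    \<comment> \<open>The last entry ensures that the normalized vector \<open>A x / \<parallel>A x\<parallel>\<close> still lies in \<open>E e0\<close>, as \<open>\<parallel>A x\<parallel> > \<mu>/2\<close>.\<close>
    define e where "e = min h (min e0 (e0 * \<mu> / (2 * b)))"
    have e: "e > 0" "e \<le> h" "e \<le> e0" "e \<le> e0 * \<mu> / (2 * b)" using h e0 \<mu> b(1) unfolding e_def by auto
    have "\<mu> - d < (SUP x\<in>E e. norm (A x))" using \<mu>_le[OF e(1)] d(2) unfolding \<beta>_def by linarith
    then obtain x where x: "x \<in> E e" "\<mu> - d < norm (A x)"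
      using less_cSUP_iff[OF E_ne[OF e(1)] bdd] by blast
    have xM: "x \<in> M" "norm x = 1" using x by (auto simp: E_def)
    have up: "norm (A x) \<le> \<mu> + d" using le_\<beta>[of x e0] x(1) E_mono[OF e(3)] e0(2) by force
    have half: "\<mu> / 2 < norm (A x)" using x(2) d(1) by linarith
    define y where "y = complex_of_real (inverse (norm (A x))) *\<^sub>C A x"
    have yM: "y \<in> M" unfolding y_def using D(6)[OF xM(1)] M by (intro csubspace_scaleC)
    have pos: "norm (A x) > 0" using half \<mu> by linarith
    have y1: "norm y = 1" unfolding y_def using pos by (simp add: norm_scaleC del: of_real_inverse)
    have "y \<in> E e0" unfolding E_def
    proof (intro CollectI conjI ballI yM y1)
      fix B assume B: "B \<in> F"
      have "norm (B y) = inverse (norm (A x)) * norm (A (B x))"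
        unfolding y_def bop_scaleC[OF M F(1)[OF B] D(6)[OF xM(1)]]
        using F(2)[OF B xM(1)] by (simp add: norm_scaleC del: of_real_inverse)
      also have "norm (A (B x)) \<le> b * norm (B x)" using b(2) bounded_op_onD(2)[OF F(1)[OF B] xM(1)] by blast
      also have "\<dots> \<le> b * (e0 * \<mu> / (2 * b))" using x(1) B b(1) e(4) unfolding E_def by (intro mult_left_mono) force+
      also have "\<dots> = e0 * (\<mu> / 2)" using b(1) by simp
      also have "\<dots> \<le> e0 * norm (A x)" using half e0(1) by simp
      finally show "norm (B y) \<le> e0" using pos by (simp add: field_simps)
    qed
    then have "norm (A y) \<le> \<mu> + d" using le_\<beta>[of y e0] e0(2) by linarith
    moreover have "norm (A y) = inverse (norm (A x)) * norm (A (A x))"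
      unfolding y_def clinear_on_scaleC[OF M linA D(6)[OF xM(1)]] by (simp add: norm_scaleC del: of_real_inverse)
    ultimately have "norm (A (A x)) \<le> (\<mu> + d) * norm (A x)" using pos by (simp add: field_simps)
    also have "\<dots> \<le> (\<mu> + d) * (\<mu> + d)" using up \<mu> d(2) by (intro mult_left_mono) auto
    finally have AA: "norm (A' (A x)) \<le> (\<mu> + d)\<^sup>2" using norm_eq[OF xM(1)] by (simp add: power2_eq_square)
    have lo: "(\<mu> - d)\<^sup>2 \<le> (norm (A x))\<^sup>2" using x(2) d(1) \<mu> by (intro power_mono) auto
    have "cinner (A' (A x)) (complex_of_real (\<mu>\<^sup>2) *\<^sub>C x) = complex_of_real (\<mu>\<^sup>2 * (norm (A x))\<^sup>2)"
      using D(4)[OF D(6)[OF xM(1)] xM(1)] by (simp add: cinner_scaleC_right cinner_self)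
    then have "Re (cinner (A' (A x)) (complex_of_real (\<mu>\<^sup>2) *\<^sub>C x)) = \<mu>\<^sup>2 * (norm (A x))\<^sup>2"
      by (metis Re_complex_of_real)
    then have "(norm (A' (A x) - complex_of_real (\<mu>\<^sup>2) *\<^sub>C x))\<^sup>2
        = (norm (A' (A x)))\<^sup>2 - 2 * \<mu>\<^sup>2 * (norm (A x))\<^sup>2 + \<mu> ^ 4"
      unfolding norm_diff_sq norm_scaleC norm_of_real xM(2) by (simp flip: power_mult)
    also have "\<dots> \<le> ((\<mu> + d)\<^sup>2)\<^sup>2 - 2 * \<mu>\<^sup>2 * (\<mu> - d)\<^sup>2 + \<mu> ^ 4"
      using power_mono[OF AA norm_ge_zero, of 2] mult_left_mono[OF lo, of "2 * \<mu>\<^sup>2"] by simp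
    also have "\<dots> < h\<^sup>2" using d(3) by (simp flip: power_mult)
    finally have sq: "(norm (A' (A x) - complex_of_real (\<mu>\<^sup>2) *\<^sub>C x))\<^sup>2 < h\<^sup>2" .
    have "norm (A' (A x) - complex_of_real (\<mu>\<^sup>2) *\<^sub>C x) \<le> h"
      by (rule power2_le_imp_le[OF less_imp_le[OF sq] less_imp_le[OF h]])
    then show ?thesis using xM x(1) E_mono[OF e(2)] unfolding E_def by (intro bexI[of _ x]) auto
  qed
  moreover have "(norm (A x))\<^sup>2 \<le> \<mu>\<^sup>2 * (norm x)\<^sup>2" if "F = {}" "x \<in> M" for x
  proof (cases "x = 0")
    case False
    define u where "u = complex_of_real (inverse (norm x)) *\<^sub>C x"
    have u: "u \<in> M" "norm u = 1" unfolding u_def using False that M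
      by (auto intro: csubspace_scaleC simp: norm_scaleC simp del: of_real_inverse)
    have "norm (A u) \<le> \<mu>" unfolding \<mu>_def
    proof (rule cINF_greatest)
      fix e :: real assume "e \<in> {0<..}"
      show "norm (A u) \<le> \<beta> e" using u that by (intro le_\<beta>) (auto simp: E_def)
    qed auto
    moreover have "norm (A u) = inverse (norm x) * norm (A x)"
      unfolding u_def clinear_on_scaleC[OF M linA that(2)] by (simp add: norm_scaleC del: of_real_inverse)
    ultimately have "norm (A x) \<le> \<mu> * norm x" using False by (simp add: field_simps)
    then show ?thesis using power_mono[of "norm (A x)" "\<mu> * norm x" 2] by (simp add: power_mult_distrib)
  qed (use that clinear_on_0[OF M linA] in simp)
  ultimately show ?thesis unfolding approx_null_def by (intro exI[of _ "\<mu>\<^sup>2"]) auto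
qed

text \<open>Knowing \<open>|A|\<^sup>2\<close>, \<open>|A - 1|\<^sup>2\<close> and \<open>|A - \<i>|\<^sup>2\<close> at an approximate eigenvector determines \<open>A\<close> there.\<close>

lemma approx_null_insert_normal:
  fixes M :: "'a::chilbert_space set"
  assumes M: "closed_csubspace M" and A: "normal_pair M A A'"
    and F: "\<And>B. B \<in> F \<Longrightarrow> bounded_op_on M B" "\<And>B x. B \<in> F \<Longrightarrow> x \<in> M \<Longrightarrow> B (A x) = A (B x)"
    and an: "approx_null M F"
  shows "\<exists>w. approx_null M (insert (\<lambda>x. A x - w *\<^sub>C x) F)"
proof -
  note D = normal_pairD[OF A]
  note linA = bounded_op_onD(1)[OF D(1)] note linA' = bounded_op_onD(1)[OF D(2)]
  define P where "P c x = A x - c *\<^sub>C x" for c x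
  define P' where "P' c x = A' x - cnj c *\<^sub>C x" for c x
  have P: "normal_pair M (P c) (P' c)" for c
    unfolding P_def P'_def by (rule normal_pair_shift[OF M A])
  define R where "R c l x = P' c (P c x) - complex_of_real l *\<^sub>C x" for c l x
  have R_bd: "bounded_op_on M (R c l)" for c l
    unfolding R_def
    by (rule bounded_op_on_diff[OF M bounded_op_on_comp[OF normal_pairD(2)[OF P] normal_pairD(1)[OF P]]
          bounded_op_on_scaleC[OF M bounded_op_on_id]])
  have PP: "P' c (P c x) = A' (A x) - c *\<^sub>C A' x - cnj c *\<^sub>C A x + (cnj c * c) *\<^sub>C x" if "x \<in> M" for c x
    unfolding P'_def P_def
    using clinear_on_diff[OF M linA' D(6)[OF that] csubspace_scaleC[OF M that]] clinear_on_scaleC[OF M linA' that]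
    by (simp add: scaleC_diff_right scaleC_scaleC)
  have PA: "P c (A x) = A (P c x)" if "x \<in> M" for c x
    unfolding P_def
    using clinear_on_diff[OF M linA D(6)[OF that] csubspace_scaleC[OF M that]] clinear_on_scaleC[OF M linA that]
    by simp
  have P'A: "P' c (A x) = A (P' c x)" if "x \<in> M" for c x
    unfolding P'_def
    using clinear_on_diff[OF M linA D(7)[OF that] csubspace_scaleC[OF M that]] clinear_on_scaleC[OF M linA that]
      D(5)[OF that] by simp
  have R_A: "R c l (A x) = A (R c l x)" if x: "x \<in> M" for c l x
  proof -
    have Px: "P c x \<in> M" "P' c (P c x) \<in> M"
      using normal_pairD(6)[OF P x] normal_pairD(7)[OF P normal_pairD(6)[OF P x]] .
    have "A (R c l x) = A (P' c (P c x)) - complex_of_real l *\<^sub>C A x"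
      unfolding R_def
      using clinear_on_diff[OF M linA Px(2) csubspace_scaleC[OF M x]] clinear_on_scaleC[OF M linA x] by simp
    then show ?thesis unfolding R_def PA[OF x] P'A[OF Px(1)] by simp
  qed
  have step: "\<exists>l. approx_null M (insert (R c l) G)"
    if G: "\<And>B. B \<in> G \<Longrightarrow> bounded_op_on M B" "\<And>B x. B \<in> G \<Longrightarrow> x \<in> M \<Longrightarrow> B (A x) = A (B x)"
      "approx_null M G" for c G
  proof -
    have "B (P c x) = P c (B x)" if B: "B \<in> G" and x: "x \<in> M" for B x
      unfolding P_def
      by (rule commute_shift[where A = A and x = x, OF M G(1)[OF B]]) (use D(6) G(2)[OF B] x in auto)
    from approx_null_insert_modulus[OF M P G(1) this G(3)]
    show ?thesis unfolding R_def by blast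
  qed
  obtain l0 where l0: "approx_null M (insert (R 0 l0) F)" using step[OF F an] by blast
  have "\<exists>l1. approx_null M (insert (R 1 l1) (insert (R 0 l0) F))"
    by (rule step[OF _ _ l0]) (use F R_bd R_A in auto)
  then obtain l1 where l1: "approx_null M (insert (R 1 l1) (insert (R 0 l0) F))" ..
  have "\<exists>l2. approx_null M (insert (R \<i> l2) (insert (R 1 l1) (insert (R 0 l0) F)))"
    by (rule step[OF _ _ l1]) (use F R_bd R_A in auto)
  then obtain l2 where l2: "approx_null M (insert (R \<i> l2) (insert (R 1 l1) (insert (R 0 l0) F)))" ..
  \<comment> \<open>The value of \<open>w\<close> comes from \<open>2 A = (A + A\<^sup>*) + (A - A\<^sup>*)\<close>.\<close>
  define w where "w = - ((complex_of_real (l1 - l0) - 1) + \<i> * (complex_of_real (l2 - l0) - 1)) / 2"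
  have key: "2 *\<^sub>C (A x - w *\<^sub>C x) = (R 0 l0 x - R 1 l1 x) + \<i> *\<^sub>C (R 0 l0 x - R \<i> l2 x)" if "x \<in> M" for x
  proof -
    have two: "2 *\<^sub>C v = v + v" for v :: 'a using scaleC_add_left[of 1 1 v] by simp
    have "2 *\<^sub>C (A x - w *\<^sub>C x)
        = A x + A x + ((complex_of_real (l1 - l0) - 1) + \<i> * (complex_of_real (l2 - l0) - 1)) *\<^sub>C x"
    proof -
      have "2 * w = - ((complex_of_real (l1 - l0) - 1) + \<i> * (complex_of_real (l2 - l0) - 1))"
        by (simp add: w_def)
      then show ?thesis
        unfolding scaleC_diff_right scaleC_scaleC two by (simp only: scaleC_minus_left diff_minus_eq_add)
    qed
    then show ?thesis
      unfolding R_def PP[OF that]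
      by (simp add: scaleC_diff_right scaleC_diff_left scaleC_add_right scaleC_add_left scaleC_scaleC algebra_simps)
  qed
  have "approx_null M (insert (\<lambda>x. A x - w *\<^sub>C x) F)"
    unfolding approx_null_def
  proof (intro allI impI)
    fix e :: real assume e: "0 < e"
    then have "0 < e / 2" by simp
    then obtain x where x: "x \<in> M" "norm x = 1"
      "\<forall>B\<in>insert (R \<i> l2) (insert (R 1 l1) (insert (R 0 l0) F)). norm (B x) \<le> e / 2"
      using l2 unfolding approx_null_def by blast
    have "2 * norm (A x - w *\<^sub>C x) = norm ((R 0 l0 x - R 1 l1 x) + \<i> *\<^sub>C (R 0 l0 x - R \<i> l2 x))"
      unfolding key[OF x(1), symmetric] norm_scaleC by simp
    also have "\<dots> \<le> norm (R 0 l0 x - R 1 l1 x) + norm (R 0 l0 x - R \<i> l2 x)"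
      using norm_triangle_ineq by (metis (no_types, lifting) norm_scaleC norm_ii mult_1)
    also have "\<dots> \<le> (e/2 + e/2) + (e/2 + e/2)"
      using x(3) norm_triangle_ineq4[of "R 0 l0 x" "R 1 l1 x"] norm_triangle_ineq4[of "R 0 l0 x" "R \<i> l2 x"]
      by (intro add_mono) force+
    finally have "norm (A x - w *\<^sub>C x) \<le> e" by simp
    moreover have "norm (B x) \<le> e" if "B \<in> F" for B using x(3) that e by force
    ultimately show "\<exists>x\<in>M. norm x = 1 \<and> (\<forall>B\<in>insert (\<lambda>x. A x - w *\<^sub>C x) F. norm (B x) \<le> e)"
      using x by blast
  qed
  then show ?thesis ..
qed

text \<open>The eigenvalues are found one after the other; as \<open>A\<^sub>i\<close> commutes with the \<open>A\<^sub>j - w\<^sub>j\<close> that have been treated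
  before, the common approximate null vectors can be chosen to be approximate eigenvectors of \<open>A\<^sub>i\<close>, too.\<close>

lemma approx_null_joint:
  fixes M :: "'a::chilbert_space set"
  assumes M: "closed_csubspace M" and I: "finite I"
    and A: "\<And>i. i \<in> I \<Longrightarrow> normal_pair M (A i) (A' i)"
    and comm: "\<And>i j x. i \<in> I \<Longrightarrow> j \<in> I \<Longrightarrow> x \<in> M \<Longrightarrow> A i (A j x) = A j (A i x)"
    and F: "\<And>B. B \<in> F \<Longrightarrow> bounded_op_on M B" "\<And>B i x. B \<in> F \<Longrightarrow> i \<in> I \<Longrightarrow> x \<in> M \<Longrightarrow> B (A i x) = A i (B x)"
    and an: "approx_null M F"
  shows "\<exists>w. approx_null M (F \<union> (\<lambda>i x. A i x - w i *\<^sub>C x) ` I)"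
  using I A comm F(2)
proof (induction I)
  case empty
  then show ?case using an by simp
next
  case (insert i I)
  have "\<exists>w. approx_null M (F \<union> (\<lambda>i x. A i x - w i *\<^sub>C x) ` I)"
    by (rule insert.IH) (use insert.prems in auto)
  then obtain w where w: "approx_null M (F \<union> (\<lambda>i x. A i x - w i *\<^sub>C x) ` I)" ..
  have Ai: "normal_pair M (A i) (A' i)" using insert.prems by blast
  let ?G = "F \<union> (\<lambda>i x. A i x - w i *\<^sub>C x) ` I"
  have G1: "bounded_op_on M B" if "B \<in> ?G" for B
    using that F(1) normal_pairD(1)[OF normal_pair_shift[OF M insert.prems(1)]] by auto
  have G2: "B (A i x) = A i (B x)" if B: "B \<in> ?G" and x: "x \<in> M" for B x
    using B
  proof
    assume "B \<in> (\<lambda>i x. A i x - w i *\<^sub>C x) ` I"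
    then obtain j where j: "j \<in> I" "B = (\<lambda>x. A j x - w j *\<^sub>C x)" by blast
    have "A i (A j x - w j *\<^sub>C x) = A j (A i x) - w j *\<^sub>C A i x"
      by (rule commute_shift[OF M normal_pairD(1)[OF Ai]])
         (use j insert.prems(2) normal_pairD(6)[OF insert.prems(1)] x in auto)
    then show ?thesis using j by simp
  qed (use insert.prems(3) x in auto)
  obtain c where c: "approx_null M (insert (\<lambda>x. A i x - c *\<^sub>C x) ?G)"
    using approx_null_insert_normal[OF M Ai G1 G2 w] by blast
  have "F \<union> (\<lambda>j x. A j x - (w(i := c)) j *\<^sub>C x) ` insert i I \<subseteq> insert (\<lambda>x. A i x - c *\<^sub>C x) ?G"
    using insert.hyps by auto
  then show ?case using approx_null_subset[OF c] by blast
qed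

section \<open>Joint approximate eigenvalues belong to the Taylor spectrum\<close>

text \<open>A gliding hump: the sign of each summand \<open>3\<^sup>-\<^sup>k e\<^sub>k\<close> of \<open>y\<close> is chosen so that it does not cancel
  the product of the earlier summands with \<open>e\<^sub>k\<close>; the later ones are too short to do so.\<close>

lemma gliding_hump:
  fixes e :: "nat \<Rightarrow> 'a::chilbert_space"
  assumes M: "closed_csubspace M" and e: "\<And>k. e k \<in> M" "\<And>k. norm (e k) = 1"
  shows "\<exists>y\<in>M. \<forall>k. (1/3) ^ k / 2 \<le> cmod (cinner y (e k))"
proof -
  define Y where "Y = rec_nat 0 (\<lambda>k y. if (1/3) ^ k \<le> cmod (cinner (y + (1/3) ^ k *\<^sub>R e k) (e k))
    then y + (1/3) ^ k *\<^sub>R e k else y - (1/3) ^ k *\<^sub>R e k)"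
  have Y0: "Y 0 = 0" by (simp add: Y_def)
  have YS: "Y (Suc k) = (if (1/3) ^ k \<le> cmod (cinner (Y k + (1/3) ^ k *\<^sub>R e k) (e k))
    then Y k + (1/3) ^ k *\<^sub>R e k else Y k - (1/3) ^ k *\<^sub>R e k)" for k
    by (simp add: Y_def)
  have YM: "Y k \<in> M" for k
    by (induction k) (auto simp: Y0 YS e M intro!: csubspace_0 csubspace_add csubspace_diff csubspace_scaleR)
  have low: "(1/3) ^ k \<le> cmod (cinner (Y (Suc k)) (e k))" for k
  proof -
    have ee: "cinner ((1/3) ^ k *\<^sub>R e k) (e k) = complex_of_real ((1/3) ^ k)"
      by (simp add: cinner_scaleR_left cinner_self e scaleR_conv_of_real)
    have "2 * (1/3) ^ k = cmod (cinner (Y k + (1/3) ^ k *\<^sub>R e k) (e k) - cinner (Y k - (1/3) ^ k *\<^sub>R e k) (e k))"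
      by (simp add: cinner_add_left cinner_diff_left ee norm_mult norm_power flip: mult_2)
    also have "\<dots> \<le> cmod (cinner (Y k + (1/3) ^ k *\<^sub>R e k) (e k)) + cmod (cinner (Y k - (1/3) ^ k *\<^sub>R e k) (e k))"
      by (rule norm_triangle_ineq4)
    finally show ?thesis unfolding YS by auto
  qed
  define d where "d k = Y (Suc k) - Y k" for k
  have nd: "norm (d k) = (1/3) ^ k" for k using e(2) by (simp add: d_def YS)
  have sd: "summable (\<lambda>k. norm (d k))" unfolding nd by (rule summable_geometric) simp
  then have sd': "summable d" by (rule summable_norm_cancel)
  have "(\<Sum>j<k. d j) = Y k" for k unfolding d_def by (simp add: sum_lessThan_telescope Y0)
  then have lim: "Y \<longlonglongrightarrow> suminf d" using summable_LIMSEQ[OF sd'] by simp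
  define y where "y = suminf d"
  have yM: "y \<in> M" using csubspace_limit[OF M lim YM] by (simp add: y_def)
  have "(1/3) ^ k / 2 \<le> cmod (cinner y (e k))" for k
  proof -
    have "y - Y (Suc k) = suminf (\<lambda>j. d (j + Suc k))"
      using suminf_split_initial_segment[OF sd', of "Suc k"] \<open>\<And>k. (\<Sum>j<k. d j) = Y k\<close>[of "Suc k"]
      by (simp add: y_def)
    also have "norm \<dots> \<le> suminf (\<lambda>j. norm (d (j + Suc k)))"
      by (rule summable_norm) (use sd summable_ignore_initial_segment in blast)
    also have "\<dots> = suminf (\<lambda>j. (1/3) ^ j * (1/3) ^ Suc k :: real)" unfolding nd power_add ..
    also have "\<dots> = (1/3) ^ k / 2"
      using suminf_mult2[OF summable_geometric[of "1/3::real"], of "(1/3) ^ Suc k"]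
      by (simp add: suminf_geometric)
    finally have dist: "norm (y - Y (Suc k)) \<le> (1/3) ^ k / 2" .
    have "cmod (cinner (Y (Suc k) - y) (e k)) \<le> (1/3) ^ k / 2"
      using cauchy_schwarz[of "Y (Suc k) - y" "e k"] dist e(2)[of k] by (simp add: norm_minus_commute)
    moreover have "cmod (cinner (Y (Suc k)) (e k)) \<le> cmod (cinner (Y (Suc k) - y) (e k)) + cmod (cinner y (e k))"
      unfolding cinner_diff_left using norm_triangle_sub by (metis add.commute)
    ultimately show ?thesis using low[of k] by linarith
  qed
  then show ?thesis using yM by blast
qed

text \<open>In the top degree exactness would write every \<open>y\<close> as \<open>\<Sum>\<^sub>j A\<^sub>j u\<^sub>j\<close>. For unit vectors \<open>e\<^sub>k\<close> with
  \<open>\<parallel>A\<^sub>j\<^sup>* e\<^sub>k\<parallel> = \<parallel>A\<^sub>j e\<^sub>k\<parallel> \<le> 9\<^sup>-\<^sup>k\<close> the products of \<open>y\<close> with \<open>e\<^sub>k\<close> would then be of order \<open>9\<^sup>-\<^sup>k\<close>, which fails for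
  the vector of the gliding hump.\<close>

lemma approx_null_not_exact:
  fixes M :: "'a::chilbert_space set"
  assumes M: "closed_csubspace M" and A: "\<And>i. i \<in> {1..n} \<Longrightarrow> normal_pair M (A i) (A' i)"
    and an: "approx_null M (A ` {1..n})"
  shows "\<not> koszul_exact n M A"
proof
  assume ex: "koszul_exact n M A"
  have "\<exists>x\<in>M. norm x = 1 \<and> (\<forall>i\<in>{1..n}. norm (A i x) \<le> (1/9) ^ k)" for k :: nat
    using an[unfolded approx_null_def, rule_format, of "(1/9) ^ k"] by auto
  then obtain e where e: "\<And>k. e k \<in> M" "\<And>k. norm (e k) = 1"
    "\<And>k i. i \<in> {1..n} \<Longrightarrow> norm (A i (e k)) \<le> (1/9) ^ k" by metis
  obtain y where y: "y \<in> M" "\<And>k. (1/3) ^ k / 2 \<le> cmod (cinner y (e k))"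
    using gliding_hump[of M e, OF M e(1,2)] by blast
  obtain u where u: "\<And>j. j \<in> {1..n} \<Longrightarrow> u j \<in> M" "y = (\<Sum>j=1..n. A j (u j))"
    using koszul_exact_surj[OF M bounded_op_onD(1)[OF normal_pairD(1)[OF A]] ex y(1)] by blast
  define C where "C = (\<Sum>j=1..n. norm (u j))"
  have "cmod (cinner y (e k)) \<le> C * (1/9) ^ k" for k
  proof -
    have "cmod (cinner y (e k)) \<le> (\<Sum>j=1..n. cmod (cinner (A j (u j)) (e k)))"
      unfolding u(2) cinner_sum_left by (rule norm_sum)
    also have "\<dots> \<le> (\<Sum>j=1..n. norm (u j) * (1/9) ^ k)"
    proof (rule sum_mono)
      fix j assume j: "j \<in> {1..n}"
      have "cmod (cinner (A j (u j)) (e k)) \<le> norm (u j) * norm (A' j (e k))"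
        unfolding normal_pairD(3)[OF A[OF j] u(1)[OF j] e(1)] by (rule cauchy_schwarz)
      also have "\<dots> \<le> norm (u j) * (1/9) ^ k"
        unfolding normal_pair_norm[OF A[OF j] e(1)] by (intro mult_left_mono e(3) j) simp
      finally show "cmod (cinner (A j (u j)) (e k)) \<le> norm (u j) * (1/9) ^ k" .
    qed
    finally show ?thesis by (simp add: C_def sum_distrib_right)
  qed
  then have *: "(1/3) ^ k / 2 \<le> C * (1/9) ^ k" for k using y(2) order_trans by blast
  have "(3::real) ^ k \<le> 2 * C" for k
  proof -
    have "(1/9::real) ^ k = (1/3) ^ k * (1/3) ^ k" by (simp flip: power_mult_distrib)
    then have "(1/3) ^ k * (1 / 2) \<le> (1/3) ^ k * (C * (1/3) ^ k)" using *[of k] by (simp add: mult_ac)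
    then have "1 / 2 \<le> C * (1/3) ^ k" by (rule mult_left_le_imp_le) simp
    then show ?thesis by (simp add: power_divide field_simps)
  qed
  moreover obtain k where "2 * C < (3::real) ^ k" using real_arch_pow[of 3 "2 * C"] by auto
  ultimately show False using not_le by blast
qed

text \<open>If \<open>U\<^sub>n\<close> is not isometric, there are approximate eigenvectors of \<open>U\<^sub>n\<^sup>* U\<^sub>n - 1\<close> for a nonzero
  eigenvalue; they can be refined to joint approximate eigenvectors of \<open>U\<close>, whose eigenvalue \<open>w\<close>
  then has \<open>|w\<^sub>n| \<noteq> 1\<close>.\<close>

lemma Gamma_unitary_last_isometric:
  fixes K :: "'a::chilbert_space set"
  assumes n: "1 \<le> n" and K: "closed_csubspace K" and U: "Gamma_unitary_on n K U" and x0: "x0 \<in> K"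
  shows "norm (U n x0) = norm x0"
proof (rule ccontr)
  assume ne: "norm (U n x0) \<noteq> norm x0"
  have np: "normal_pair K (U i) (adjoint_on K (U i))" if "i \<in> {1..n}" for i
    using U that normal_on_pair[OF K] unfolding Gamma_unitary_on_def by blast
  have comm: "U i (U j x) = U j (U i x)" if "i \<in> {1..n}" "j \<in> {1..n}" "x \<in> K" for i j x
    using U that unfolding Gamma_unitary_on_def commuting_tuple_on_def by blast
  define A where "A = U n"
  define A' where "A' = adjoint_on K A"
  have nn: "n \<in> {1..n}" using n by simp
  have A: "normal_pair K A A'" unfolding A_def A'_def using np[OF nn] .
  note D = normal_pairD[OF A]
  note linA = bounded_op_onD(1)[OF D(1)] note linA' = bounded_op_onD(1)[OF D(2)]
  define R where "R x = A' (A x) - x" for x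
  have R_bd: "bounded_op_on K R"
    unfolding R_def by (rule bounded_op_on_diff[OF K bounded_op_on_comp[OF D(2,1)] bounded_op_on_id])
  note linR = bounded_op_onD(1)[OF R_bd] note RK = bounded_op_onD(2)[OF R_bd]
  have R: "normal_pair K R R"
    unfolding normal_pair_def using R_bd D by (auto simp: R_def cinner_diff_left cinner_diff_right)
  have AR: "R (A x) = A (R x)" if "x \<in> K" for x
    unfolding R_def clinear_on_diff[OF K linA D(7)[OF D(6)[OF that]] that] D(5)[OF D(6)[OF that]] ..
  have R0: "R x0 \<noteq> 0"
  proof
    assume "R x0 = 0"
    then have "cinner (A' (A x0)) x0 = cinner x0 x0" by (simp add: R_def)
    then have "cinner (A x0) (A x0) = cinner x0 x0" using D(4)[OF D(6)[OF x0] x0] by simp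
    then have "(norm (A x0))\<^sup>2 = (norm x0)\<^sup>2" unfolding cinner_self of_real_eq_iff .
    then show False using ne by (simp add: A_def power2_eq_iff_nonneg)
  qed
  then have "x0 \<noteq> 0" using clinear_on_0[OF K linR] by auto
  then have "inverse (norm x0) *\<^sub>R x0 \<in> K" "norm (inverse (norm x0) *\<^sub>R x0) = 1"
    using csubspace_scaleR[OF K x0] by auto
  then have an0: "approx_null K {}" unfolding approx_null_def by blast
  obtain l where l: "approx_null K {\<lambda>x. R (R x) - complex_of_real l *\<^sub>C x}"
    "\<forall>x\<in>K. (norm (R x))\<^sup>2 \<le> l * (norm x)\<^sup>2"
    using approx_null_insert_modulus[OF K R _ _ an0] by auto
  have "0 < (norm (R x0))\<^sup>2" using R0 by simp
  then have "0 < l * (norm x0)\<^sup>2" using l(2) x0 by (meson less_le_trans)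
  then have l0: "l > 0" by (simp add: zero_less_mult_iff)
  \<comment> \<open>If \<open>R2\<close> and \<open>A - w\<close> have common approximate null vectors, then \<open>(|w|\<^sup>2 - 1)\<^sup>2 = l \<noteq> 0\<close>.\<close>
  define R2 where "R2 x = R (R x) - complex_of_real l *\<^sub>C x" for x
  have R2_bd: "bounded_op_on K R2" unfolding R2_def
    by (rule bounded_op_on_diff[OF K bounded_op_on_comp[OF R_bd R_bd] bounded_op_on_scaleC[OF K bounded_op_on_id]])
  have R2_A: "R2 (A x) = A (R2 x)" if x: "x \<in> K" for x
    unfolding R2_def using AR[OF RK[OF x]] AR[OF x]
      clinear_on_diff[OF K linA RK[OF RK[OF x]] csubspace_scaleC[OF K x]] clinear_on_scaleC[OF K linA x] by simp
  obtain w where w: "approx_null K (insert (\<lambda>x. A x - w *\<^sub>C x) {R2})"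
    using approx_null_insert_normal[OF K A, of "{R2}"] R2_bd R2_A l(1) unfolding R2_def[abs_def] by auto
  have w1: "cmod w \<noteq> 1"
  proof
    assume w1: "cmod w = 1"
    obtain a where a: "a > 0" "\<And>x. x \<in> K \<Longrightarrow> norm (A' x) \<le> a * norm x"
      using bounded_op_on_bound[OF D(2)] by blast
    obtain r where r: "r > 0" "\<And>x. x \<in> K \<Longrightarrow> norm (R x) \<le> r * norm x"
      using bounded_op_on_bound[OF R_bd] by blast
    have bound: "l \<le> (r * (a + 1) + 1) * e" if e: "e > 0" for e
    proof -
      obtain x where x: "x \<in> K" "norm x = 1" "norm (A x - w *\<^sub>C x) \<le> e" "norm (R2 x) \<le> e"
        using w e unfolding approx_null_def by auto
      have Aw: "A x - w *\<^sub>C x \<in> K" using D(6)[OF x(1)] x(1) K by (intro csubspace_diff csubspace_scaleC)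
      have "norm (A' x - cnj w *\<^sub>C x) \<le> e"
        using normal_pair_norm[OF normal_pair_shift[OF K A, of w] x(1)] x(3) by simp
      moreover have "R x = A' (A x - w *\<^sub>C x) + w *\<^sub>C (A' x - cnj w *\<^sub>C x)"
        using w1 complex_norm_square[of w] clinear_on_diff[OF K linA' D(6)[OF x(1)] csubspace_scaleC[OF K x(1)]]
          clinear_on_scaleC[OF K linA' x(1)]
        by (simp add: R_def scaleC_diff_right scaleC_scaleC)
      ultimately have "norm (R x) \<le> a * e + e"
        using norm_triangle_ineq[of "A' (A x - w *\<^sub>C x)" "w *\<^sub>C (A' x - cnj w *\<^sub>C x)"]
          a(2)[OF Aw] mult_left_mono[OF x(3) less_imp_le[OF a(1)]] w1 by (simp add: norm_scaleC)
      then have "norm (R (R x)) \<le> r * (a * e + e)"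
        using r(2)[OF RK[OF x(1)]] r(1) by (meson less_imp_le mult_left_mono order_trans)
      moreover have "complex_of_real l *\<^sub>C x = R (R x) - R2 x" by (simp add: R2_def)
      then have "norm (complex_of_real l *\<^sub>C x) \<le> norm (R (R x)) + norm (R2 x)"
        by (metis norm_triangle_ineq4)
      ultimately show ?thesis using x(2,4) l0 by (simp add: norm_scaleC algebra_simps)
    qed
    define c where "c = r * (a + 1) + 1"
    have "c > 0" unfolding c_def using r(1) a(1) by (simp add: add_pos_pos)
    then show False using bound[of "l / (2 * c)"] l0 unfolding c_def[symmetric] by simp
  qed
  have np': "normal_pair K (U i) (adjoint_on K (U i))" if "i \<in> {1..<n}" for i using np that by simp
  have "approx_null K {\<lambda>x. A x - w *\<^sub>C x}" using approx_null_subset[OF w] by blast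
  moreover have "bounded_op_on K B" if "B \<in> {\<lambda>x. A x - w *\<^sub>C x}" for B
    using that normal_pairD(1)[OF normal_pair_shift[OF K A, of w]] by simp
  moreover have "B (U i x) = U i (B x)" if "B \<in> {\<lambda>x. A x - w *\<^sub>C x}" "i \<in> {1..<n}" "x \<in> K" for B i x
  proof -
    have i: "i \<in> {1..n}" using that(2) by simp
    have "U i (A x - w *\<^sub>C x) = A (U i x) - w *\<^sub>C U i x"
      by (rule commute_shift[OF K normal_pairD(1)[OF np[OF i]]])
         (use D(6) comm[OF i nn] that(3) in \<open>auto simp: A_def\<close>)
    then show ?thesis using that(1) by simp
  qed
  ultimately have "\<exists>v. approx_null K ({\<lambda>x. A x - w *\<^sub>C x} \<union> (\<lambda>i x. U i x - v i *\<^sub>C x) ` {1..<n})"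
    by (intro approx_null_joint[OF K _ np']) (use comm in auto)
  then obtain v where v: "approx_null K ({\<lambda>x. A x - w *\<^sub>C x} \<union> (\<lambda>i x. U i x - v i *\<^sub>C x) ` {1..<n})" ..
  define W where "W = (\<lambda>i\<in>{1..n}. if i = n then w else v i)"
  have "approx_null K ((\<lambda>i x. U i x - W i *\<^sub>C x) ` {1..n})"
    by (rule approx_null_subset[OF v]) (auto simp: W_def A_def)
  then have "\<not> koszul_exact n K (\<lambda>i x. U i x - W i *\<^sub>C x)"
    by (intro approx_null_not_exact[OF K, where A' = "\<lambda>i x. adjoint_on K (U i) x - cnj (W i) *\<^sub>C x"]
        normal_pair_shift[OF K] np)
  then have "W \<in> taylor_spectrum n K U" unfolding taylor_spectrum_def W_def by auto
  then have "W \<in> bGamma_set n" using U unfolding Gamma_unitary_on_def by blast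
  then obtain z where z: "z \<in> {1..n} \<rightarrow>\<^sub>E sphere 0 1" "W = sym_map n z" unfolding bGamma_set_def by blast
  have "cmod (z j) = 1" if "j \<in> {1..n}" for j using PiE_mem[OF z(1) that] by simp
  then have "cmod (W n) = 1" unfolding z(2) sym_map_elem_sym[OF nn] elem_sym_top prod_norm[symmetric] by (intro prod.neutral) auto
  then show False using w1 n by (simp add: W_def)
qed

section \<open>Points over the origin in the distinguished boundary\<close>

lemma elem_sym_perm:
  assumes f: "bij_betw f {1..n} {1..n}"
  shows "elem_sym n (\<lambda>j. z (f j)) k = elem_sym n z k"
proof -
  have inj: "inj_on f J" if "J \<subseteq> {1..n}" for J
    using f that by (auto simp: bij_betw_def intro: inj_on_subset)
  have "bij_betw ((`) f) {J. J \<subseteq> {1..n} \<and> card J = k} {J. J \<subseteq> {1..n} \<and> card J = k}"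
  proof (rule bij_betw_subset[OF bij_betw_Pow[OF f]])
    show "{J. J \<subseteq> {1..n} \<and> card J = k} \<subseteq> Pow {1..n}" by auto
    show "(`) f ` {J. J \<subseteq> {1..n} \<and> card J = k} = {J. J \<subseteq> {1..n} \<and> card J = k}"
    proof (intro subset_antisym subsetI)
      fix J assume "J \<in> (`) f ` {J. J \<subseteq> {1..n} \<and> card J = k}"
      then obtain I where I: "I \<subseteq> {1..n}" "card I = k" "J = f ` I" by blast
      then show "J \<in> {J. J \<subseteq> {1..n} \<and> card J = k}"
        using card_image[OF inj[OF I(1)]] bij_betw_imp_surj_on[OF f] by auto
    next
      fix J assume "J \<in> {J. J \<subseteq> {1..n} \<and> card J = k}"
      then have J: "J \<subseteq> {1..n}" "card J = k" by auto
      then have "J \<subseteq> f ` {1..n}" using bij_betw_imp_surj_on[OF f] by simp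
      then obtain I where I: "I \<subseteq> {1..n}" "J = f ` I" by (auto simp: subset_image_iff)
      then have "card I = k" using card_image[OF inj[OF I(1)]] J(2) by simp
      then show "J \<in> (`) f ` {J. J \<subseteq> {1..n} \<and> card J = k}" using I by blast
    qed
  qed
  then have "elem_sym n z k = (\<Sum>J | J \<subseteq> {1..n} \<and> card J = k. \<Prod>j\<in>f ` J. z j)"
    unfolding elem_sym_def by (rule sum.reindex_bij_betw[symmetric])
  also have "\<dots> = elem_sym n (\<lambda>j. z (f j)) k"
    unfolding elem_sym_def by (intro sum.cong refl) (simp add: prod.reindex[OF inj] o_def)
  finally show ?thesis by simp
qed

lemma elem_sym_mult: "elem_sym n (\<lambda>j. c * z j) k = c ^ k * elem_sym n z k"
  unfolding elem_sym_def sum_distrib_left by (intro sum.cong) (auto simp: prod.distrib)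

text \<open>The \<open>n\<close>-th roots of a number of modulus one: multiplication by a primitive root of unity \<open>w\<close> permutes
  them, so \<open>e\<^sub>k = w\<^sup>k e\<^sub>k\<close>, and hence \<open>e\<^sub>k = 0\<close> for \<open>0 < k < n\<close>.\<close>

lemma bGamma_set_axis:
  assumes n: "1 \<le> n" and u: "cmod u = 1"
  shows "(\<lambda>i\<in>{1..n}. if i = n then u else 0) \<in> bGamma_set n"
proof -
  define w where "w = exp (2 * of_real pi * \<i> / of_nat n)"
  have wk: "w ^ k = 1 \<longleftrightarrow> n dvd k" for k
  proof -
    have "w ^ k = exp (2 * of_real pi * \<i> * of_nat k / of_nat n)"
      unfolding w_def exp_of_nat_mult[symmetric] by (simp add: mult_ac)
    then show ?thesis using complex_root_unity_eq_1[OF n, of k] by simp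
  qed
  have w1: "cmod w = 1" by (simp add: w_def)
  define v where "v = u / (\<Prod>j=1..n. w ^ j)"
  have v1: "cmod v = 1" using u w1 by (simp add: v_def norm_divide norm_power flip: prod_norm)
  define c where "c = cis (Arg v / n)"
  have cn: "c ^ n = v"
    using n v1 rcis_cmod_Arg[of v] by (simp add: c_def Complex.DeMoivre rcis_def)
  define z where "z j = c * w ^ j" for j
  have z1: "cmod (z j) = 1" for j by (simp add: z_def norm_mult norm_power w1 c_def)
  have top: "elem_sym n z n = u"
  proof -
    have "elem_sym n z n = c ^ n * (\<Prod>j=1..n. w ^ j)"
      by (simp add: elem_sym_top z_def prod.distrib)
    moreover have "w \<noteq> 0" using w1 by auto
    ultimately show ?thesis by (simp add: cn v_def)
  qed
  have mid: "elem_sym n z k = 0" if k: "0 < k" "k < n" for k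
  proof -
    define f where "f j = (if j = n then 1 else Suc j)" for j
    have f: "bij_betw f {1..n} {1..n}"
      by (rule bij_betw_byWitness[where f' = "\<lambda>j. if j = 1 then n else j - 1"]) (use n in \<open>auto simp: f_def\<close>)
    have "z (f j) = w * z j" for j
      using wk[of n] by (auto simp: f_def z_def)
    then have "elem_sym n z k = w ^ k * elem_sym n z k"
      using elem_sym_perm[OF f, of z k] elem_sym_mult[of n w z k] by simp
    moreover have "w ^ k \<noteq> 1" using wk[of k] k by (auto dest: dvd_imp_le)
    ultimately show ?thesis by simp
  qed
  have "(\<lambda>i\<in>{1..n}. if i = n then u else 0) = sym_map n z"
  proof
    fix k show "(\<lambda>i\<in>{1..n}. if i = n then u else 0) k = sym_map n z k"
      using top mid[of k] sym_map_elem_sym[of k n z] by (cases "k \<in> {1..n}") (auto simp: sym_map_def)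
  qed
  also have "\<dots> = sym_map n (restrict z {1..n})" by (rule sym_map_cong) simp
  finally show ?thesis unfolding bGamma_set_def using z1 by (intro image_eqI) auto
qed

section \<open>Unitary extension of an isometry\<close>

text \<open>The factorizations \<open>W - w = (1 - w W\<^sup>-\<^sup>1) W = - w (1 - w\<^sup>-\<^sup>1 W)\<close> contain a small perturbation of the identity
  if \<open>|w| < 1\<close> or \<open>|w| > 1\<close>, respectively.\<close>

lemma unitary_shift_bij:
  fixes K :: "'a::chilbert_space set"
  assumes K: "closed_csubspace K" and W: "clinear_on K W" "\<And>x. x \<in> K \<Longrightarrow> W x \<in> K" "\<And>x. x \<in> K \<Longrightarrow> norm (W x) = norm x"
    and V: "clinear_on K V" "\<And>x. x \<in> K \<Longrightarrow> V x \<in> K" "\<And>x. x \<in> K \<Longrightarrow> W (V x) = x" "\<And>x. x \<in> K \<Longrightarrow> V (W x) = x"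
    and w: "cmod w \<noteq> 1"
  shows "bij_betw (\<lambda>x. W x - w *\<^sub>C x) K K"
proof -
  have lin: "clinear_on K (\<lambda>x. x - c *\<^sub>C A x)" if "clinear_on K A" for c A
    using that unfolding clinear_on_def by (auto simp: scaleC_add_right scaleC_diff_right scaleC_scaleC mult.commute)
  have bij: "bij_betw (\<lambda>x. x - c *\<^sub>C A x) K K"
    if "clinear_on K A" "\<And>x. x \<in> K \<Longrightarrow> A x \<in> K" "\<And>x. x \<in> K \<Longrightarrow> norm (A x) = norm x" "cmod c < 1" for c A
    by (rule near_identity_bij[where c = "cmod c", OF K lin[OF that(1)]])
       (use that K in \<open>auto simp: norm_scaleC intro!: csubspace_diff csubspace_scaleC\<close>)
  show ?thesis
  proof (cases "cmod w < 1")
    case True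
    have bW: "bij_betw W K K" by (rule bij_betw_byWitness[where f' = V]) (use W V in auto)
    have nV: "norm (V x) = norm x" if "x \<in> K" for x using W(3)[OF V(2)[OF that]] V(3)[OF that] by simp
    have "bij_betw ((\<lambda>x. x - w *\<^sub>C V x) \<circ> W) K K" by (rule bij_betw_trans[OF bW bij[OF V(1,2) nV True]])
    then show ?thesis by (rule bij_betw_cong[THEN iffD1, rotated]) (simp add: V(4))
  next
    case False
    then have w1: "1 < cmod w" using w by simp
    then have w0: "w \<noteq> 0" by auto
    have "cmod (inverse w) < 1" using w1 by (simp add: norm_inverse inverse_less_1_iff)
    from bij[OF W this] have b: "bij_betw (\<lambda>x. x - inverse w *\<^sub>C W x) K K" .
    have s: "bij_betw (\<lambda>x. (- w) *\<^sub>C x) K K"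
      by (rule bij_betw_byWitness[where f' = "\<lambda>x. (- inverse w) *\<^sub>C x"])
         (use w0 K in \<open>auto simp: scaleC_scaleC intro!: csubspace_minus csubspace_scaleC\<close>)
    have "bij_betw ((\<lambda>x. (- w) *\<^sub>C x) \<circ> (\<lambda>x. x - inverse w *\<^sub>C W x)) K K" by (rule bij_betw_trans[OF b s])
    then show ?thesis
      by (rule bij_betw_cong[THEN iffD1, rotated]) (use w0 in \<open>simp add: scaleC_diff_right scaleC_scaleC\<close>)
  qed
qed

lemma l2_eqI: "(\<And>k. l2_nth f k = l2_nth g k) \<Longrightarrow> f = g"
  by (metis ext l2_nth_inject)

lemmas l2_nth_simps = plus_l2.rep_eq minus_l2.rep_eq scaleC_l2.rep_eq zero_l2.rep_eq

lemma norm_l2_sq: "(norm f)\<^sup>2 = suminf (\<lambda>k. (norm (l2_nth f k))\<^sup>2)"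
  and l2_summable: "summable (\<lambda>k. (norm (l2_nth f k))\<^sup>2)"
proof -
  show s: "summable (\<lambda>k. (norm (l2_nth f k))\<^sup>2)" using l2_nth[of f] by simp
  show "(norm f)\<^sup>2 = suminf (\<lambda>k. (norm (l2_nth f k))\<^sup>2)"
    unfolding norm_l2.rep_eq by (simp add: suminf_nonneg s)
qed

lemma l2_nth_Abs: "summable (\<lambda>k. (norm (g k))\<^sup>2) \<Longrightarrow> l2_nth (Abs_l2 g) = g"
  by (rule Abs_l2_inverse) simp

lemma l2_nth_tendsto:
  assumes "X \<longlonglongrightarrow> f"
  shows "(\<lambda>m. l2_nth (X m) k) \<longlonglongrightarrow> l2_nth f k"
proof -
  have "(\<lambda>m. norm (X m - f)) \<longlonglongrightarrow> 0" using assms by (simp add: LIM_zero tendsto_norm_zero)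
  then have "(\<lambda>m. l2_nth (X m) k - l2_nth f k) \<longlonglongrightarrow> 0"
    by (rule Lim_null_comparison[rotated])
       (use l2_nth_norm_le[of "X m - f" k for m] in \<open>auto simp: minus_l2.rep_eq\<close>)
  then show ?thesis by (rule LIM_zero_cancel)
qed

lemma zero_normal: "normal_on (N :: 'a::chilbert_space set) (\<lambda>_. 0)" if "closed_csubspace N"
proof -
  have b: "bounded_op_on N (\<lambda>_. 0)"
    using csubspace_0[OF that] by (auto simp: bounded_op_on_def clinear_on_def intro!: exI[of _ 0])
  have "adjoint_on N (\<lambda>_. 0) y = 0" for y
    by (rule adjoint_on_unique[OF that csubspace_0[OF that]]) simp
  then show ?thesis unfolding normal_on_def using b by simp
qed

lemma nat_cases3: "R 0 \<Longrightarrow> R (Suc 0) \<Longrightarrow> (\<And>j. R (Suc (Suc j))) \<Longrightarrow> R k"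
proof (cases k)
  case (Suc j)
  then show "R (Suc 0) \<Longrightarrow> (\<And>j. R (Suc (Suc j))) \<Longrightarrow> R k" by (cases j) simp_all
qed simp

text \<open>The unitary extension of an isometry \<open>P\<close> of \<open>M\<close> acts on \<open>M \<oplus> E \<oplus> E \<oplus> \<dots>\<close>, where \<open>E\<close> is the
  orthogonal complement of the range of \<open>P\<close> in \<open>M\<close>, by \<open>(x, e\<^sub>1, e\<^sub>2, \<dots>) \<mapsto> (P x + e\<^sub>1, e\<^sub>2, e\<^sub>3, \<dots>)\<close>.\<close>

locale isometry_on_subspace =
  fixes M :: "'a::chilbert_space set" and P :: "'a \<Rightarrow> 'a"
  assumes M: "closed_csubspace M" and iso: "isometry_on M P"
begin

lemma bP: "bounded_op_on M P" and normP: "x \<in> M \<Longrightarrow> norm (P x) = norm x"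
  using iso by (auto simp: isometry_on_def)

lemmas linP = bounded_op_onD(1)[OF bP] and memP = bounded_op_onD(2)[OF bP]

definition Q :: "'a \<Rightarrow> 'a" where "Q = adjoint_on M P"

lemma bQ: "bounded_op_on M Q" unfolding Q_def by (rule bounded_op_on_adjoint[OF M bP])

lemmas linQ = bounded_op_onD(1)[OF bQ] and memQ = bounded_op_onD(2)[OF bQ]

lemma adj: "x \<in> M \<Longrightarrow> cinner (P x) y = cinner x (Q y)"
  unfolding Q_def by (rule cinner_adjoint_on[OF M bP])

lemma QP: "x \<in> M \<Longrightarrow> Q (P x) = x"
  by (rule cinner_ext_on[OF M])
     (auto simp: memQ memP adj[symmetric] norm_preserving_cinner[OF M linP normP])

definition E :: "'a set" where "E = {x\<in>M. Q x = 0}"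

lemma E_closed: "closed_csubspace E"
  unfolding closed_csubspace_def
proof (intro conjI)
  show "closed E" unfolding E_def
    by (rule continuous_closed_preimage_constant[OF bounded_op_on_continuous[OF M bQ] csubspace_closed[OF M]])
qed (auto simp: E_def clinear_on_0[OF M linQ] clinear_on_add[OF M linQ] clinear_on_scaleC[OF M linQ]
    intro: csubspace_0 csubspace_add csubspace_scaleC M)

lemma E_orth: "x \<in> M \<Longrightarrow> e \<in> E \<Longrightarrow> cinner (P x) e = 0"
  by (simp add: adj E_def)

lemma E_compl: "x \<in> M \<Longrightarrow> x - P (Q x) \<in> E"
  unfolding E_def by (auto simp: clinear_on_diff[OF M linQ] memP memQ QP intro: csubspace_diff M)

definition K :: "'a l2 set" where "K = {f. l2_nth f 0 \<in> M \<and> (\<forall>k. l2_nth f (Suc k) \<in> E)}"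

lemma EM: "e \<in> E \<Longrightarrow> e \<in> M" by (simp add: E_def)

lemma K_closed: "closed_csubspace K"
  unfolding closed_csubspace_def
proof (intro conjI)
  show "closed K"
    unfolding closed_sequential_limits
  proof (intro allI impI)
    fix X f assume "(\<forall>m. X m \<in> K) \<and> X \<longlonglongrightarrow> f"
    then have X: "\<And>m. X m \<in> K" "X \<longlonglongrightarrow> f" by auto
    show "f \<in> K" unfolding K_def
    proof (intro CollectI conjI allI)
      show "l2_nth f 0 \<in> M" by (rule csubspace_limit[OF M l2_nth_tendsto[OF X(2)]]) (use X(1) in \<open>simp add: K_def\<close>)
      fix k
      show "l2_nth f (Suc k) \<in> E"
        by (rule csubspace_limit[OF E_closed l2_nth_tendsto[OF X(2)]]) (use X(1) in \<open>simp add: K_def\<close>)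
    qed
  qed
qed (auto simp: K_def l2_nth_simps intro: csubspace_0 csubspace_add csubspace_scaleC M E_closed)

definition W :: "'a l2 \<Rightarrow> 'a l2" where
  "W f = Abs_l2 (\<lambda>k. case k of 0 \<Rightarrow> P (l2_nth f 0) + l2_nth f 1 | Suc j \<Rightarrow> l2_nth f (Suc (Suc j)))"

definition W_inv :: "'a l2 \<Rightarrow> 'a l2" where
  "W_inv f = Abs_l2 (\<lambda>k. case k of 0 \<Rightarrow> Q (l2_nth f 0) | Suc 0 \<Rightarrow> l2_nth f 0 - P (Q (l2_nth f 0))
     | Suc (Suc j) \<Rightarrow> l2_nth f (Suc j))"

definition embed :: "'a \<Rightarrow> 'a l2" where
  "embed x = Abs_l2 (\<lambda>k. case k of 0 \<Rightarrow> x | Suc j \<Rightarrow> 0)"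

lemma summable_shift2: "summable (\<lambda>k. f (Suc (Suc k))) \<longleftrightarrow> summable (f :: nat \<Rightarrow> real)"
  using summable_iff_shift[of f 2] by simp

lemma l2_nth_W: "l2_nth (W f) 0 = P (l2_nth f 0) + l2_nth f 1" "l2_nth (W f) (Suc k) = l2_nth f (Suc (Suc k))"
proof -
  have "summable (\<lambda>k. (norm (case Suc k of 0 \<Rightarrow> P (l2_nth f 0) + l2_nth f 1 | Suc j \<Rightarrow> l2_nth f (Suc (Suc j))))\<^sup>2)"
    using l2_summable[of f] summable_shift2[of "\<lambda>k. (norm (l2_nth f k))\<^sup>2"] by simp
  then have "summable (\<lambda>k. (norm (case k of 0 \<Rightarrow> P (l2_nth f 0) + l2_nth f 1 | Suc j \<Rightarrow> l2_nth f (Suc (Suc j))))\<^sup>2)"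
    by (subst (asm) summable_Suc_iff)
  then show "l2_nth (W f) 0 = P (l2_nth f 0) + l2_nth f 1" "l2_nth (W f) (Suc k) = l2_nth f (Suc (Suc k))"
    by (simp_all add: W_def l2_nth_Abs)
qed

lemma l2_nth_W_inv: "l2_nth (W_inv f) 0 = Q (l2_nth f 0)"
  "l2_nth (W_inv f) (Suc 0) = l2_nth f 0 - P (Q (l2_nth f 0))"
  "l2_nth (W_inv f) (Suc (Suc k)) = l2_nth f (Suc k)"
proof -
  let ?g = "\<lambda>k. case k of 0 \<Rightarrow> Q (l2_nth f 0) | Suc 0 \<Rightarrow> l2_nth f 0 - P (Q (l2_nth f 0)) | Suc (Suc j) \<Rightarrow> l2_nth f (Suc j)"
  have "summable (\<lambda>k. (norm (l2_nth f (Suc k)))\<^sup>2)"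
    using l2_summable[of f] by (subst summable_Suc_iff)
  then have "summable (\<lambda>k. (norm (?g (Suc (Suc k))))\<^sup>2)" by simp
  then have "summable (\<lambda>k. (norm (?g k))\<^sup>2)" using summable_shift2[of "\<lambda>k. (norm (?g k))\<^sup>2"] by blast
  then have "l2_nth (W_inv f) = ?g" unfolding W_inv_def by (rule l2_nth_Abs)
  then show "l2_nth (W_inv f) 0 = Q (l2_nth f 0)" "l2_nth (W_inv f) (Suc 0) = l2_nth f 0 - P (Q (l2_nth f 0))"
    "l2_nth (W_inv f) (Suc (Suc k)) = l2_nth f (Suc k)" by simp_all
qed

lemma l2_nth_embed: "l2_nth (embed x) 0 = x" "l2_nth (embed x) (Suc k) = 0"
proof -
  have "summable (\<lambda>k. (norm (case Suc k of 0 \<Rightarrow> x | Suc j \<Rightarrow> 0))\<^sup>2)" by simp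
  then have "summable (\<lambda>k. (norm (case k of 0 \<Rightarrow> x | Suc j \<Rightarrow> 0))\<^sup>2)" by (subst (asm) summable_Suc_iff)
  then show "l2_nth (embed x) 0 = x" "l2_nth (embed x) (Suc k) = 0" by (simp_all add: embed_def l2_nth_Abs)
qed

lemma KD: "f \<in> K \<Longrightarrow> l2_nth f 0 \<in> M" "f \<in> K \<Longrightarrow> l2_nth f (Suc k) \<in> E"
  by (auto simp: K_def)

lemma W_mem:
  assumes f: "f \<in> K"
  shows "W f \<in> K"
proof -
  have "P (l2_nth f 0) + l2_nth f (Suc 0) \<in> M"
    by (rule csubspace_add[OF M memP[OF KD(1)[OF f]] EM[OF KD(2)[OF f]]])
  then show ?thesis using KD(2)[OF f] by (simp add: K_def l2_nth_W)
qed

lemma W_inv_mem: "f \<in> K \<Longrightarrow> W_inv f \<in> K"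
  unfolding K_def mem_Collect_eq
proof (intro conjI allI)
  assume f: "l2_nth f 0 \<in> M \<and> (\<forall>k. l2_nth f (Suc k) \<in> E)"
  show "l2_nth (W_inv f) 0 \<in> M" using f by (simp add: l2_nth_W_inv memQ)
  show "l2_nth (W_inv f) (Suc k) \<in> E" for k
    using f E_compl by (cases k) (auto simp: l2_nth_W_inv)
qed

lemma W_W_inv: "W (W_inv f) = f"
proof (rule l2_eqI)
  show "l2_nth (W (W_inv f)) k = l2_nth f k" for k by (cases k) (simp_all add: l2_nth_W l2_nth_W_inv)
qed

lemma W_inv_W:
  assumes f: "f \<in> K"
  shows "W_inv (W f) = f"
proof (rule l2_eqI)
  note f0 = KD(1)[OF f] and f1 = KD(2)[OF f, of 0]
  have Q: "Q (P (l2_nth f 0) + l2_nth f (Suc 0)) = l2_nth f 0"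
    using f1 by (simp add: clinear_on_add[OF M linQ memP[OF f0] EM[OF f1]] QP[OF f0] E_def)
  show "l2_nth (W_inv (W f)) k = l2_nth f k" for k
    by (rule nat_cases3[of "\<lambda>k. l2_nth (W_inv (W f)) k = l2_nth f k"]) (simp_all add: l2_nth_W l2_nth_W_inv Q)
qed

lemma W_lin: "clinear_on K W"
  unfolding clinear_on_def
proof (intro conjI ballI allI)
  fix f g assume "f \<in> K" "g \<in> K"
  then have "l2_nth f 0 \<in> M" "l2_nth g 0 \<in> M" by (auto dest: KD)
  then show "W (f + g) = W f + W g"
    by (intro l2_eqI) (case_tac k; simp add: l2_nth_W l2_nth_simps clinear_on_add[OF M linP])
next
  fix c f assume "f \<in> K"
  then have "l2_nth f 0 \<in> M" by (auto dest: KD)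
  then show "W (c *\<^sub>C f) = c *\<^sub>C W f"
    by (intro l2_eqI) (case_tac k; simp add: l2_nth_W l2_nth_simps clinear_on_scaleC[OF M linP] scaleC_add_right)
qed

lemma W_norm:
  assumes f: "f \<in> K"
  shows "norm (W f) = norm f"
proof -
  note f0 = KD(1)[OF f] and f1 = KD(2)[OF f, of 0]
  let ?a = "\<lambda>k. (norm (l2_nth f k))\<^sup>2"
  have s: "summable ?a" by (rule l2_summable)
  then have s': "summable (\<lambda>k. ?a (Suc k))" by (subst summable_Suc_iff)
  have "(norm (W f))\<^sup>2 = suminf (\<lambda>k. (norm (l2_nth (W f) (Suc k)))\<^sup>2) + (norm (l2_nth (W f) 0))\<^sup>2"
    unfolding norm_l2_sq using suminf_split_head[OF l2_summable[of "W f"]] by simp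
  also have "\<dots> = suminf (\<lambda>k. ?a (Suc (Suc k))) + (norm (P (l2_nth f 0) + l2_nth f (Suc 0)))\<^sup>2"
    by (simp add: l2_nth_W)
  also have "(norm (P (l2_nth f 0) + l2_nth f (Suc 0)))\<^sup>2 = ?a 0 + ?a (Suc 0)"
    unfolding norm_add_sq E_orth[OF f0 f1] normP[OF f0] by simp
  also have "suminf (\<lambda>k. ?a (Suc (Suc k))) + (?a 0 + ?a (Suc 0)) = suminf ?a"
    using suminf_split_head[OF s] suminf_split_head[OF s'] by simp
  finally have "(norm (W f))\<^sup>2 = (norm f)\<^sup>2" unfolding norm_l2_sq[of f] .
  then show ?thesis by (simp add: power2_eq_iff_nonneg)
qed

lemma W_bounded: "bounded_op_on K W"
  by (rule bounded_op_onI[of _ _ 1]) (use W_mem W_lin W_norm in auto)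

lemma W_adjoint:
  assumes g: "g \<in> K"
  shows "adjoint_on K W g = W_inv g"
proof (rule adjoint_on_unique[OF K_closed W_inv_mem[OF g]])
  fix f assume f: "f \<in> K"
  show "cinner (W f) g = cinner f (W_inv g)"
    using norm_preserving_cinner[OF K_closed W_lin W_norm f W_inv_mem[OF g]] by (simp add: W_W_inv)
qed

lemma W_inv_lin: "clinear_on K W_inv"
proof -
  have "clinear_on K (adjoint_on K W)"
    by (rule bounded_op_onD(1)[OF bounded_op_on_adjoint[OF K_closed W_bounded]])
  then show ?thesis
    unfolding clinear_on_def using W_adjoint K_closed by (auto simp: csubspace_add csubspace_scaleC)
qed

lemma W_normal: "normal_on K W"
  unfolding normal_on_def using W_bounded by (auto simp: W_adjoint W_mem W_W_inv W_inv_W)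

text \<open>If \<open>w\<close> is not in \<open>{0} \<times> \<dots> \<times> {0} \<times> \<T>\<close>, then \<open>- w\<^sub>i\<close> for some \<open>i < n\<close> or \<open>W - w\<^sub>n\<close> is
  invertible, so the Koszul complex of \<open>(0, \<dots>, 0, W) - w\<close> is exact.\<close>

lemma Gamma_unitary_extension:
  assumes n: "1 \<le> n"
  shows "Gamma_unitary_on n K (\<lambda>i. if i = n then W else (\<lambda>_. 0))"
proof -
  define U where "U i = (if i = n then W else (\<lambda>_. 0))" for i :: nat
  have nU: "normal_on K (U i)" for i by (simp add: U_def W_normal zero_normal K_closed)
  have W0: "W 0 = 0" by (rule clinear_on_0[OF K_closed W_lin])
  have ct: "commuting_tuple_on n K U"
    unfolding commuting_tuple_on_def using nU by (auto simp: normal_on_def U_def W0)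
  interpret commuting_tuple n K U by unfold_locales (rule K_closed, rule ct)
  have "w \<in> bGamma_set n" if w: "w \<in> {1..n} \<rightarrow>\<^sub>E UNIV" and nex: "\<not> koszul_exact n K (\<lambda>i x. U i x - w i *\<^sub>C x)" for w
  proof (rule ccontr)
    assume nin: "w \<notin> bGamma_set n"
    define A where "A i x = U i x - w i *\<^sub>C x" for i x
    have kt: "koszul_tuple n K A" unfolding A_def[abs_def] by (rule koszul_tuple_shift)
    have "\<exists>i\<in>{1..n}. bij_betw (A i) K K"
    proof (cases "\<exists>i\<in>{1..<n}. w i \<noteq> 0")
      case True
      then obtain i where i: "i \<in> {1..<n}" "w i \<noteq> 0" by blast
      have "bij_betw (\<lambda>x. (- w i) *\<^sub>C x) K K"
        by (rule bij_betw_byWitness[where f' = "\<lambda>x. (- inverse (w i)) *\<^sub>C x"])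
           (use i K_closed in \<open>auto simp: scaleC_scaleC intro!: csubspace_minus csubspace_scaleC\<close>)
      moreover have "A i = (\<lambda>x. (- w i) *\<^sub>C x)" using i(1) by (auto simp: A_def U_def)
      ultimately show ?thesis using i(1) by (intro bexI[of _ i]) auto
    next
      case False
      have "cmod (w n) \<noteq> 1"
      proof
        assume "cmod (w n) = 1"
        moreover have "w = (\<lambda>i\<in>{1..n}. if i = n then w n else 0)"
          using w False by (intro ext) (force simp: PiE_iff extensional_def)
        ultimately show False using bGamma_set_axis[OF n, of "w n"] nin by simp
      qed
      then have "bij_betw (\<lambda>x. W x - w n *\<^sub>C x) K K"
        by (intro unitary_shift_bij[OF K_closed W_lin W_mem W_norm W_inv_lin W_inv_mem W_W_inv W_inv_W])
      moreover have "A n = (\<lambda>x. W x - w n *\<^sub>C x)" by (auto simp: A_def U_def)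
      ultimately show ?thesis using n by (intro bexI[of _ n]) auto
    qed
    then obtain i where i: "i \<in> {1..n}" "bij_betw (A i) K K" by blast
    have "(\<Sum>k=1..n. (if k = i then 1 else 0) *\<^sub>C A k x) = A i x" for x
    proof -
      have "(\<Sum>k=1..n. (if k = i then 1 else 0) *\<^sub>C A k x) = (\<Sum>k=1..n. if k = i then A k x else 0)"
        by (intro sum.cong) auto
      then show ?thesis using i(1) by simp
    qed
    then have "koszul_exact n K A"
      using koszul_tuple.koszul_exact_if_bij[OF kt, of "\<lambda>k. if k = i then 1 else 0"] i(2) by simp
    then show False using nex unfolding A_def by simp
  qed
  then have "taylor_spectrum n K U \<subseteq> bGamma_set n" unfolding taylor_spectrum_def by blast
  then show ?thesis using nU ct unfolding Gamma_unitary_on_def U_def[abs_def] by auto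
qed

lemma Gamma_isometry:
  assumes n: "1 \<le> n" and Tn: "T n = P" and T0: "\<And>i x. i \<in> {1..<n} \<Longrightarrow> x \<in> M \<Longrightarrow> T i x = 0"
  shows "Gamma_isometry_on n M T"
  unfolding Gamma_isometry_on_def
proof (intro conjI exI)
  show "\<forall>i\<in>{1..n}. bounded_op_on M (T i)"
  proof
    fix i assume "i \<in> {1..n}"
    then consider "i = n" | "i \<in> {1..<n}" by force
    then show "bounded_op_on M (T i)"
    proof cases
      case 2
      then show ?thesis
        using T0 M by (auto simp: bounded_op_on_def clinear_on_def csubspace_0 csubspace_add csubspace_scaleC intro!: exI[of _ 0])
    qed (simp add: Tn bP)
  qed
  show "closed_csubspace K" by (rule K_closed)
  show "Gamma_unitary_on n K (\<lambda>i. if i = n then W else (\<lambda>_. 0))" by (rule Gamma_unitary_extension[OF n])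
  show "clinear_on M embed"
    unfolding clinear_on_def
    by (intro conjI ballI allI l2_eqI) (case_tac k; simp add: l2_nth_embed l2_nth_simps)+
  show "\<forall>x\<in>M. norm (embed x) = norm x"
  proof
    fix x
    have "(norm (embed x))\<^sup>2 = (norm x)\<^sup>2"
      unfolding norm_l2_sq using suminf_split_head[OF l2_summable[of "embed x"]] by (simp add: l2_nth_embed)
    then show "norm (embed x) = norm x" by (simp add: power2_eq_iff_nonneg)
  qed
  show "embed ` M \<subseteq> K" using csubspace_0[OF E_closed] by (auto simp: K_def l2_nth_embed)
  show "\<forall>i\<in>{1..n}. \<forall>x\<in>M. (if i = n then W else (\<lambda>_. 0)) (embed x) = embed (T i x)"
  proof (intro ballI)
    fix i x assume i: "i \<in> {1..n}" and x: "x \<in> M"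
    have "W (embed x) = embed (P x)"
    proof (rule l2_eqI)
      show "l2_nth (W (embed x)) k = l2_nth (embed (P x)) k" for k
        by (cases k) (simp_all add: l2_nth_W l2_nth_embed)
    qed
    moreover have "embed 0 = 0"
    proof (rule l2_eqI)
      show "l2_nth (embed 0) k = l2_nth 0 k" for k by (cases k) (simp_all add: l2_nth_embed l2_nth_simps)
    qed
    ultimately show "(if i = n then W else (\<lambda>_. 0)) (embed x) = embed (T i x)" using i x T0[of i x] Tn by auto
  qed
qed

end

section \<open>Contractions and their isometric parts\<close>

lemma cadjoint:
  assumes "bounded_op_on UNIV A"
  shows cinner_cadjoint: "cinner (A x) y = cinner x (cadjoint A y)"
    and cinner_cadjoint': "cinner x (A y) = cinner (cadjoint A x) y"
    and cadjoint_cadjoint: "cadjoint (cadjoint A) = A"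
  using cinner_adjoint_on[OF csubspace_UNIV assms] cinner_adjoint_on'[OF csubspace_UNIV assms]
    adjoint_on_adjoint[OF csubspace_UNIV assms] by auto

lemma bounded_cadjoint: "bounded_op_on UNIV A \<Longrightarrow> bounded_op_on UNIV (cadjoint A)"
  using bounded_op_on_adjoint[OF csubspace_UNIV] .

lemma cinner_ext: "(\<And>z. cinner z x = cinner z (y::'a::chilbert_space)) \<Longrightarrow> x = y"
  using cinner_ext_on[OF csubspace_UNIV] by auto

lemma cadjoint_commute:
  assumes A: "bounded_op_on UNIV A" and B: "bounded_op_on UNIV B" and c: "\<And>x. A (B x) = B (A x)"
  shows "cadjoint A (cadjoint B x) = cadjoint B (cadjoint A x)"
  by (rule cinner_ext) (simp flip: cinner_cadjoint[OF A] cinner_cadjoint[OF B] add: c)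

lemma unitary_onI:
  assumes N: "closed_csubspace N" and A: "bounded_op_on N A"
    and B: "\<And>x. x \<in> N \<Longrightarrow> B x \<in> N" "\<And>x y. x \<in> N \<Longrightarrow> y \<in> N \<Longrightarrow> cinner (A x) y = cinner x (B y)"
    and inv: "\<And>x. x \<in> N \<Longrightarrow> A (B x) = x" "\<And>x. x \<in> N \<Longrightarrow> B (A x) = x"
  shows "unitary_on N A"
proof -
  have "adjoint_on N A y = B y" if "y \<in> N" for y
    using that B by (intro adjoint_on_unique[OF N]) auto
  then show ?thesis unfolding unitary_on_def using A inv bounded_op_onD(2)[OF A] by auto
qed

locale contraction =
  fixes P :: "'a::chilbert_space \<Rightarrow> 'a"
  assumes contr: "contraction_on UNIV P"
begin

abbreviation "P' \<equiv> cadjoint P"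

lemma bP: "bounded_op_on UNIV P" and normP: "norm (P x) \<le> norm x"
  using contr by (auto simp: contraction_on_def)

lemmas bP' = bounded_cadjoint[OF bP]
lemmas adj = cinner_cadjoint[OF bP] and adj' = cinner_cadjoint'[OF bP]
lemmas linP = bounded_op_onD(1)[OF bP] and linP' = bounded_op_onD(1)[OF bP']

lemma normP': "norm (P' y) \<le> norm y"
proof -
  have "complex_of_real ((norm (P' y))\<^sup>2) = cinner (P (P' y)) y" by (simp add: adj cinner_self)
  then have "(norm (P' y))\<^sup>2 = cmod (cinner (P (P' y)) y)" by (metis abs_of_nonneg norm_of_real zero_le_power2)
  also have "\<dots> \<le> norm (P (P' y)) * norm y" by (rule cauchy_schwarz)
  also have "\<dots> \<le> norm (P' y) * norm y" by (intro mult_right_mono normP) simp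
  finally have "norm (P' y) * norm (P' y) \<le> norm (P' y) * norm y" by (simp add: power2_eq_square)
  then show ?thesis by (cases "norm (P' y) = 0") (auto simp: mult_le_cancel_left)
qed

lemma contraction_cadjoint: "contraction P'"
  by unfold_locales (simp add: contraction_on_def bP' normP')

text \<open>This follows from expanding \<open>\<parallel>P\<^sup>* P x - x\<parallel>\<^sup>2\<close>, as \<open>P\<^sup>*\<close> is a contraction as well.\<close>

lemma isometric_vector:
  assumes "norm (P x) = norm x"
  shows "P' (P x) = x"
proof -
  have "cinner (P' (P x)) x = complex_of_real ((norm (P x))\<^sup>2)" by (simp flip: adj' add: cinner_self)
  then have "Re (cinner (P' (P x)) x) = (norm x)\<^sup>2" using assms by (metis Re_complex_of_real)
  then have "(norm (P' (P x) - x))\<^sup>2 = (norm (P' (P x)))\<^sup>2 - (norm x)\<^sup>2"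
    unfolding norm_diff_sq by simp
  also have "(norm (P' (P x)))\<^sup>2 \<le> (norm x)\<^sup>2" using normP'[of "P x"] assms by (intro power_mono) auto
  finally show ?thesis by simp
qed

text \<open>On such a subspace \<open>P\<^sup>*\<close> agrees with the inverse of the restriction of \<open>P\<close>. Hence no restriction of a
  completely non-unitary contraction to a closed invariant subspace has a unitary part.\<close>

lemma unitary_part_reducing:
  assumes N: "closed_csubspace N" and u: "unitary_on N P"
  shows "reducing_on UNIV P N" "x \<in> N \<Longrightarrow> P (P' x) = x" "x \<in> N \<Longrightarrow> P' (P x) = x"
proof -
  have b: "bounded_op_on N P" using u by (simp add: unitary_on_def)
  have u': "adjoint_on N P (P x) = x" "P (adjoint_on N P x) = x" if "x \<in> N" for x
    using u that by (auto simp: unitary_on_def)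
  have PP: "P' (P x) = x" if x: "x \<in> N" for x
  proof (rule isometric_vector)
    have "cinner (P x) (P x) = cinner x x"
      using cinner_adjoint_on[OF N b x, of "P x"] u'(1)[OF x] by simp
    then have "(norm (P x))\<^sup>2 = (norm x)\<^sup>2" unfolding cinner_self of_real_eq_iff .
    then show "norm (P x) = norm x" by (simp add: power2_eq_iff_nonneg)
  qed
  then show "x \<in> N \<Longrightarrow> P' (P x) = x" .
  have P': "P' x = adjoint_on N P x" if x: "x \<in> N" for x
    using PP[OF adjoint_on_mem[OF N b], of x] u'(2)[OF x] by simp
  then show "x \<in> N \<Longrightarrow> P (P' x) = x" using u' by simp
  show "reducing_on UNIV P N"
    unfolding reducing_on_def using N P' adjoint_on_mem[OF N b] bounded_op_onD(2)[OF b] by auto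
qed

definition isometric_part :: "'a set" where
  "isometric_part = {x. \<forall>k. norm ((P ^^ k) x) = norm x}"

lemma isometric_partD: "x \<in> isometric_part \<Longrightarrow> norm ((P ^^ k) x) = norm x"
  by (simp add: isometric_part_def)

lemma isometric_part_P: "x \<in> isometric_part \<Longrightarrow> P x \<in> isometric_part"
  unfolding isometric_part_def
proof (intro CollectI allI)
  fix k assume "x \<in> {x. \<forall>k. norm ((P ^^ k) x) = norm x}"
  then have "norm ((P ^^ Suc k) x) = norm x" "norm ((P ^^ 1) x) = norm x" by blast+
  then show "norm ((P ^^ k) (P x)) = norm (P x)" by (simp add: funpow_swap1)
qed

lemma isometric_part_norm: "x \<in> isometric_part \<Longrightarrow> norm (P x) = norm x"
  using isometric_partD[of x 1] by simp

lemma isometric_part_funpow: "x \<in> isometric_part \<Longrightarrow> (P ^^ k) x \<in> isometric_part"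
  by (induction k) (auto intro: isometric_part_P)

lemma isometric_part_P'P: "x \<in> isometric_part \<Longrightarrow> P' (P x) = x"
  by (rule isometric_vector) (rule isometric_part_norm)

lemma isometric_part_P'P_funpow: "x \<in> isometric_part \<Longrightarrow> (P' ^^ k) ((P ^^ k) x) = x"
  by (induction k) (auto simp: funpow_swap1[of P'] isometric_part_P'P isometric_part_funpow)

lemma cinner_funpow: "cinner ((P ^^ k) x) y = cinner x ((P' ^^ k) y)"
  by (induction k arbitrary: y) (simp_all add: adj funpow_swap1[of P'])

lemma mem_isometric_part_iff: "x \<in> isometric_part \<longleftrightarrow> (\<forall>k. (P' ^^ k) ((P ^^ k) x) = x)"
proof
  assume *: "\<forall>k. (P' ^^ k) ((P ^^ k) x) = x"
  have "norm ((P ^^ k) x) = norm x" for k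
  proof -
    have "cinner ((P ^^ k) x) ((P ^^ k) x) = cinner x x" unfolding cinner_funpow using * by simp
    then have "(norm ((P ^^ k) x))\<^sup>2 = (norm x)\<^sup>2" unfolding cinner_self of_real_eq_iff .
    then show ?thesis by (simp add: power2_eq_iff_nonneg)
  qed
  then show "x \<in> isometric_part" by (simp add: isometric_part_def)
qed (simp add: isometric_part_P'P_funpow)

lemma isometric_part_closed: "closed_csubspace isometric_part"
proof -
  have eq: "isometric_part = (\<Inter>k. {x. (P' ^^ k) ((P ^^ k) x) = x})" by (auto simp: mem_isometric_part_iff)
  have "closed_csubspace {x. (P' ^^ k) ((P ^^ k) x) = x}" for k
    by (rule closed_equalizer[OF bounded_op_on_comp[OF bounded_op_on_funpow[OF bP'] bounded_op_on_funpow[OF bP]]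
          bounded_op_on_id])
  then show ?thesis unfolding eq by (rule closed_csubspace_Inter)
qed

text \<open>The isometric part is defined by equations in \<open>P\<close> and \<open>P\<^sup>*\<close> alone.\<close>

lemma isometric_part_commuting:
  assumes c: "\<And>x. A (P x) = P (A x)" "\<And>x. A (P' x) = P' (A x)" and x: "x \<in> isometric_part"
  shows "A x \<in> isometric_part"
  unfolding mem_isometric_part_iff
proof
  fix k
  have "(P ^^ k) (A y) = A ((P ^^ k) y)" "(P' ^^ k) (A y) = A ((P' ^^ k) y)" for y
    by (induction k) (auto simp: c)
  then show "(P' ^^ k) ((P ^^ k) (A x)) = A x" using isometric_part_P'P_funpow[OF x] by simp
qed

lemma isometric_part_greatest:
  assumes "P ` N \<subseteq> N" "\<And>x. x \<in> N \<Longrightarrow> norm (P x) = norm x"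
  shows "N \<subseteq> isometric_part"
proof
  fix x assume "x \<in> N"
  then have "(P ^^ k) x \<in> N \<and> norm ((P ^^ k) x) = norm x" for k
    by (induction k) (use assms in auto)
  then show "x \<in> isometric_part" by (simp add: isometric_part_def)
qed

lemma bounded_P_isometric_part: "bounded_op_on isometric_part P"
  using bP by (rule bounded_op_on_subspace) (auto intro: isometric_part_P)

lemma lim_norm_le:
  "lim (\<lambda>k. norm ((P ^^ k) x)) \<le> norm ((P ^^ k) x)"
proof -
  have dec: "decseq (\<lambda>k. norm ((P ^^ k) x))" by (rule decseq_SucI) (simp add: normP)
  then obtain l where l: "(\<lambda>k. norm ((P ^^ k) x)) \<longlonglongrightarrow> l"
    by (rule decseq_convergent[where B = 0]) auto
  show "lim (\<lambda>k. norm ((P ^^ k) x)) \<le> norm ((P ^^ k) x)"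
    using decseq_ge[OF dec l] limI[OF l] by simp
qed

lemma lim_norm_less_iff: "lim (\<lambda>k. norm ((P ^^ k) x)) < norm x \<longleftrightarrow> x \<notin> isometric_part"
proof
  assume "x \<notin> isometric_part"
  then obtain k where k: "norm ((P ^^ k) x) \<noteq> norm x" by (auto simp: isometric_part_def)
  have "norm ((P ^^ k) x) \<le> norm x" by (induction k) (use normP order_trans in auto)
  then show "lim (\<lambda>k. norm ((P ^^ k) x)) < norm x" using k lim_norm_le[of x k] by linarith
next
  assume less: "lim (\<lambda>k. norm ((P ^^ k) x)) < norm x"
  show "x \<notin> isometric_part"
  proof
    assume "x \<in> isometric_part"
    then have "(\<lambda>k. norm ((P ^^ k) x)) = (\<lambda>_. norm x)" by (auto simp: isometric_partD)
    then show False using less by simp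
  qed
qed

end

locale cnu_contraction = contraction +
  assumes cnu: "cnu_contraction_on UNIV P"
begin

lemma unitary_part_trivial:
  assumes "closed_csubspace N" "unitary_on N P"
  shows "N = {0}"
  using cnu unitary_part_reducing(1)[OF assms] assms(2) unfolding cnu_contraction_on_def by blast

lemma unitary_part_trivial_adjoint:
  assumes N: "closed_csubspace N" and u: "unitary_on N P'"
  shows "N = {0}"
proof -
  interpret ad: contraction P' by (rule contraction_cadjoint)
  note U = ad.unitary_part_reducing[OF N u, unfolded cadjoint_cadjoint[OF bP]]
  have N': "P ` N \<subseteq> N" "P' ` N \<subseteq> N"
    using U(1) unfolding reducing_on_def cadjoint_cadjoint[OF bP] by auto
  have "unitary_on N P"
    using U(2,3) N' adj by (intro unitary_onI[OF N bounded_op_on_subspace[OF bP], where B = P']) auto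
  then show ?thesis by (rule unitary_part_trivial[OF N])
qed

lemma cnu_restrict:
  assumes "bounded_op_on M P"
  shows "cnu_contraction_on M P"
  unfolding cnu_contraction_on_def contraction_on_def reducing_on_def
  using assms normP unitary_part_trivial by auto

lemma cnu_restrict_adjoint:
  assumes "bounded_op_on M P'"
  shows "cnu_contraction_on M P'"
  unfolding cnu_contraction_on_def contraction_on_def reducing_on_def
  using assms normP' unitary_part_trivial_adjoint by auto

text \<open>Every admissible subspace is contained in the isometric part, which is itself admissible. So maximality
  determines the subspace.\<close>

lemma maximal_cnu_isometry_subspace_iff: "maximal_cnu_isometry_subspace P M \<longleftrightarrow> M = isometric_part"
proof -
  let ?Q = "\<lambda>M. P ` M \<subseteq> M \<and> isometry_on M P \<and> cnu_contraction_on M P"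
  have Q: "?Q isometric_part"
    using bounded_P_isometric_part isometric_part_norm isometric_part_P cnu_restrict
    by (auto simp: isometry_on_def)
  have le: "N \<subseteq> isometric_part" if "?Q N" for N
    using that by (intro isometric_part_greatest) (auto simp: isometry_on_def)
  show ?thesis
    unfolding maximal_cnu_isometry_subspace_def maximal_subspace_def
    using Q le isometric_part_closed by (metis subset_antisym)
qed

text \<open>The intersection \<open>N\<close> of the ranges \<open>P\<^sup>k M\<close>, where \<open>M\<close> is the isometric part, is the unitary part in the
  Wold decomposition of \<open>P|\<^sub>M\<close>, which is trivial for a completely non-unitary \<open>P\<close>. The description of \<open>P\<^sup>k M\<close> as
  the set of all \<open>y\<close> with \<open>P\<^sup>*\<^sup>k y \<in> M\<close> and \<open>P\<^sup>k P\<^sup>*\<^sup>k y = y\<close> shows that \<open>N\<close> is closed.\<close>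

lemma isometric_part_pure:
  assumes y: "\<And>k. \<exists>v\<in>isometric_part. y = (P ^^ k) v"
  shows "y = 0"
proof -
  define N where "N = (\<Inter>k. {y. (P' ^^ k) y \<in> isometric_part \<and> (P ^^ k) ((P' ^^ k) y) = y})"
  have pre: "closed_csubspace {y. A y \<in> isometric_part}" if A: "bounded_op_on UNIV A" for A
    unfolding closed_csubspace_def
  proof (intro conjI)
    show "closed {y. A y \<in> isometric_part}"
      using continuous_closed_vimage[OF csubspace_closed[OF isometric_part_closed], of A]
        bounded_op_on_continuous[OF csubspace_UNIV A]
      by (simp add: vimage_def continuous_on_eq_continuous_within)
  qed (auto simp: bop_0[OF csubspace_UNIV A]
      bop_add[OF csubspace_UNIV A]
      bop_scaleC[OF csubspace_UNIV A]
      intro: csubspace_0 csubspace_add csubspace_scaleC isometric_part_closed)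
  have "closed_csubspace {y. (P' ^^ k) y \<in> isometric_part \<and> (P ^^ k) ((P' ^^ k) y) = y}" for k
  proof -
    have 1: "closed_csubspace {y. (P' ^^ k) y \<in> isometric_part}"
      by (rule pre[OF bounded_op_on_funpow[OF bP']])
    have 2: "closed_csubspace {y. (P ^^ k) ((P' ^^ k) y) = y}"
      by (rule closed_equalizer[OF bounded_op_on_comp[OF bounded_op_on_funpow[OF bP] bounded_op_on_funpow[OF bP']]
          bounded_op_on_id])
    show ?thesis using 1 2 unfolding closed_csubspace_def Collect_conj_eq by (auto intro: closed_Int)
  qed
  then have N: "closed_csubspace N" unfolding N_def by (rule closed_csubspace_Inter)
  have ND: "(P' ^^ k) y \<in> isometric_part" "(P ^^ k) ((P' ^^ k) y) = y" if "y \<in> N" for y k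
    using that by (auto simp: N_def)
  have N0: "y \<in> isometric_part" if "y \<in> N" for y using ND(1)[OF that, of 0] by simp
  have NP: "P y \<in> N" if y: "y \<in> N" for y
    unfolding N_def
  proof (intro INT_I CollectI)
    fix k
    show "(P' ^^ k) (P y) \<in> isometric_part \<and> (P ^^ k) ((P' ^^ k) (P y)) = P y"
    proof (cases k)
      case 0
      then show ?thesis using isometric_part_P[OF N0[OF y]] by simp
    next
      case (Suc j)
      have "(P' ^^ k) (P y) = (P' ^^ j) y"
        unfolding Suc using isometric_part_P'P[OF N0[OF y]] by (simp add: funpow_swap1)
      then show ?thesis using ND[OF y, of j] Suc by simp
    qed
  qed
  have NP': "P' y \<in> N" if y: "y \<in> N" for y
    unfolding N_def
  proof (intro INT_I CollectI conjI)
    fix k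
    let ?v = "(P' ^^ Suc k) y"
    have e: "(P' ^^ k) (P' y) = ?v" by (simp add: funpow_swap1)
    show "(P' ^^ k) (P' y) \<in> isometric_part" unfolding e by (rule ND(1)[OF y])
    have "P ((P ^^ k) ?v) = y" using ND(2)[OF y, of "Suc k"] by simp
    then have "P' y = (P ^^ k) ?v"
      using isometric_part_P'P[OF isometric_part_funpow[OF ND(1)[OF y]], of k "Suc k"] by simp
    then show "(P ^^ k) ((P' ^^ k) (P' y)) = P' y" unfolding e by simp
  qed
  have "unitary_on N P"
  proof (rule unitary_onI[OF N bounded_op_on_subspace[OF bP], where B = P'])
    fix x assume x: "x \<in> N"
    show "P (P' x) = x" using ND(2)[OF x, of 1] by simp
    show "P' (P x) = x" by (rule isometric_part_P'P[OF N0[OF x]])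
  qed (use NP NP' adj in auto)
  then have "N = {0}" by (rule unitary_part_trivial[OF N])
  moreover have "y \<in> N" unfolding N_def
  proof (intro INT_I CollectI)
    fix k
    obtain v where v: "v \<in> isometric_part" "y = (P ^^ k) v" using y by blast
    then show "(P' ^^ k) y \<in> isometric_part \<and> (P ^^ k) ((P' ^^ k) y) = y"
      using isometric_part_P'P_funpow[OF v(1), of k] by simp
  qed
  ultimately show ?thesis by blast
qed

end

section \<open>A test polynomial\<close>

text \<open>On the torus the complex conjugate of a product is its reciprocal.\<close>

lemma elem_sym_torus:
  assumes z: "\<And>j. j \<in> {1..n} \<Longrightarrow> cmod (z j) = 1" and i: "i \<le> n"
  shows "cnj (elem_sym n z i) * elem_sym n z n = elem_sym n z (n - i)"
proof -
  have "cnj (elem_sym n z i) * elem_sym n z n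
      = (\<Sum>J | J \<subseteq> {1..n} \<and> card J = i. \<Prod>j\<in>{1..n} - J. z j)"
    unfolding elem_sym_top unfolding elem_sym_def cnj_sum cnj_prod sum_distrib_right
  proof (intro sum.cong refl)
    fix J assume "J \<in> {J. J \<subseteq> {1..n} \<and> card J = i}"
    then have J: "J \<subseteq> {1..n}" by simp
    have "(\<Prod>j\<in>J. cnj (z j)) * (\<Prod>j\<in>J. z j) = (\<Prod>j\<in>J. 1)"
      unfolding prod.distrib[symmetric]
    proof (rule prod.cong[OF refl])
      fix j assume "j \<in> J"
      then show "cnj (z j) * z j = 1"
        using z[of j] J complex_norm_square[of "z j"] by (auto simp: mult.commute)
    qed
    moreover have "(\<Prod>j=1..n. z j) = (\<Prod>j\<in>{1..n} - J. z j) * (\<Prod>j\<in>J. z j)"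
      by (rule prod.subset_diff[OF J]) simp
    ultimately show "(\<Prod>j\<in>J. cnj (z j)) * (\<Prod>j=1..n. z j) = (\<Prod>j\<in>{1..n} - J. z j)"
      by (simp add: mult_ac)
  qed
  also have "\<dots> = elem_sym n z (n - i)"
    unfolding elem_sym_def
  proof (rule sum.reindex_bij_witness[of _ "\<lambda>J. {1..n} - J" "\<lambda>J. {1..n} - J"])
    fix J assume "J \<in> {J. J \<subseteq> {1..n} \<and> card J = i}"
    then have J: "J \<subseteq> {1..n}" "card J = i" by auto
    show "{1..n} - ({1..n} - J) = J" using J(1) by auto
    show "{1..n} - J \<in> {J. J \<subseteq> {1..n} \<and> card J = n - i}"
      using card_Diff_subset[OF finite_subset[OF J(1) finite_atLeastAtMost] J(1)] J(2) by auto
  next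
    fix J assume "J \<in> {J. J \<subseteq> {1..n} \<and> card J = n - i}"
    then have J: "J \<subseteq> {1..n}" "card J = n - i" by auto
    show "{1..n} - ({1..n} - J) = J" using J(1) by auto
    show "{1..n} - J \<in> {J. J \<subseteq> {1..n} \<and> card J = i}"
      using card_Diff_subset[OF finite_subset[OF J(1) finite_atLeastAtMost] J(1)] J(2) i by auto
  qed auto
  finally show ?thesis .
qed

lemma elem_sym_bound:
  assumes z: "\<And>j. j \<in> {1..n} \<Longrightarrow> cmod (z j) \<le> 1"
  shows "cmod (elem_sym n z i) \<le> real (card {J. J \<subseteq> {1..n} \<and> card J = i})"
proof -
  have "cmod (elem_sym n z i) \<le> (\<Sum>J | J \<subseteq> {1..n} \<and> card J = i. cmod (\<Prod>j\<in>J. z j))"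
    unfolding elem_sym_def by (rule norm_sum)
  also have "\<dots> \<le> (\<Sum>J | J \<subseteq> {1..n} \<and> card J = i. 1)"
    by (intro sum_mono) (use z in \<open>auto simp flip: prod_norm intro!: prod_le_1\<close>)
  finally show ?thesis by simp
qed

text \<open>The maximum modulus principle, applied in one coordinate after the other.\<close>

lemma polydisc_max_torus:
  fixes g :: "(nat \<Rightarrow> complex) \<Rightarrow> complex"
  assumes hol: "\<And>z j. (\<lambda>t. g (z(j := t))) holomorphic_on UNIV"
    and torus: "\<And>z. (\<And>j. j \<in> {1..n} \<Longrightarrow> cmod (z j) = 1) \<Longrightarrow> cmod (g z) \<le> B"
    and z: "\<And>j. j \<in> {1..n} \<Longrightarrow> cmod (z j) \<le> 1"
  shows "cmod (g z) \<le> B"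
proof -
  have "m \<le> n \<Longrightarrow> (\<And>j. j \<in> {1..m} \<Longrightarrow> cmod (z j) \<le> 1) \<Longrightarrow> (\<And>j. j \<in> {m<..n} \<Longrightarrow> cmod (z j) = 1)
    \<Longrightarrow> cmod (g z) \<le> B" for m z
  proof (induction m arbitrary: z)
    case 0
    then show ?case by (intro torus) auto
  next
    case (Suc m)
    have "cmod (g (z(Suc m := z (Suc m)))) \<le> B"
    proof (rule maximum_modulus_frontier[where f = "\<lambda>t. g (z(Suc m := t))" and S = "cball 0 1"])
      show "(\<lambda>t. g (z(Suc m := t))) holomorphic_on interior (cball 0 1)"
        using hol holomorphic_on_subset by blast
      show "continuous_on (closure (cball 0 1)) (\<lambda>t. g (z(Suc m := t)))"
        using hol holomorphic_on_imp_continuous_on continuous_on_subset by blast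
      show "z (Suc m) \<in> cball 0 1" using Suc.prems(2)[of "Suc m"] by simp
      fix t :: complex assume "t \<in> frontier (cball 0 1)"
      then have "cmod t = 1" by simp
      then show "cmod (g (z(Suc m := t))) \<le> B" using Suc.prems by (intro Suc.IH) auto
    qed simp
    then show ?case by simp
  qed
  from this[of n z] show ?thesis using z by simp
qed

lemma elem_sym_holomorphic: "(\<lambda>t. elem_sym n (z(j := t)) k) holomorphic_on UNIV"
proof -
  have "(\<lambda>t. (z(j := t)) l) holomorphic_on UNIV" for l
    by (cases "l = j") (simp_all add: holomorphic_intros)
  then show ?thesis unfolding elem_sym_def by (intro holomorphic_on_sum holomorphic_on_prod)
qed

text \<open>On the torus the test function is \<open>s\<^sub>n (1 + 2 \<i> t Im (e s\<^sub>i))\<close>: its modulus differs from \<open>1\<close> only in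
  second order in \<open>t\<close>.\<close>

lemma test_function_bound:
  assumes s: "s \<in> Gamma_set n" and i: "i \<in> {1..<n}" and e: "cmod e = 1"
  defines "C \<equiv> real (card {J. J \<subseteq> {1..n} \<and> card J = i})"
  shows "cmod (s n + complex_of_real t * (e * s i * s n - cnj e * s (n - i))) \<le> sqrt (1 + 4 * t\<^sup>2 * C\<^sup>2)"
proof -
  obtain z where z: "\<And>j. j \<in> {1..n} \<Longrightarrow> cmod (z j) \<le> 1" "s = sym_map n z"
    using Gamma_setE[OF s] by blast
  have ni: "i \<in> {1..n}" "n \<in> {1..n}" "n - i \<in> {1..n}" using i by auto
  define g where "g z = elem_sym n z n + complex_of_real t *
    (e * elem_sym n z i * elem_sym n z n - cnj e * elem_sym n z (n - i))" for z
  have "cmod (g z) \<le> sqrt (1 + 4 * t\<^sup>2 * C\<^sup>2)"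
  proof (rule polydisc_max_torus[of g n])
    show "(\<lambda>t. g (z(j := t))) holomorphic_on UNIV" for z j
      unfolding g_def by (intro holomorphic_intros elem_sym_holomorphic)
    show "cmod (g z) \<le> sqrt (1 + 4 * t\<^sup>2 * C\<^sup>2)" if z1: "\<And>j. j \<in> {1..n} \<Longrightarrow> cmod (z j) = 1" for z
    proof -
      define a where "a = e * elem_sym n z i"
      have u: "cmod (elem_sym n z n) = 1"
        unfolding elem_sym_top prod_norm[symmetric] using z1 by (intro prod.neutral) auto
      have "elem_sym n z (n - i) = cnj (elem_sym n z i) * elem_sym n z n"
        using elem_sym_torus[of n z i, OF z1] i by simp
      then have "g z = elem_sym n z n * (1 + complex_of_real t * (a - cnj a))"
        by (simp add: g_def a_def algebra_simps)
      then have "cmod (g z) = cmod (1 + complex_of_real t * (a - cnj a))" using u by (simp add: norm_mult)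
      also have "1 + complex_of_real t * (a - cnj a) = Complex 1 (2 * t * Im a)"
        by (simp add: complex_eq_iff)
      also have "cmod (Complex 1 (2 * t * Im a)) = sqrt (1 + 4 * t\<^sup>2 * (Im a)\<^sup>2)"
        by (simp add: cmod_def power_mult_distrib)
      also have "\<dots> \<le> sqrt (1 + 4 * t\<^sup>2 * C\<^sup>2)"
      proof -
        have "\<bar>Im a\<bar> \<le> C"
          using abs_Im_le_cmod[of a] elem_sym_bound[of n z i] z1 e unfolding a_def C_def norm_mult by force
        then have "(Im a)\<^sup>2 \<le> C\<^sup>2" using power_mono[of "\<bar>Im a\<bar>" C 2] by simp
        then show ?thesis by (simp add: mult_left_mono)
      qed
      finally show ?thesis .
    qed
  qed (use z in auto)
  then show ?thesis unfolding g_def z(2) using ni by (simp only: sym_map_elem_sym)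
qed

section \<open>The adjoint tuple and restrictions\<close>

lemma (in gamma_tuple) restrict_invariant:
  assumes N: "closed_csubspace N" "N \<subseteq> M" "\<And>i. i \<in> {1..n} \<Longrightarrow> T i ` N \<subseteq> N"
  shows "gamma_tuple n N T"
proof
  show "commuting_tuple_on n N T"
    unfolding commuting_tuple_on_def using bounded_op_on_subspace[OF bnd N(2,3)] comm N(2) by blast
  fix p c x
  assume "poly_vars_le n p" "\<And>s. s \<in> Gamma_set n \<Longrightarrow> cmod (poly_eval n p s) \<le> c" "x \<in> N"
  then show "norm (poly_op n p T x) \<le> c * norm x" using N(2) by (intro vn) auto
qed (rule N)

text \<open>The operator \<open>p(T\<^sup>*)\<close> is the adjoint of the polynomial with conjugated coefficients at \<open>T\<close>, and complex conjugation maps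
  \<open>\<Gamma>\<^sub>n\<close> to itself.\<close>

lemma gamma_tuple_adjoint:
  assumes "gamma_tuple n UNIV T"
  shows "gamma_tuple n UNIV (\<lambda>i. cadjoint (T i))"
proof -
  interpret gamma_tuple n UNIV T by fact
  have ct': "commuting_tuple_on n UNIV (\<lambda>i. cadjoint (T i))"
    unfolding commuting_tuple_on_def
  proof (intro conjI ballI)
    fix i assume i: "i \<in> {1..n}"
    show "bounded_op_on UNIV (cadjoint (T i))" by (rule bounded_cadjoint[OF bnd[OF i]])
    fix j x assume j: "j \<in> {1..n}"
    show "cadjoint (T i) (cadjoint (T j) x) = cadjoint (T j) (cadjoint (T i) x)"
      by (rule cadjoint_commute[OF bnd[OF i] bnd[OF j] comm[OF i j UNIV_I]])
  qed
  show ?thesis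
  proof
    fix p c x
    assume p: "poly_vars_le n p" and c: "\<And>s. s \<in> Gamma_set n \<Longrightarrow> cmod (poly_eval n p s) \<le> c"
    define z where "z = poly_op n p (\<lambda>i. cadjoint (T i)) x"
    have "cmod (poly_eval n (cpoly_cnj p) s) \<le> c" if s: "s \<in> Gamma_set n" for s
    proof -
      have "poly_eval n p (\<lambda>i. cnj (s i)) = poly_eval n p (\<lambda>i\<in>{1..n}. cnj (s i))"
        by (rule poly_eval_cong) simp
      then show ?thesis using c[OF Gamma_set_cnj[OF s]] by (simp add: poly_eval_cnj)
    qed
    then have bound: "norm (poly_op n (cpoly_cnj p) T z) \<le> c * norm z"
      by (intro vn poly_vars_le_cnj p) auto
    have "cinner (poly_op n (cpoly_cnj p) T z) x = cinner z z"
      unfolding z_def by (rule cinner_poly_op_adjoint[OF ct ct' cinner_cadjoint[OF bnd]])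
    then have "(norm z)\<^sup>2 = cmod (cinner (poly_op n (cpoly_cnj p) T z) x)"
      by (simp add: cinner_self norm_power)
    also have "\<dots> \<le> norm (poly_op n (cpoly_cnj p) T z) * norm x" by (rule cauchy_schwarz)
    also have "\<dots> \<le> c * norm z * norm x" by (intro mult_right_mono bound) simp
    finally have *: "norm z * norm z \<le> norm z * (c * norm x)" by (simp add: power2_eq_square mult_ac)
    obtain s where "s \<in> Gamma_set n" using Gamma_set_nonempty by blast
    then have "0 \<le> c" using c norm_ge_zero order_trans by blast
    then show "norm (poly_op n p (\<lambda>i. cadjoint (T i)) x) \<le> c * norm x"
      unfolding z_def[symmetric] using * by (cases "norm z = 0") (auto simp: mult_le_cancel_left)
  qed (simp, rule ct')
qed

lemma orthogonal_decomposition_complement: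
  assumes "orthogonal_decomposition M N"
  shows "N = {z. \<forall>x\<in>M. cinner x z = 0}"
proof (intro subset_antisym subsetI)
  fix z assume z: "z \<in> {z. \<forall>x\<in>M. cinner x z = 0}"
  obtain x y where xy: "x \<in> M" "y \<in> N" "z = x + y"
    using assms unfolding orthogonal_decomposition_def by blast
  moreover have "cinner x y = 0" using assms xy unfolding orthogonal_decomposition_def by blast
  ultimately have "cinner x x = 0" using z by (auto simp: cinner_add_right)
  then show "z \<in> N" using xy by simp
qed (use assms in \<open>auto simp: orthogonal_decomposition_def\<close>)

section \<open>Doubly commuting tuples\<close>

locale doubly_commuting =
  fixes n :: nat and T :: "nat \<Rightarrow> 'a::chilbert_space \<Rightarrow> 'a"
  assumes n: "2 \<le> n" and Gamma: "cnu_Gamma_contraction_on n UNIV T"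
    and dc: "\<And>i x. i \<in> {1..<n} \<Longrightarrow> cadjoint (T n) (T i x) = T i (cadjoint (T n) x)"
begin

sublocale gamma_tuple n UNIV T
  using Gamma_contraction_vn Gamma unfolding cnu_Gamma_contraction_on_def by blast

sublocale cnu_contraction "T n"
  using Gamma unfolding cnu_Gamma_contraction_on_def by unfold_locales (auto simp: cnu_contraction_on_def)

abbreviation "P \<equiv> T n"

lemma nn: "n \<in> {1..n}" and lt: "i \<in> {1..<n} \<Longrightarrow> i \<in> {1..n}" and refl_lt: "i \<in> {1..<n} \<Longrightarrow> n - i \<in> {1..<n}"
  using n by auto

lemma T_P: "i \<in> {1..n} \<Longrightarrow> T i (P x) = P (T i x)"
  using comm nn by blast

lemma adjoint_T_P:
  assumes i: "i \<in> {1..<n}"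
  shows "cadjoint (T i) (P x) = P (cadjoint (T i) x)"
proof -
  have "cadjoint (T i) (cadjoint P' x) = cadjoint P' (cadjoint (T i) x)"
    by (rule cadjoint_commute[OF bnd[OF lt[OF i]] bP']) (simp add: dc[OF i])
  then show ?thesis unfolding cadjoint_cadjoint[OF bP] .
qed

lemma adjoint_T_P':
  assumes i: "i \<in> {1..<n}"
  shows "cadjoint (T i) (P' x) = P' (cadjoint (T i) x)"
  by (rule cadjoint_commute[OF bnd[OF lt[OF i]] bP]) (rule T_P[OF lt[OF i]])

lemma isometric_part_T: "i \<in> {1..n} \<Longrightarrow> x \<in> isometric_part \<Longrightarrow> T i x \<in> isometric_part"
proof (cases "i = n")
  case False
  assume i: "i \<in> {1..n}" and x: "x \<in> isometric_part"
  then have "i \<in> {1..<n}" using False by auto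
  then show ?thesis
    by (intro isometric_part_commuting[of "T i"]) (simp_all add: T_P[OF i] dc x)
qed (simp add: isometric_part_P)

lemma isometric_part_adjoint_T:
  "i \<in> {1..<n} \<Longrightarrow> x \<in> isometric_part \<Longrightarrow> cadjoint (T i) x \<in> isometric_part"
  by (rule isometric_part_commuting[of "cadjoint (T i)"]) (simp_all add: adjoint_T_P adjoint_T_P')

text \<open>Von Neumann's inequality for the test function \<open>s\<^sub>n + t (e s\<^sub>i s\<^sub>n - e\<^sup>* s\<^sub>n\<^sub>-\<^sub>i)\<close>, whose sup norm is
  \<open>1 + O(t\<^sup>2)\<close>, at a vector \<open>x\<close> with \<open>\<parallel>P x\<parallel> = \<parallel>x\<parallel>\<close>: the first order term in \<open>t\<close> cannot be positive, for any
  unimodular \<open>e\<close>.\<close>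

lemma fundamental_relation_quadratic:
  assumes i: "i \<in> {1..<n}" and x: "x \<in> isometric_part"
  shows "cinner (T i x) x = cinner (P x) (T (n - i) x)"
proof -
  define c where "c = cinner (T i x) x - cinner (P x) (T (n - i) x)"
  define C where "C = real (card {J. J \<subseteq> {1..n} \<and> card J = i})"
  have ii: "i \<in> {1..n}" "n - i \<in> {1..n}" using i by auto
  have le0: "Re (e * c) \<le> 0" if e: "cmod e = 1" for e
  proof -
    define v where "v = e *\<^sub>C T i (P x) - cnj e *\<^sub>C T (n - i) x"
    have first: "Re (cinner (P x) v) = Re (e * c)"
    proof -
      have "cinner (T i (P x)) (P x) = cinner (T i x) x"
        unfolding T_P[OF ii(1)] adj isometric_part_P'P[OF x] ..
      then have "cinner v (P x) = e * cinner (T i x) x - cnj e * cinner (T (n - i) x) (P x)"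
        by (simp add: v_def cinner_diff_left cinner_scaleC_left)
      moreover have "cnj e * cinner (T (n - i) x) (P x) = cnj (e * cinner (P x) (T (n - i) x))"
        unfolding complex_cnj_mult cinner_commute[of "T (n - i) x" "P x"] ..
      ultimately have "Re (cinner v (P x)) = Re (e * c)"
        by (simp only: c_def right_diff_distrib minus_complex.simps cnj.simps)
      then show ?thesis by (metis cinner_commute cnj.simps(1))
    qed
    have bound: "Re (e * c) \<le> 2 * t * C\<^sup>2 * (norm x)\<^sup>2" if t: "t > 0" for t
    proof -
      define p where "p = cvar n + cconst (complex_of_real t) *
        (cconst e * cvar i * cvar n + cconst (- cnj e) * cvar (n - i))"
      have "norm (poly_op n p T x) \<le> sqrt (1 + 4 * t\<^sup>2 * C\<^sup>2) * norm x"
      proof (rule vn)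
        show "poly_vars_le n p" unfolding p_def
          by (intro poly_vars_le_add poly_vars_le_mult poly_vars_le_const poly_vars_le_var nn ii)
        fix s assume s: "s \<in> Gamma_set n"
        have "poly_eval n p s = s n + complex_of_real t * (e * s i * s n - cnj e * s (n - i))"
          unfolding p_def poly_eval_add poly_eval_mult poly_eval_const poly_eval_var[OF nn]
            poly_eval_var[OF ii(1)] poly_eval_var[OF ii(2)] by simp
        then show "cmod (poly_eval n p s) \<le> sqrt (1 + 4 * t\<^sup>2 * C\<^sup>2)"
          unfolding C_def using test_function_bound[OF s i e] by simp
      qed simp
      moreover have "poly_op n p T x = P x + complex_of_real t *\<^sub>C v"
        unfolding p_def poly_op_add poly_op_mult[OF UNIV_I] poly_op_const poly_op_var[OF nn]
          poly_op_var[OF ii(1)] poly_op_var[OF ii(2)] v_def by simp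
      ultimately have "(norm (P x + complex_of_real t *\<^sub>C v))\<^sup>2 \<le> (sqrt (1 + 4 * t\<^sup>2 * C\<^sup>2) * norm x)\<^sup>2"
        by (intro power_mono) auto
      also have "\<dots> = (norm x)\<^sup>2 + 4 * t\<^sup>2 * C\<^sup>2 * (norm x)\<^sup>2"
        by (simp add: power_mult_distrib distrib_right)
      finally have "(norm x)\<^sup>2 + 2 * t * Re (e * c) + (norm (complex_of_real t *\<^sub>C v))\<^sup>2
          \<le> (norm x)\<^sup>2 + 4 * t\<^sup>2 * C\<^sup>2 * (norm x)\<^sup>2"
        unfolding norm_add_sq isometric_part_norm[OF x] using first by (simp add: cinner_scaleC_right)
      moreover have "0 \<le> (norm (complex_of_real t *\<^sub>C v))\<^sup>2" by simp
      ultimately have "2 * t * Re (e * c) \<le> 4 * t\<^sup>2 * C\<^sup>2 * (norm x)\<^sup>2" by linarith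
      then have "(2 * t) * Re (e * c) \<le> (2 * t) * (2 * t * C\<^sup>2 * (norm x)\<^sup>2)"
        by (simp add: power2_eq_square mult_ac)
      then show ?thesis using t by (simp add: mult_le_cancel_left)
    qed
    have "((\<lambda>t. 2 * t * C\<^sup>2 * (norm x)\<^sup>2) \<longlongrightarrow> 2 * 0 * C\<^sup>2 * (norm x)\<^sup>2) (at_right 0)"
      by (intro tendsto_intros)
    moreover have "\<forall>\<^sub>F t in at_right 0. Re (e * c) \<le> 2 * t * C\<^sup>2 * (norm x)\<^sup>2"
      using eventually_at_right_less[of 0] by (rule eventually_mono) (rule bound)
    ultimately have "Re (e * c) \<le> 2 * 0 * C\<^sup>2 * (norm x)\<^sup>2"
      by (rule tendsto_lowerbound) simp
    then show ?thesis by simp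
  qed
  have "c = 0"
  proof (rule ccontr)
    assume c: "c \<noteq> 0"
    \<comment> \<open>The rotation that makes \<open>e c\<close> positive.\<close>
    define e where "e = cnj c / complex_of_real (cmod c)"
    have "cmod e = 1" using c by (simp add: e_def norm_divide)
    moreover have "e * c = complex_of_real (cmod c)"
      using c complex_norm_square[of c] by (simp add: e_def power2_eq_square field_simps)
    ultimately show False using le0[of e] c by simp
  qed
  then show ?thesis by (simp add: c_def)
qed

text \<open>Both sides leave the isometric part invariant, and their quadratic forms agree there.\<close>

lemma fundamental_relation:
  assumes i: "i \<in> {1..<n}" and x: "x \<in> isometric_part"
  shows "T i x = P (cadjoint (T (n - i)) x)"
proof -
  have b: "bounded_op_on UNIV (\<lambda>x. T i x - cadjoint (T (n - i)) (P x))"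
    by (rule bounded_op_on_diff[OF csubspace_UNIV bnd[OF lt[OF i]]
          bounded_op_on_comp[OF bounded_cadjoint[OF bnd[OF lt[OF refl_lt[OF i]]]] bP]])
  have "T i x - cadjoint (T (n - i)) (P x) = 0"
  proof (rule quadratic_form_zero[OF isometric_part_closed _ _ _ x])
    show "clinear_on isometric_part (\<lambda>x. T i x - cadjoint (T (n - i)) (P x))"
      using bounded_op_onD(1)[OF b] by (simp add: clinear_on_def)
    show "(\<lambda>x. T i x - cadjoint (T (n - i)) (P x)) ` isometric_part \<subseteq> isometric_part"
      using isometric_part_T[OF lt[OF i]] isometric_part_adjoint_T[OF refl_lt[OF i]] isometric_part_P
      by (auto intro!: csubspace_diff isometric_part_closed)
    fix y assume "y \<in> isometric_part"
    then show "cinner (T i y - cadjoint (T (n - i)) (P y)) y = 0"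
      using fundamental_relation_quadratic[OF i, of y] cinner_cadjoint'[OF bnd[OF lt[OF refl_lt[OF i]]], of "P y" y]
      by (simp add: cinner_diff_left)
  qed
  then show ?thesis using adjoint_T_P[OF refl_lt[OF i], of x] by simp
qed

text \<open>Taking adjoints in \<open>S\<^sub>j = P S\<^sub>n\<^sub>-\<^sub>j\<^sup>*\<close> on the isometric part \<open>M\<close> gives \<open>S\<^sub>j\<^sup>* = S\<^sub>n\<^sub>-\<^sub>j (P|\<^sub>M)\<^sup>*\<close>, and
  inserting this for \<open>j = n - i\<close> gives \<open>S\<^sub>i = P S\<^sub>i (P|\<^sub>M)\<^sup>*\<close>. Iteration shows that the range of
  \<open>S\<^sub>i\<close> on \<open>M\<close> is contained in \<open>P\<^sup>k M\<close> for all \<open>k\<close>.\<close>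

lemma isometric_part_T_zero:
  assumes i: "i \<in> {1..<n}" and x: "x \<in> isometric_part"
  shows "T i x = 0"
proof -
  define Q where "Q = adjoint_on isometric_part P"
  note memQ = adjoint_on_mem[OF isometric_part_closed bounded_P_isometric_part, folded Q_def]
  note adjQ = cinner_adjoint_on[OF isometric_part_closed bounded_P_isometric_part, folded Q_def]
  define j where "j = n - i"
  have j: "j \<in> {1..<n}" "n - j = i" unfolding j_def using i refl_lt by auto
  have "cadjoint (T j) x = T i (Q x)" if x: "x \<in> isometric_part" for x
  proof (rule cinner_ext_on[OF isometric_part_closed isometric_part_adjoint_T[OF j(1) x]
        isometric_part_T[OF lt[OF i] memQ]])
    fix z assume z: "z \<in> isometric_part"
    have "cinner z (cadjoint (T j) x) = cinner (T j z) x" by (rule cinner_cadjoint[OF bnd[OF lt[OF j(1)]], symmetric])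
    also have "\<dots> = cinner (cadjoint (T i) z) (Q x)"
      unfolding fundamental_relation[OF j(1) z] j(2) by (rule adjQ[OF isometric_part_adjoint_T[OF i z]])
    also have "\<dots> = cinner z (T i (Q x))" by (rule cinner_cadjoint'[OF bnd[OF lt[OF i]], symmetric])
    finally show "cinner z (cadjoint (T j) x) = cinner z (T i (Q x))" .
  qed
  then have rec: "T i x = P (T i (Q x))" if "x \<in> isometric_part" for x
    using fundamental_relation[OF i that] that unfolding j_def by simp
  have "\<exists>v\<in>isometric_part. T i x = (P ^^ k) v" for k
    using x
  proof (induction k arbitrary: x)
    case 0
    then show ?case using isometric_part_T[OF lt[OF i]] by auto
  next
    case (Suc k)
    obtain v where "v \<in> isometric_part" "T i (Q x) = (P ^^ k) v" using Suc.IH[OF memQ] by blast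
    then show ?case using rec[OF Suc.prems] by auto
  qed
  then show ?thesis by (rule isometric_part_pure)
qed

lemma isometric_part_Gamma_isometry: "cnu_Gamma_isometry_on n isometric_part T"
proof -
  interpret iso: isometry_on_subspace isometric_part P
    by unfold_locales
       (auto simp: isometric_part_closed isometry_on_def bounded_P_isometric_part isometric_part_norm)
  have "Gamma_isometry_on n isometric_part T"
    using n isometric_part_T_zero by (intro iso.Gamma_isometry) auto
  then show ?thesis
    unfolding cnu_Gamma_isometry_on_def using cnu_restrict[OF bounded_P_isometric_part] by simp
qed

text \<open>The last component of a \<open>\<Gamma>\<^sub>n\<close>-isometry is the restriction of an isometric operator.\<close>

lemma Gamma_isometry_subset_isometric_part:
  assumes inv: "joint_invariant n N T" and iso: "Gamma_isometry_on n N T"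
  shows "N \<subseteq> isometric_part"
proof (rule isometric_part_greatest)
  show PN: "P ` N \<subseteq> N" using inv nn by (auto simp: joint_invariant_def)
  fix x assume x: "x \<in> N"
  obtain K :: "'a l2 set" and U V where
    K: "closed_csubspace K" "Gamma_unitary_on n K U" "\<forall>x\<in>N. norm (V x) = norm x" "V ` N \<subseteq> K"
      "\<forall>i\<in>{1..n}. \<forall>x\<in>N. U i (V x) = V (T i x)"
    using iso unfolding Gamma_isometry_on_def by blast
  have "norm (P x) = norm (V (P x))" using K(3) PN x by auto
  also have "\<dots> = norm (U n (V x))" using K(5) nn x by auto
  also have "\<dots> = norm (V x)"
    using Gamma_unitary_last_isometric[OF _ K(1,2), of "V x"] n x K(4) by auto
  finally show "norm (P x) = norm x" using K(3) x by simp
qed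

lemma maximal_cnu_Gamma_isometry_subspace_iff:
  "maximal_cnu_Gamma_isometry_subspace n T M \<longleftrightarrow> M = isometric_part"
proof -
  let ?Q = "\<lambda>M. joint_invariant n M T \<and> cnu_Gamma_isometry_on n M T"
  have Q: "?Q isometric_part"
    using isometric_part_T isometric_part_Gamma_isometry by (auto simp: joint_invariant_def)
  have le: "N \<subseteq> isometric_part" if "?Q N" for N
    using that Gamma_isometry_subset_isometric_part unfolding cnu_Gamma_isometry_on_def by blast
  show ?thesis
    unfolding maximal_cnu_Gamma_isometry_subspace_def maximal_subspace_def
    using Q le isometric_part_closed by (metis subset_antisym)
qed

text \<open>A vector of a larger admissible subspace has a component in the isometric part, which belongs to that
  subspace as well and must vanish, since \<open>lim \<parallel>P\<^sup>k a\<parallel> = \<parallel>a\<parallel>\<close> on the isometric part.\<close>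

lemma maximal_cosubspace:
  assumes od: "orthogonal_decomposition isometric_part H"
  shows "maximal_cnu_Gamma_contraction_cosubspace n T H"
proof -
  let ?A = "\<lambda>i. cadjoint (T i)"
  have H: "H = {z. \<forall>x\<in>isometric_part. cinner x z = 0}" by (rule orthogonal_decomposition_complement[OF od])
  have Hc: "closed_csubspace H" using od by (simp add: orthogonal_decomposition_def)
  have inv: "?A i ` H \<subseteq> H" if "i \<in> {1..n}" for i
    unfolding H using isometric_part_T[OF that] by (auto simp flip: cinner_cadjoint[OF bnd[OF that]])
  have "gamma_tuple n H ?A"
    by (rule gamma_tuple.restrict_invariant[OF gamma_tuple_adjoint[OF gamma_tuple_axioms] Hc _ inv]) auto
  then have "Gamma_contraction_on n H ?A" by (rule gamma_tuple.Gamma_contraction)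
  moreover have "cnu_contraction_on H (?A n)"
    by (intro cnu_restrict_adjoint bounded_op_on_subspace[OF bP' _ inv] nn) auto
  moreover have "lim (\<lambda>k. norm ((P ^^ k) x)) < norm x" if "x \<in> H" "x \<noteq> 0" for x
  proof -
    have "x \<notin> isometric_part" using that unfolding H by auto
    then show ?thesis by (simp add: lim_norm_less_iff)
  qed
  moreover have "N = H"
    if N: "closed_csubspace N" "H \<subseteq> N" "\<forall>x\<in>N. x \<noteq> 0 \<longrightarrow> lim (\<lambda>k. norm ((P ^^ k) x)) < norm x" for N
  proof (intro subset_antisym N(2) subsetI)
    fix x assume x: "x \<in> N"
    obtain a b where ab: "a \<in> isometric_part" "b \<in> H" "x = a + b"
      using od unfolding orthogonal_decomposition_def by blast
    have "x - b \<in> N" using x ab(2) N(1,2) by (intro csubspace_diff) auto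
    then have "a \<in> N" using ab(3) by simp
    then have "a = 0" using N(3) ab(1) lim_norm_less_iff by blast
    then show "x \<in> H" using ab by simp
  qed
  ultimately show ?thesis
    unfolding maximal_cnu_Gamma_contraction_cosubspace_def maximal_subspace_def
      cnu_Gamma_contraction_on_def joint_invariant_def
    by (intro conjI allI impI ballI Hc inv) (elim conjE, assumption | blast)+
qed

end

theorem theorem4p11:
  fixes n :: nat
    and S :: "nat \<Rightarrow> 'a::chilbert_space \<Rightarrow> 'a"
    and P :: "'a \<Rightarrow> 'a"
    and H1 H2 :: "'a set"
  assumes "n \<ge> 2"
    and "cnu_Gamma_contraction_on n UNIV (S(n := P))"
    and "\<forall>i\<in>{1..n-1}. cadjoint P \<circ> S i = S i \<circ> cadjoint P"
    and "orthogonal_decomposition H1 H2"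
    and "maximal_cnu_isometry_subspace P H1"
  shows "maximal_cnu_Gamma_isometry_subspace n (S(n := P)) H1
    \<and> maximal_cnu_Gamma_contraction_cosubspace n (S(n := P)) H2
    \<and> (\<forall>L1 L2. orthogonal_decomposition L1 L2 \<and>
         (maximal_cnu_isometry_subspace P L1 \<or> maximal_cnu_Gamma_isometry_subspace n (S(n := P)) L1)
         \<longrightarrow> L1 = H1 \<and> L2 = H2)"
proof -
  have "cadjoint P (S i x) = S i (cadjoint P x)" if "i \<in> {1..<n}" for i x
  proof -
    have "i \<in> {1..n-1}" using that by auto
    then show ?thesis using fun_cong[OF assms(3)[rule_format], of i x] by simp
  qed
  then interpret doubly_commuting n "S(n := P)"
    using assms(1,2) by unfold_locales auto
  have iso: "maximal_cnu_isometry_subspace P M \<longleftrightarrow> M = isometric_part" for M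
    using maximal_cnu_isometry_subspace_iff by simp
  have H1: "H1 = isometric_part" using assms(5) iso by simp
  have "L2 = H2" if "orthogonal_decomposition H1 L2" for L2
    using orthogonal_decomposition_complement[OF that] orthogonal_decomposition_complement[OF assms(4)] by simp
  moreover have "maximal_cnu_Gamma_contraction_cosubspace n (S(n := P)) H2"
    using maximal_cosubspace assms(4) H1 by simp
  ultimately show ?thesis
    using iso maximal_cnu_Gamma_isometry_subspace_iff H1 by auto
qed

end
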